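(* Let $(M,g)$ be a Riemannian manifold of dimension $n$ and let $\mathcal{F}_O$ be its orthonormal frame bundle. Then there exists a unique connection on $\mathcal{F}_O$ that is torsion-free.
   Context: $\mathcal{F}_O$ is the principal $O(n)$-bundle $\pi:\mathcal{F}_O\to M$ whose points over $x\in M$ are the linear isometries $u:\mathbb{R}^n\to T_xM$ (equivalently, $g$-orthonormal bases of $T_xM$); $O(n)$ acts on the right by $(ug)(v)=u(gv)$, and $R_g(u)=ug$. A connection on a principal $G$-bundle $P$ (with Lie algebra $\mathfrak{g}$ of $G$) is a smooth $G$-invariant distribution $A\subseteq TP$ such that $\pi_*:A_u\to T_{\pi(u)}M$ is an isomorphism for every $u\in P$. Its connection form $\phi$ is the $\mathfrak{g}$-valued $1$-form on $P$ that vanishes on $A$ and satisfies $\phi(X^* )=X$ for all $X\in\mathfrak{g}$, where $X^*_u=\frac{d}{dt}(u\exp(tX))|_{t=0}$. The canonical $\mathbb{R}^n$-valued $1$-form $\omega$ on $\mathcal{F}_O$ is $\omega(X)=u^{-1}(\pi_*X)$ for $X\in T_u\mathcal{F}_O$. The torsion of a connection with connection form $\phi$ on $\mathcal{F}_O$ is the $\mathbb{R}^n$-valued $2$-form $\Theta=d\omega+\phi\wedge\omega$, i.e. $\Theta(X,Y)=d\omega(X,Y)+\phi(X)\omega(Y)-\phi(Y)\omega(X)$, where $\mathfrak{so}(n)$ acts on $\mathbb{R}^n$ by matrix multiplication. The connection is torsion-free if $\Theta=0$. *)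

theory Defs
  imports "HOL-Analysis.Analysis" "HOL-Library.Function_Algebras"
begin

subsection \<open>Pointwise real vector space structure on functions\<close>

instantiation "fun" :: (type, real_vector) real_vector
begin

definition scaleR_fun :: "real \<Rightarrow> ('a \<Rightarrow> 'b) \<Rightarrow> 'a \<Rightarrow> 'b"
  where "scaleR_fun a f = (\<lambda>x. a *\<^sub>R f x)"

instance
  by standard (auto simp: scaleR_fun_def fun_eq_iff scaleR_add_right scaleR_add_left)

end


subsection \<open>Smooth maps between open subsets of normed spaces\<close>

text \<open>Both notions below are meant for open \<open>S\<close>.\<close>

primrec Ck_on :: "nat \<Rightarrow> ('e::real_normed_vector \<Rightarrow> 'f::real_normed_vector) \<Rightarrow> 'e set \<Rightarrow> bool"
  where
    "Ck_on 0 f S \<longleftrightarrow> continuous_on S f"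
  | "Ck_on (Suc k) f S \<longleftrightarrow>
      (\<forall>x\<in>S. f differentiable (at x)) \<and>
      (\<forall>v. Ck_on k (\<lambda>x. frechet_derivative f (at x) v) S)"

definition smooth_on :: "('e::real_normed_vector \<Rightarrow> 'f::real_normed_vector) \<Rightarrow> 'e set \<Rightarrow> bool"
  where "smooth_on f S \<longleftrightarrow> (\<forall>k. Ck_on k f S)"


subsection \<open>Smooth manifolds given by an atlas\<close>

text \<open>
  A chart is a domain together with a coordinate map; the values of the coordinate map outside the
  domain are irrelevant.  A manifold is given by an atlas, which determines its set of points, its
  topology and its smooth structure.
\<close>

type_synonym ('p, 'e) chart = "'p set \<times> ('p \<Rightarrow> 'e)"

definition chart_inv :: "('p, 'e) chart \<Rightarrow> 'e \<Rightarrow> 'p"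
  where "chart_inv c = inv_into (fst c) (snd c)"

definition transition :: "('p, 'e) chart \<Rightarrow> ('p, 'e) chart \<Rightarrow> 'e \<Rightarrow> 'e"
  where "transition c d = snd d \<circ> chart_inv c"

definition points :: "('p, 'e) chart set \<Rightarrow> 'p set"
  where "points \<A> = \<Union> (fst ` \<A>)"

definition smooth_atlas :: "('p, 'e::euclidean_space) chart set \<Rightarrow> bool"
  where "smooth_atlas \<A> \<longleftrightarrow>
    (\<forall>c\<in>\<A>. inj_on (snd c) (fst c) \<and> open (snd c ` fst c)) \<and>
    (\<forall>c\<in>\<A>. \<forall>d\<in>\<A>. open (snd c ` (fst c \<inter> fst d)) \<and>
      smooth_on (transition c d) (snd c ` (fst c \<inter> fst d)))"

definition manifold_topology :: "('p, 'e::euclidean_space) chart set \<Rightarrow> 'p topology"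
  where "manifold_topology \<A> =
    topology (\<lambda>W. W \<subseteq> points \<A> \<and> (\<forall>c\<in>\<A>. open (snd c ` (fst c \<inter> W))))"

lemma openin_manifold_topology:
  assumes "smooth_atlas \<A>"
  shows "openin (manifold_topology \<A>) W \<longleftrightarrow>
    W \<subseteq> points \<A> \<and> (\<forall>c\<in>\<A>. open (snd c ` (fst c \<inter> W)))"
proof -
  have "istopology (\<lambda>W. W \<subseteq> points \<A> \<and> (\<forall>c\<in>\<A>. open (snd c ` (fst c \<inter> W))))"
    unfolding istopology_def
  proof (intro conjI allI impI ballI)
    fix S T c
    assume S: "S \<subseteq> points \<A> \<and> (\<forall>c\<in>\<A>. open (snd c ` (fst c \<inter> S)))"
      and T: "T \<subseteq> points \<A> \<and> (\<forall>c\<in>\<A>. open (snd c ` (fst c \<inter> T)))"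
    then show "S \<inter> T \<subseteq> points \<A>" by auto
    assume c: "c \<in> \<A>"
    have "snd c ` (fst c \<inter> (S \<inter> T)) = snd c ` (fst c \<inter> S) \<inter> snd c ` (fst c \<inter> T)"
      using assms c unfolding smooth_atlas_def inj_on_def by blast
    with S T c show "open (snd c ` (fst c \<inter> (S \<inter> T)))" by auto
  next
    fix \<K> c
    assume K: "\<forall>K\<in>\<K>. K \<subseteq> points \<A> \<and> (\<forall>c\<in>\<A>. open (snd c ` (fst c \<inter> K)))"
    then show "\<Union> \<K> \<subseteq> points \<A>" by auto
    assume c: "c \<in> \<A>"
    have "snd c ` (fst c \<inter> \<Union> \<K>) = (\<Union>K\<in>\<K>. snd c ` (fst c \<inter> K))" by auto
    with K c show "open (snd c ` (fst c \<inter> \<Union> \<K>))" by auto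
  qed
  then show ?thesis unfolding manifold_topology_def by simp
qed

definition smooth_manifold :: "('p, 'e::euclidean_space) chart set \<Rightarrow> bool"
  where "smooth_manifold \<A> \<longleftrightarrow> smooth_atlas \<A> \<and>
    Hausdorff_space (manifold_topology \<A>) \<and> second_countable (manifold_topology \<A>)"

text \<open>Openness of the sets \<open>D\<close> below expresses continuity of \<open>f\<close>.\<close>

definition smooth_map ::
  "('p, 'e::euclidean_space) chart set \<Rightarrow> ('q, 'f::euclidean_space) chart set \<Rightarrow> ('p \<Rightarrow> 'q) \<Rightarrow> bool"
  where "smooth_map \<A> \<B> f \<longleftrightarrow> f ` points \<A> \<subseteq> points \<B> \<and>
    (\<forall>c\<in>\<A>. \<forall>d\<in>\<B>. let D = snd c ` {p \<in> fst c. f p \<in> fst d} in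
      open D \<and> smooth_on (snd d \<circ> f \<circ> chart_inv c) D)"


subsection \<open>Tangent vectors\<close>

text \<open>
  A tangent vector at \<open>p\<close> is the family of its coordinate vectors in all charts around \<open>p\<close>, related
  by the derivatives of the transition maps (and \<open>0\<close> by convention at all other charts).
\<close>

type_synonym ('p, 'e) tvec = "('p, 'e) chart \<Rightarrow> 'e"

definition tangent_space ::
  "('p, 'e::euclidean_space) chart set \<Rightarrow> 'p \<Rightarrow> ('p, 'e) tvec set"
  where "tangent_space \<A> p = {X.
    (\<forall>c. \<not> (c \<in> \<A> \<and> p \<in> fst c) \<longrightarrow> X c = 0) \<and>
    (\<forall>c\<in>\<A>. \<forall>d\<in>\<A>. p \<in> fst c \<inter> fst d \<longrightarrow>
      X d = frechet_derivative (transition c d) (at (snd c p)) (X c))}"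

text \<open>The tangent vector at \<open>p\<close> whose coordinate vector in the chart \<open>c\<close> is \<open>v\<close>.\<close>

definition coord_vec ::
  "('p, 'e::euclidean_space) chart set \<Rightarrow> ('p, 'e) chart \<Rightarrow> 'p \<Rightarrow> 'e \<Rightarrow> ('p, 'e) tvec"
  where "coord_vec \<A> c p v = (\<lambda>d. if d \<in> \<A> \<and> p \<in> fst d
    then frechet_derivative (transition c d) (at (snd c p)) v else 0)"

text \<open>An arbitrary chart around \<open>p\<close>; what is defined with it does not depend on the choice.\<close>

definition chart_at :: "('p, 'e) chart set \<Rightarrow> 'p \<Rightarrow> ('p, 'e) chart"
  where "chart_at \<A> p = (SOME c. c \<in> \<A> \<and> p \<in> fst c)"

definition pushforward ::
  "('p, 'e::euclidean_space) chart set \<Rightarrow> ('q, 'f::euclidean_space) chart set \<Rightarrow>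
    ('p \<Rightarrow> 'q) \<Rightarrow> 'p \<Rightarrow> ('p, 'e) tvec \<Rightarrow> ('q, 'f) tvec"
  where "pushforward \<A> \<B> f p X = (let c = chart_at \<A> p in
    (\<lambda>d. if d \<in> \<B> \<and> f p \<in> fst d
      then frechet_derivative (snd d \<circ> f \<circ> chart_inv c) (at (snd c p)) (X c) else 0))"

definition velocity ::
  "('p, 'e::euclidean_space) chart set \<Rightarrow> (real \<Rightarrow> 'p) \<Rightarrow> real \<Rightarrow> ('p, 'e) tvec"
  where "velocity \<A> \<gamma> t = (\<lambda>c. if c \<in> \<A> \<and> \<gamma> t \<in> fst c
    then vector_derivative (snd c \<circ> \<gamma>) (at t) else 0)"


subsection \<open>Vector fields and one-forms on open subsets of a manifold\<close>

definition smooth_vector_field ::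
  "('p, 'e::euclidean_space) chart set \<Rightarrow> 'p set \<Rightarrow> ('p \<Rightarrow> ('p, 'e) tvec) \<Rightarrow> bool"
  where "smooth_vector_field \<A> W E \<longleftrightarrow> (\<forall>p\<in>W. E p \<in> tangent_space \<A> p) \<and>
    (\<forall>c\<in>\<A>. smooth_on (\<lambda>y. E (chart_inv c y) c) (snd c ` (fst c \<inter> W)))"

definition form_coeff ::
  "('p, 'e::euclidean_space) chart set \<Rightarrow> ('p \<Rightarrow> ('p, 'e) tvec \<Rightarrow> 'v) \<Rightarrow>
    ('p, 'e) chart \<Rightarrow> 'e \<Rightarrow> 'e \<Rightarrow> 'v"
  where "form_coeff \<A> \<beta> c v y = \<beta> (chart_inv c y) (coord_vec \<A> c (chart_inv c y) v)"

definition smooth_one_form ::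
  "('p, 'e::euclidean_space) chart set \<Rightarrow> 'p set \<Rightarrow>
    ('p \<Rightarrow> ('p, 'e) tvec \<Rightarrow> 'v::real_normed_vector) \<Rightarrow> bool"
  where "smooth_one_form \<A> W \<beta> \<longleftrightarrow>
    (\<forall>p\<in>W. \<forall>X\<in>tangent_space \<A> p. \<forall>Y\<in>tangent_space \<A> p. \<forall>a.
      \<beta> p (a *\<^sub>R X + Y) = a *\<^sub>R \<beta> p X + \<beta> p Y) \<and>
    (\<forall>c\<in>\<A>. \<forall>v. smooth_on (form_coeff \<A> \<beta> c v) (snd c ` (fst c \<inter> W)))"

text \<open>
  Normalisation: \<open>d\<beta>(X,Y) = X(\<beta>(Y)) - Y(\<beta>(X)) - \<beta>([X,Y])\<close>, written in a chart, where
  the coordinate vectors of \<open>X\<close> and \<open>Y\<close> are extended to constant (hence commuting) vector fields.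
\<close>

definition ext_deriv ::
  "('p, 'e::euclidean_space) chart set \<Rightarrow>
    ('p \<Rightarrow> ('p, 'e) tvec \<Rightarrow> 'v::real_normed_vector) \<Rightarrow>
    'p \<Rightarrow> ('p, 'e) tvec \<Rightarrow> ('p, 'e) tvec \<Rightarrow> 'v"
  where "ext_deriv \<A> \<beta> p X Y = (let c = chart_at \<A> p in
    frechet_derivative (form_coeff \<A> \<beta> c (Y c)) (at (snd c p)) (X c) -
    frechet_derivative (form_coeff \<A> \<beta> c (X c)) (at (snd c p)) (Y c))"


subsection \<open>Calculus on an embedded submanifold\<close>

text \<open>
  Here \<open>S\<close> is the underlying set of an embedded submanifold.  Its tangent vectors are the velocities
  of smooth curves lying in \<open>S\<close>; smooth objects on \<open>S\<close> are those which locally are restrictions of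
  smooth objects on the ambient manifold.
\<close>

definition sub_tangent_space ::
  "('p, 'e::euclidean_space) chart set \<Rightarrow> 'p set \<Rightarrow> 'p \<Rightarrow> ('p, 'e) tvec set"
  where "sub_tangent_space \<A> S p = {velocity \<A> \<gamma> 0 | \<gamma> \<epsilon>.
    \<epsilon> > 0 \<and> smooth_map {({-\<epsilon><..<\<epsilon>}, \<lambda>t. t)} \<A> \<gamma> \<and>
    \<gamma> ` {-\<epsilon><..<\<epsilon>} \<subseteq> S \<and> \<gamma> 0 = p}"

text \<open>\<open>(W, \<beta>)\<close> is a smooth extension of the one-form \<open>\<alpha>\<close> on \<open>S\<close> to an open neighbourhood of \<open>p\<close>.\<close>

definition local_extension ::
  "('p, 'e::euclidean_space) chart set \<Rightarrow> 'p set \<Rightarrow>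
    ('p \<Rightarrow> ('p, 'e) tvec \<Rightarrow> 'v::real_normed_vector) \<Rightarrow> 'p \<Rightarrow>
    'p set \<Rightarrow> ('p \<Rightarrow> ('p, 'e) tvec \<Rightarrow> 'v) \<Rightarrow> bool"
  where "local_extension \<A> S \<alpha> p W \<beta> \<longleftrightarrow>
    openin (manifold_topology \<A>) W \<and> p \<in> W \<and> smooth_one_form \<A> W \<beta> \<and>
    (\<forall>q\<in>W \<inter> S. \<forall>X\<in>sub_tangent_space \<A> S q. \<alpha> q X = \<beta> q X)"

definition sub_smooth_one_form ::
  "('p, 'e::euclidean_space) chart set \<Rightarrow> 'p set \<Rightarrow>
    ('p \<Rightarrow> ('p, 'e) tvec \<Rightarrow> 'v::real_normed_vector) \<Rightarrow> bool"
  where "sub_smooth_one_form \<A> S \<alpha> \<longleftrightarrow> (\<forall>p\<in>S. \<exists>W \<beta>. local_extension \<A> S \<alpha> p W \<beta>)"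

text \<open>
  Since \<open>d\<close> commutes with pullback along the inclusion of \<open>S\<close>, the exterior derivative of \<open>\<alpha>\<close> is
  the restriction of that of any smooth extension.
\<close>

definition sub_ext_deriv ::
  "('p, 'e::euclidean_space) chart set \<Rightarrow> 'p set \<Rightarrow>
    ('p \<Rightarrow> ('p, 'e) tvec \<Rightarrow> 'v::real_normed_vector) \<Rightarrow>
    'p \<Rightarrow> ('p, 'e) tvec \<Rightarrow> ('p, 'e) tvec \<Rightarrow> 'v"
  where "sub_ext_deriv \<A> S \<alpha> p X Y =
    (THE r. \<exists>W \<beta>. local_extension \<A> S \<alpha> p W \<beta> \<and> r = ext_deriv \<A> \<beta> p X Y)"

text \<open>A distribution on \<open>S\<close> is a set \<open>A\<close> of pairs \<open>(p, X)\<close>; its fibre over \<open>p\<close> is \<open>A `` {p}\<close>.\<close>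

definition smooth_distribution ::
  "('p, 'e::euclidean_space) chart set \<Rightarrow> 'p set \<Rightarrow> ('p \<times> ('p, 'e) tvec) set \<Rightarrow> bool"
  where "smooth_distribution \<A> S A \<longleftrightarrow>
    A \<subseteq> Sigma S (sub_tangent_space \<A> S) \<and>
    (\<forall>p\<in>S. subspace (A `` {p})) \<and>
    (\<forall>p\<in>S. \<exists>W (r::nat) E. openin (manifold_topology \<A>) W \<and> p \<in> W \<and>
      (\<forall>i<r. smooth_vector_field \<A> W (E i)) \<and>
      (\<forall>q\<in>W \<inter> S. inj_on (\<lambda>i. E i q) {..<r} \<and> independent ((\<lambda>i. E i q) ` {..<r}) \<and>
        span ((\<lambda>i. E i q) ` {..<r}) = A `` {q}))"


subsection \<open>Principal connections\<close>

text \<open>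
  \<open>P\<close> is an embedded submanifold of the manifold with atlas \<open>\<B>\<close>, \<open>\<pi>\<close> its projection to the manifold
  with atlas \<open>\<A>\<close>, and \<open>R h\<close> the right action of \<open>h \<in> G\<close>.
\<close>

definition principal_connection ::
  "('p, 'e::euclidean_space) chart set \<Rightarrow> 'p set \<Rightarrow> ('q, 'f::euclidean_space) chart set \<Rightarrow>
    ('p \<Rightarrow> 'q) \<Rightarrow> 'h set \<Rightarrow> ('h \<Rightarrow> 'p \<Rightarrow> 'p) \<Rightarrow> ('p \<times> ('p, 'e) tvec) set \<Rightarrow> bool"
  where "principal_connection \<B> P \<A> \<pi> G R A \<longleftrightarrow>
    smooth_distribution \<B> P A \<and>
    (\<forall>h\<in>G. \<forall>p\<in>P. pushforward \<B> \<B> (R h) p ` (A `` {p}) = A `` {R h p}) \<and>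
    (\<forall>p\<in>P. bij_betw (pushforward \<B> \<A> \<pi> p) (A `` {p}) (tangent_space \<A> (\<pi> p)))"

text \<open>
  The class operations \<open>exp\<close>, \<open>^\<close> and \<open>*\<close> are not available or are componentwise on matrices, hence
  the explicit exponential series with respect to \<open>**\<close>.
\<close>

definition matrix_exp :: "real^'n^'n \<Rightarrow> real^'n^'n"
  where "matrix_exp Z = (\<Sum>k. (1 / fact k) *\<^sub>R ((\<lambda>Y. Z ** Y) ^^ k) (mat 1))"

definition fundamental_vector ::
  "('p, 'e::euclidean_space) chart set \<Rightarrow> (real^'n^'n \<Rightarrow> 'p \<Rightarrow> 'p) \<Rightarrow> real^'n^'n \<Rightarrow> 'p \<Rightarrow> ('p, 'e) tvec"
  where "fundamental_vector \<B> R Z p = velocity \<B> (\<lambda>t. R (matrix_exp (t *\<^sub>R Z)) p) 0"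

text \<open>\<open>\<gg>\<close> is the Lie algebra of the structure group, as a set of matrices.\<close>

definition connection_form ::
  "('p, 'e::euclidean_space) chart set \<Rightarrow> 'p set \<Rightarrow> (real^'n^'n) set \<Rightarrow>
    (real^'n^'n \<Rightarrow> 'p \<Rightarrow> 'p) \<Rightarrow> ('p \<times> ('p, 'e) tvec) set \<Rightarrow>
    ('p \<Rightarrow> ('p, 'e) tvec \<Rightarrow> real^'n^'n) \<Rightarrow> bool"
  where "connection_form \<B> P \<gg> R A \<phi> \<longleftrightarrow>
    sub_smooth_one_form \<B> P \<phi> \<and>
    (\<forall>p\<in>P. \<forall>X\<in>sub_tangent_space \<B> P p. \<phi> p X \<in> \<gg>) \<and>
    (\<forall>(p, X)\<in>A. \<phi> p X = 0) \<and>
    (\<forall>p\<in>P. \<forall>Z\<in>\<gg>. \<phi> p (fundamental_vector \<B> R Z p) = Z)"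


subsection \<open>Riemannian manifolds and frame bundles\<close>

definition riemannian_manifold ::
  "('a, real^'n) chart set \<Rightarrow> ('a \<Rightarrow> ('a, real^'n) tvec \<Rightarrow> ('a, real^'n) tvec \<Rightarrow> real) \<Rightarrow> bool"
  where "riemannian_manifold \<A> g \<longleftrightarrow> smooth_manifold \<A> \<and>
    (\<forall>x\<in>points \<A>. \<forall>X\<in>tangent_space \<A> x. \<forall>Y\<in>tangent_space \<A> x.
      g x X Y = g x Y X \<and>
      (\<forall>Z\<in>tangent_space \<A> x. \<forall>a. g x (a *\<^sub>R X + Y) Z = a * g x X Z + g x Y Z) \<and>
      (X \<noteq> 0 \<longrightarrow> g x X X > 0)) \<and>
    (\<forall>c\<in>\<A>. \<forall>v w. smooth_on
      (\<lambda>y. g (chart_inv c y) (coord_vec \<A> c (chart_inv c y) v) (coord_vec \<A> c (chart_inv c y) w))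
      (snd c ` fst c))"

type_synonym ('a, 'n) frame = "'a \<times> (real^'n \<Rightarrow> ('a, real^'n) tvec)"

definition frames :: "('a, real^'n) chart set \<Rightarrow> ('a, 'n) frame set"
  where "frames \<A> = {(x, u). x \<in> points \<A> \<and> linear u \<and> bij_betw u UNIV (tangent_space \<A> x)}"

text \<open>
  A chart \<open>c\<close> of the manifold induces the chart of the frame bundle sending \<open>(x, u)\<close> to the
  coordinates of \<open>x\<close> and the matrix whose columns are the coordinate vectors of the frame.
\<close>

definition frame_chart ::
  "('a, real^'n) chart set \<Rightarrow> ('a, real^'n) chart \<Rightarrow> (('a, 'n) frame, (real^'n) \<times> (real^'n^'n)) chart"
  where "frame_chart \<A> c =
    ({(x, u). (x, u) \<in> frames \<A> \<and> x \<in> fst c}, \<lambda>(x, u). (snd c x, matrix (\<lambda>v. u v c)))"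

definition frame_atlas ::
  "('a, real^'n) chart set \<Rightarrow> (('a, 'n) frame, (real^'n) \<times> (real^'n^'n)) chart set"
  where "frame_atlas \<A> = frame_chart \<A> ` \<A>"

text \<open>
  The orthonormal frame bundle, an embedded submanifold of the frame bundle; its projection is
  \<^const>\<open>fst\<close>.
\<close>

definition orthonormal_frames ::
  "('a, real^'n) chart set \<Rightarrow> ('a \<Rightarrow> ('a, real^'n) tvec \<Rightarrow> ('a, real^'n) tvec \<Rightarrow> real) \<Rightarrow>
    ('a, 'n) frame set"
  where "orthonormal_frames \<A> g =
    {(x, u). (x, u) \<in> frames \<A> \<and> (\<forall>v w. g x (u v) (u w) = v \<bullet> w)}"

definition right_action :: "real^'n^'n \<Rightarrow> ('a, 'n) frame \<Rightarrow> ('a, 'n) frame"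
  where "right_action h = (\<lambda>(x, u). (x, \<lambda>v. u (h *v v)))"

definition orthogonal_group :: "(real^'n^'n) set"
  where "orthogonal_group = {h. orthogonal_matrix h}"

definition orthogonal_lie_algebra :: "(real^'n^'n) set"
  where "orthogonal_lie_algebra = {Z. transpose Z = - Z}"

definition canonical_form ::
  "('a, real^'n) chart set \<Rightarrow>
    ('a, 'n) frame \<Rightarrow> (('a, 'n) frame, (real^'n) \<times> (real^'n^'n)) tvec \<Rightarrow> real^'n"
  where "canonical_form \<A> p X = inv (snd p) (pushforward (frame_atlas \<A>) \<A> fst p X)"

type_synonym ('a, 'n) distribution =
  "(('a, 'n) frame \<times> (('a, 'n) frame, (real^'n) \<times> (real^'n^'n)) tvec) set"

definition frame_connection ::
  "('a, real^'n) chart set \<Rightarrow> ('a \<Rightarrow> ('a, real^'n) tvec \<Rightarrow> ('a, real^'n) tvec \<Rightarrow> real) \<Rightarrow>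
    ('a, 'n) distribution \<Rightarrow> bool"
  where "frame_connection \<A> g A \<longleftrightarrow>
    principal_connection (frame_atlas \<A>) (orthonormal_frames \<A> g) \<A> fst
      orthogonal_group right_action A"

definition torsion ::
  "('a, real^'n) chart set \<Rightarrow> ('a \<Rightarrow> ('a, real^'n) tvec \<Rightarrow> ('a, real^'n) tvec \<Rightarrow> real) \<Rightarrow>
    (('a, 'n) frame \<Rightarrow> (('a, 'n) frame, (real^'n) \<times> (real^'n^'n)) tvec \<Rightarrow> real^'n^'n) \<Rightarrow>
    ('a, 'n) frame \<Rightarrow> (('a, 'n) frame, (real^'n) \<times> (real^'n^'n)) tvec \<Rightarrow>
    (('a, 'n) frame, (real^'n) \<times> (real^'n^'n)) tvec \<Rightarrow> real^'n"
  where "torsion \<A> g \<phi> p X Y =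
    sub_ext_deriv (frame_atlas \<A>) (orthonormal_frames \<A> g) (canonical_form \<A>) p X Y +
    \<phi> p X *v canonical_form \<A> p Y - \<phi> p Y *v canonical_form \<A> p X"

text \<open>
  The connection form of a connection is unique on the tangent vectors of the orthonormal frame
  bundle, so the existential quantifier just names it.
\<close>

definition torsion_free ::
  "('a, real^'n) chart set \<Rightarrow> ('a \<Rightarrow> ('a, real^'n) tvec \<Rightarrow> ('a, real^'n) tvec \<Rightarrow> real) \<Rightarrow>
    ('a, 'n) distribution \<Rightarrow> bool"
  where "torsion_free \<A> g A \<longleftrightarrow>
    (\<exists>\<phi>. connection_form (frame_atlas \<A>) (orthonormal_frames \<A> g) orthogonal_lie_algebra
        right_action A \<phi> \<and>
      (\<forall>p\<in>orthonormal_frames \<A> g.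
        \<forall>X\<in>sub_tangent_space (frame_atlas \<A>) (orthonormal_frames \<A> g) p.
        \<forall>Y\<in>sub_tangent_space (frame_atlas \<A>) (orthonormal_frames \<A> g) p.
          torsion \<A> g \<phi> p X Y = 0))"

end

theory Submission
  imports Defs
begin

text \<open>
  In the coordinates \<open>(y, m)\<close> of the frame bundle induced by a chart, with Gram matrix \<open>G\<close>, the
  orthonormal frames are given by \<open>m\<^sup>T G m = 1\<close>.  On them \<open>m\<^sup>T G\<close> is the inverse of \<open>m\<close>, so the
  canonical form is \<open>m\<^sup>T G dy\<close>, and the Levi-Civita form is
  \<open>m\<^sup>T (G dm + \<Gamma>(dy) m)\<close> with the Christoffel symbols \<open>\<Gamma>\<close> of the first kind.  Since
  \<open>\<Gamma>(v) + \<Gamma>(v)\<^sup>T = dG(v)\<close>, the values of this form are skew exactly on the tangent vectors of the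
  orthonormal frame bundle, and the symmetry \<open>\<Gamma>(v) w = \<Gamma>(w) v\<close> makes the torsion vanish.  The
  transformation law of \<open>\<Gamma>\<close> shows that the form does not depend on the chart; the connection is its
  kernel.  That the exterior derivative of a form on the orthonormal frame bundle does not depend on the
  extension follows by pulling back to surfaces with prescribed tangent plane, which Gram--Schmidt provides.

  The difference \<open>\<delta>\<close> of two torsion-free connection forms vanishes on vertical vectors and satisfies
  \<open>\<delta>(X) \<omega>(Y) = \<delta>(Y) \<omega>(X)\<close>.  So it induces a trilinear form on \<open>\<real>\<^sup>n\<close> that is symmetric in two
  arguments and skew in two, and hence zero.
\<close>

subsection \<open>Calculus of smooth maps\<close>

text \<open>The orthonormal frames are given by an equation and have no charts of their own. So
  their tangent vectors, smooth extensions of forms and a well-defined exterior derivative all have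
  to be produced by hand. Writing \<open>m\<^sup>T G\<close> for the inverse provides the
  extensions: the formulas are polynomial in \<open>m\<close>, the metric and its first derivatives,
  make sense at every frame, and contain no inverse to differentiate. Off the orthonormal frames
  \<open>m\<^sup>T G dy\<close> is in general not the canonical form, which is harmless once the
  derivative is known not to depend on the extension. A curve is too small for that independence,
  since \<open>d\<close> pairs two directions; along a surface the symmetry of second derivatives
  applies. The surface starts as an affine one and is corrected by Gram-Schmidt without changing its
  tangent plane; taken with both directions equal it also shows that every vector with skew value is
  a velocity. In the uniqueness part the forms are compared on horizontal vectors only, where the
  Levi-Civita form is zero. Equality of the distributions follows since both project isomorphically
  to the base.\<close>

lemma linear_Basis_expansion:
  fixes L :: "'e::euclidean_space \<Rightarrow> 'v::real_vector"
  assumes "linear L"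
  shows "L v = (\<Sum>b\<in>Basis. (v \<bullet> b) *\<^sub>R L b)"
proof -
  have "L (\<Sum>b\<in>Basis. (v \<bullet> b) *\<^sub>R b) = (\<Sum>b\<in>Basis. (v \<bullet> b) *\<^sub>R L b)"
    by (simp only: linear_sum[OF assms] linear_scale[OF assms])
  then show ?thesis by (simp only: euclidean_representation)
qed

text \<open>As \<open>S\<close> is open, functions that agree on \<open>S\<close> have the same
  derivatives there, so the recursion passes from \<open>f\<close> to \<open>g\<close>.\<close>

lemma Ck_on_cong:
  assumes "open S" "Ck_on k f S" "\<And>x. x \<in> S \<Longrightarrow> f x = g x"
  shows "Ck_on k g S"
  using assms(2,3)
proof (induction k arbitrary: f g)
  case 0
  then show ?case by (simp cong: continuous_on_cong)
next
  case (Suc k)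
  have d: "(g has_derivative frechet_derivative f (at x)) (at x)" if "x \<in> S" for x
  proof (rule has_derivative_transform_within_open[OF _ assms(1) that])
    show "(f has_derivative frechet_derivative f (at x)) (at x)"
      using Suc.prems(1) that by (simp add: frechet_derivative_works)
  qed (use Suc.prems(2) in auto)
  have eq: "frechet_derivative f (at x) v = frechet_derivative g (at x) v" if "x \<in> S" for x v
    using frechet_derivative_at[OF d[OF that]] by simp
  have "Ck_on k (\<lambda>x. frechet_derivative g (at x) v) S" for v
    using Suc.prems(1) by (intro Suc.IH[OF _ eq]) auto
  with d show ?case unfolding Ck_on.simps differentiable_def by blast
qed

text \<open>Lets an induction use the derivative that a calculus rule produces in place of
  \<open>frechet_derivative\<close>.\<close>

lemma Ck_on_SucI:
  assumes "open S" "\<And>x. x \<in> S \<Longrightarrow> (f has_derivative f' x) (at x)" "\<And>v. Ck_on k (\<lambda>x. f' x v) S"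
  shows "Ck_on (Suc k) f S"
proof -
  have eq: "f' x v = frechet_derivative f (at x) v" if "x \<in> S" for x v
    using frechet_derivative_at[OF assms(2)[OF that]] by simp
  have "Ck_on k (\<lambda>x. frechet_derivative f (at x) v) S" for v
    by (rule Ck_on_cong[OF assms(1,3) eq])
  then show ?thesis using assms(2) unfolding Ck_on.simps differentiable_def by blast
qed

lemma Ck_on_Suc_derivative:
  assumes "Ck_on (Suc k) f S" "x \<in> S"
  shows "(f has_derivative frechet_derivative f (at x)) (at x)"
  using assms by (simp add: frechet_derivative_works)

lemma Ck_on_SucD: "Ck_on (Suc k) f S \<Longrightarrow> Ck_on k f S"
proof (induction k arbitrary: f)
  case 0
  then show ?case
    by (auto intro!: continuous_at_imp_continuous_on differentiable_imp_continuous_within)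
next
  case (Suc k)
  from Suc.prems have d: "\<forall>x\<in>S. f differentiable (at x)"
    and c: "Ck_on (Suc k) (\<lambda>x. frechet_derivative f (at x) v) S" for v
    unfolding Ck_on.simps(2)[of "Suc k"] by blast+
  show ?case unfolding Ck_on.simps(2)[of k] using d Suc.IH[OF c] by blast
qed

lemma Ck_on_subset: "Ck_on k f S \<Longrightarrow> T \<subseteq> S \<Longrightarrow> Ck_on k f T"
  by (induction k arbitrary: f) (auto intro: continuous_on_subset)

lemma Ck_on_const: "Ck_on k (\<lambda>x. c) S"
  by (induction k arbitrary: c) auto

lemma Ck_on_linear:
  assumes "bounded_linear L" "open S" "Ck_on k f S"
  shows "Ck_on k (\<lambda>x. L (f x)) S"
  using assms(3)
proof (induction k arbitrary: f)
  case 0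
  then show ?case using assms(1) by (simp add: bounded_linear.continuous_on)
next
  case (Suc k)
  show ?case
  proof (rule Ck_on_SucI[OF assms(2)])
    show "((\<lambda>x. L (f x)) has_derivative (\<lambda>v. L (frechet_derivative f (at x) v))) (at x)" if "x \<in> S" for x
      by (rule bounded_linear.has_derivative[OF assms(1) Ck_on_Suc_derivative[OF Suc.prems that]])
  qed (use Suc in auto)
qed

lemma Ck_on_add:
  assumes "open S" "Ck_on k f S" "Ck_on k g S"
  shows "Ck_on k (\<lambda>x. f x + g x) S"
  using assms(2,3)
proof (induction k arbitrary: f g)
  case 0
  then show ?case by (simp add: continuous_on_add)
next
  case (Suc k)
  show ?case
  proof (rule Ck_on_SucI[OF assms(1)])
    show "((\<lambda>x. f x + g x) has_derivative
      (\<lambda>v. frechet_derivative f (at x) v + frechet_derivative g (at x) v)) (at x)" if "x \<in> S" for x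
      using Ck_on_Suc_derivative[OF _ that] Suc.prems by (intro has_derivative_add)
  qed (use Suc in auto)
qed

text \<open>By the product rule the derivative is a sum of two terms of the same shape, so the
  induction runs over all pairs \<open>f\<close>, \<open>g\<close>. Scalar multiples, inner products
  and both matrix products are instances.\<close>

lemma Ck_on_bilinear:
  assumes "bounded_bilinear B" "open S" "Ck_on k f S" "Ck_on k g S"
  shows "Ck_on k (\<lambda>x. B (f x) (g x)) S"
  using assms(3,4)
proof (induction k arbitrary: f g)
  case 0
  then show ?case using assms(1) by (simp add: bounded_bilinear.continuous_on)
next
  case (Suc k)
  show ?case
  proof (rule Ck_on_SucI[OF assms(2)])
    show "((\<lambda>x. B (f x) (g x)) has_derivative
      (\<lambda>v. B (f x) (frechet_derivative g (at x) v) + B (frechet_derivative f (at x) v) (g x))) (at x)"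
      if "x \<in> S" for x
      using Ck_on_Suc_derivative[OF Suc.prems(1) that] Ck_on_Suc_derivative[OF Suc.prems(2) that]
      by (rule bounded_bilinear.FDERIV[OF assms(1)])
    show "Ck_on k (\<lambda>x. B (f x) (frechet_derivative g (at x) v) + B (frechet_derivative f (at x) v) (g x)) S" for v
      using Suc.prems Ck_on_SucD[OF Suc.prems(1)] Ck_on_SucD[OF Suc.prems(2)]
      by (intro Ck_on_add assms(2) Suc.IH) simp_all
  qed
qed

lemma Ck_on_sum:
  assumes "open S" "\<And>i. i \<in> I \<Longrightarrow> Ck_on k (f i) S"
  shows "Ck_on k (\<lambda>x. \<Sum>i\<in>I. f i x) S"
  using assms(2)
  by (induction I rule: infinite_finite_induct) (auto intro: Ck_on_const Ck_on_add[OF assms(1)])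

text \<open>The chain rule applies the derivative of \<open>f\<close> to a vector that varies with
  \<open>x\<close>, while \<open>Ck_on\<close> speaks of fixed directions. Expanding this vector in
  the basis of the middle space leaves products of scalar functions with compositions of lower
  order.\<close>

lemma Ck_on_compose:
  fixes g :: "'d::real_normed_vector \<Rightarrow> 'e::euclidean_space"
  assumes "open S" "open T" "Ck_on k f T" "Ck_on k g S" "g ` S \<subseteq> T"
  shows "Ck_on k (\<lambda>x. f (g x)) S"
  using assms(3,4)
proof (induction k arbitrary: f)
  case 0
  then show ?case using assms(5) by (auto intro: continuous_on_compose2)
next
  case (Suc k)
  have eq: "frechet_derivative f (at y) w = (\<Sum>b\<in>Basis. (w \<bullet> b) *\<^sub>R frechet_derivative f (at y) b)"
    if "y \<in> T" for y w
  proof -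
    have "linear (frechet_derivative f (at y))"
      using Suc.prems(1) that by (simp add: linear_frechet_derivative)
    then show ?thesis by (rule linear_Basis_expansion)
  qed
  have ck: "Ck_on k g S" using Suc.prems(2) by (rule Ck_on_SucD)
  show ?case
  proof (rule Ck_on_SucI[OF assms(1)])
    fix x assume x: "x \<in> S"
    then have gx: "g x \<in> T" using assms(5) by auto
    have "((\<lambda>x. f (g x)) has_derivative
        (\<lambda>v. frechet_derivative f (at (g x)) (frechet_derivative g (at x) v))) (at x)"
      using diff_chain_at[OF Ck_on_Suc_derivative[OF Suc.prems(2) x] Ck_on_Suc_derivative[OF Suc.prems(1) gx]]
      by (simp add: o_def)
    then show "((\<lambda>x. f (g x)) has_derivative
        (\<lambda>v. \<Sum>b\<in>Basis. (frechet_derivative g (at x) v \<bullet> b) *\<^sub>R frechet_derivative f (at (g x)) b)) (at x)"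
      by (rule has_derivative_eq_rhs) (rule ext, rule eq[OF gx])
  next
    fix v
    show "Ck_on k (\<lambda>x. \<Sum>b\<in>Basis. (frechet_derivative g (at x) v \<bullet> b) *\<^sub>R frechet_derivative f (at (g x)) b) S"
    proof (rule Ck_on_sum[OF assms(1) Ck_on_bilinear[OF bounded_bilinear_scaleR assms(1)]])
      show "Ck_on k (\<lambda>x. frechet_derivative g (at x) v \<bullet> b) S" for b
        using Suc.prems(2) by (intro Ck_on_linear[OF bounded_linear_inner_left assms(1)]) simp
      show "Ck_on k (\<lambda>x. frechet_derivative f (at (g x)) b) S" for b
        using Suc.prems(1) by (intro Suc.IH ck) simp
    qed
  qed
qed

section \<open>Smooth maps: closure properties inherited from every finite order\<close>

lemma smooth_on_cong:
  "open S \<Longrightarrow> smooth_on f S \<Longrightarrow> (\<And>x. x \<in> S \<Longrightarrow> f x = g x) \<Longrightarrow> smooth_on g S"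
  unfolding smooth_on_def using Ck_on_cong by blast

lemma smooth_on_subset: "smooth_on f S \<Longrightarrow> T \<subseteq> S \<Longrightarrow> smooth_on f T"
  unfolding smooth_on_def using Ck_on_subset by blast

lemma smooth_on_const: "smooth_on (\<lambda>x. c) S"
  unfolding smooth_on_def using Ck_on_const by blast

lemma smooth_on_linear: "bounded_linear L \<Longrightarrow> open S \<Longrightarrow> smooth_on f S \<Longrightarrow> smooth_on (\<lambda>x. L (f x)) S"
  unfolding smooth_on_def using Ck_on_linear by blast

lemma smooth_on_add:
  "open S \<Longrightarrow> smooth_on f S \<Longrightarrow> smooth_on g S \<Longrightarrow> smooth_on (\<lambda>x. f x + g x) S"
  unfolding smooth_on_def using Ck_on_add by blast

lemma smooth_on_bilinear:
  "bounded_bilinear B \<Longrightarrow> open S \<Longrightarrow> smooth_on f S \<Longrightarrow> smooth_on g S \<Longrightarrow> smooth_on (\<lambda>x. B (f x) (g x)) S"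
  unfolding smooth_on_def using Ck_on_bilinear by blast

lemma smooth_on_sum:
  "open S \<Longrightarrow> (\<And>i. i \<in> I \<Longrightarrow> smooth_on (f i) S) \<Longrightarrow> smooth_on (\<lambda>x. \<Sum>i\<in>I. f i x) S"
  unfolding smooth_on_def using Ck_on_sum[of S I] by blast

lemma smooth_on_compose:
  fixes g :: "'d::real_normed_vector \<Rightarrow> 'e::euclidean_space"
  shows "open S \<Longrightarrow> open T \<Longrightarrow> smooth_on f T \<Longrightarrow> smooth_on g S \<Longrightarrow> g ` S \<subseteq> T \<Longrightarrow>
    smooth_on (\<lambda>x. f (g x)) S"
  unfolding smooth_on_def using Ck_on_compose[of S T] by blast

lemma smooth_on_has_derivative:
  "smooth_on f S \<Longrightarrow> x \<in> S \<Longrightarrow> (f has_derivative frechet_derivative f (at x)) (at x)"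
  unfolding smooth_on_def using Ck_on_Suc_derivative by blast

lemma smooth_on_continuous: "smooth_on f S \<Longrightarrow> continuous_on S f"
  unfolding smooth_on_def using Ck_on.simps(1) by blast

lemma smooth_on_derivative: "smooth_on f S \<Longrightarrow> smooth_on (\<lambda>x. frechet_derivative f (at x) v) S"
  unfolding smooth_on_def using Ck_on.simps(2) by blast

lemma smooth_on_ident: "open S \<Longrightarrow> smooth_on (\<lambda>x. x) S"
proof -
  assume S: "open S"
  have "Ck_on k (\<lambda>x. x) S" for k
  proof (cases k)
    case (Suc l)
    have "Ck_on (Suc l) (\<lambda>x. x) S"
      by (rule Ck_on_SucI[OF S has_derivative_ident Ck_on_const])
    then show ?thesis using Suc by simp
  qed simp
  then show ?thesis by (simp add: smooth_on_def)
qed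

lemma smooth_on_bounded_linear: "bounded_linear L \<Longrightarrow> open S \<Longrightarrow> smooth_on L S"
  by (rule smooth_on_linear[OF _ _ smooth_on_ident])

lemma smooth_on_uminus: "open S \<Longrightarrow> smooth_on f S \<Longrightarrow> smooth_on (\<lambda>x. - f x) S"
  by (rule smooth_on_linear[OF bounded_linear_minus[OF bounded_linear_ident]])

lemma smooth_on_diff:
  "open S \<Longrightarrow> smooth_on f S \<Longrightarrow> smooth_on g S \<Longrightarrow> smooth_on (\<lambda>x. f x - g x) S"
  using smooth_on_add[OF _ _ smooth_on_uminus, of S f g] by simp

lemmas smooth_on_scaleR = smooth_on_bilinear[OF bounded_bilinear_scaleR]
lemmas smooth_on_inner = smooth_on_bilinear[OF bounded_bilinear_inner]

text \<open>Smoothness of one-forms is defined with constant coordinate vectors; the basis expansion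
  extends it to moving base points and moving vectors.\<close>

lemma smooth_on_linear_family:
  fixes h :: "'d::real_normed_vector \<Rightarrow> 'e::euclidean_space" and V :: "'d \<Rightarrow> 'b::euclidean_space"
    and \<beta> :: "'e \<Rightarrow> 'b \<Rightarrow> 'v::real_normed_vector"
  assumes "open S" "open T" "\<And>z. z \<in> T \<Longrightarrow> linear (\<beta> z)" "\<And>v. smooth_on (\<lambda>z. \<beta> z v) T"
    and "smooth_on h S" "smooth_on V S" "h ` S \<subseteq> T"
  shows "smooth_on (\<lambda>x. \<beta> (h x) (V x)) S"
proof (rule smooth_on_cong[OF assms(1)])
  show "smooth_on (\<lambda>x. \<Sum>b\<in>Basis. (V x \<bullet> b) *\<^sub>R \<beta> (h x) b) S"
    by (rule smooth_on_sum[OF assms(1) smooth_on_scaleR[OF assms(1)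
            smooth_on_inner[OF assms(1,6) smooth_on_const] smooth_on_compose[OF assms(1,2,4,5,7)]]])
  show "(\<Sum>b\<in>Basis. (V x \<bullet> b) *\<^sub>R \<beta> (h x) b) = \<beta> (h x) (V x)" if "x \<in> S" for x
    using assms(3,7) that by (subst linear_Basis_expansion[of "\<beta> (h x)" "V x"]) auto
qed

lemma smooth_on_frechet_derivative:
  fixes h :: "'d::real_normed_vector \<Rightarrow> 'e::euclidean_space"
  assumes "open S" "open T" "smooth_on f T" "smooth_on h S" "smooth_on V S" "h ` S \<subseteq> T"
  shows "smooth_on (\<lambda>x. frechet_derivative f (at (h x)) (V x)) S"
  by (rule smooth_on_linear_family[OF assms(1,2) _ smooth_on_derivative[OF assms(3)] assms(4,5,6)])
    (rule has_derivative_linear[OF smooth_on_has_derivative[OF assms(3)]])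

lemma smooth_on_vec_lambda:
  fixes f :: "'d::real_normed_vector \<Rightarrow> 'n::finite \<Rightarrow> 'b::real_normed_vector"
  assumes "open S" "\<And>i. smooth_on (\<lambda>x. f x i) S"
  shows "smooth_on (\<lambda>x. \<chi> i. f x i) S"
proof -
  have norm_axis': "norm (axis i y :: 'b^'n) = norm y" for i and y :: 'b
    by (simp add: norm_vec_def L2_set_def axis_def if_distrib if_distribR cong: if_cong)
  have bl: "bounded_linear (\<lambda>y::'b. axis i y :: 'b^'n)" for i
    by (rule bounded_linear_intro[where K=1]) (simp_all add: norm_axis', simp_all add: vec_eq_iff axis_def)
  have "(\<chi> i. f x i) = (\<Sum>i\<in>UNIV. axis i (f x i))" for x
    by (simp add: vec_eq_iff axis_def if_distrib if_distribR cong: if_cong)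
  then show ?thesis
    using assms by (simp add: smooth_on_sum smooth_on_linear[OF bl])
qed

lemma smooth_on_Pair:
  "open S \<Longrightarrow> smooth_on f S \<Longrightarrow> smooth_on g S \<Longrightarrow> smooth_on (\<lambda>x. (f x, g x)) S"
proof -
  assume S: "open S" "smooth_on f S" "smooth_on g S"
  have "smooth_on (\<lambda>x. (f x, 0) + (0, g x)) S"
    by (intro smooth_on_add S smooth_on_linear[where L="\<lambda>y. (y, 0)"] smooth_on_linear[where L="\<lambda>y. (0, y)"]
        bounded_linear_Pair bounded_linear_ident bounded_linear_zero)
  then show ?thesis by simp
qed

text \<open>The exponent is arbitrary in the induction because the derivative is a multiple of
  another power. The exponent -1/2 normalises vectors in Gram-Schmidt.\<close>

lemma smooth_on_powr: "smooth_on (\<lambda>x::real. x powr a) {0<..}"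
proof -
  have "Ck_on k (\<lambda>x::real. x powr a) {0<..}" for k
  proof (induction k arbitrary: a)
    case 0
    show ?case by (auto intro!: continuous_intros)
  next
    case (Suc k)
    show ?case
    proof (rule Ck_on_SucI[OF open_greaterThan])
      show "((\<lambda>x. x powr a) has_derivative (\<lambda>v. v * (a * x powr (a - 1)))) (at x)"
        if "x \<in> {0<..}" for x :: real
        using that has_real_derivative_powr[of x a]
        by (auto simp: has_field_derivative_def elim!: has_derivative_eq_rhs)
      show "Ck_on k (\<lambda>x. v * (a * x powr (a - 1))) {0<..}" for v
        by (intro Ck_on_linear[OF bounded_linear_mult_right] open_greaterThan Suc.IH)
    qed
  qed
  then show ?thesis by (simp add: smooth_on_def)
qed

text \<open>Applying the mean value theorem in the direction \<open>u\<close>, then in the direction \<open>v\<close>.\<close>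

lemma second_difference_mean_value:
  fixes h :: "'e::real_normed_vector \<Rightarrow> real"
  assumes "\<And>y. y \<in> ball x r \<Longrightarrow> (h has_derivative Dh y) (at y)"
    and "\<And>y. y \<in> ball x r \<Longrightarrow> ((\<lambda>y. Dh y u) has_derivative D2 y) (at y)"
    and "s > 0" "s * (norm u + norm v) < r"
  shows "\<exists>p. dist x p \<le> s * (norm u + norm v) \<and>
    h (x + s *\<^sub>R u + s *\<^sub>R v) - h (x + s *\<^sub>R u) - h (x + s *\<^sub>R v) + h x = s * s * D2 p v"
proof -
  have near: "dist x (x + a *\<^sub>R u + b *\<^sub>R v) \<le> s * (norm u + norm v)"
    if "0 \<le> a" "a \<le> s" "0 \<le> b" "b \<le> s" for a b
  proof -
    have "dist x (x + a *\<^sub>R u + b *\<^sub>R v) = norm (a *\<^sub>R u + b *\<^sub>R v)"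
      unfolding dist_norm by (subst norm_minus_commute) (simp add: algebra_simps)
    also have "\<dots> \<le> a * norm u + b * norm v"
      using norm_triangle_ineq[of "a *\<^sub>R u" "b *\<^sub>R v"] that by simp
    also have "\<dots> \<le> s * norm u + s * norm v"
      using that by (auto intro!: add_mono mult_right_mono)
    finally show ?thesis by (simp add: algebra_simps)
  qed
  then have inb: "x + a *\<^sub>R u + b *\<^sub>R v \<in> ball x r" if "0 \<le> a" "a \<le> s" "0 \<le> b" "b \<le> s" for a b
    using that assms(4) by (force simp: mem_ball)
  \<comment> \<open>The second difference is \<open>q s - q 0\<close>: \<open>q\<close> is the
    difference in the direction \<open>v\<close> as a function of the step along \<open>u\<close>.
    Below, \<open>k\<close> handles the remaining direction in the same way.\<close>
  define q where "q a = h (x + a *\<^sub>R u + s *\<^sub>R v) - h (x + a *\<^sub>R u)" for a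
  have q': "(q has_derivative (\<lambda>t. Dh (x + a *\<^sub>R u + s *\<^sub>R v) (t *\<^sub>R u) - Dh (x + a *\<^sub>R u) (t *\<^sub>R u))) (at a)"
    if "0 \<le> a" "a \<le> s" for a
  proof -
    have l: "((\<lambda>a. x + a *\<^sub>R u + b *\<^sub>R v) has_derivative (\<lambda>t. t *\<^sub>R u)) (at a)" for b
      by (auto intro!: derivative_eq_intros)
    have "((\<lambda>a. h (x + a *\<^sub>R u + b *\<^sub>R v)) has_derivative (\<lambda>t. Dh (x + a *\<^sub>R u + b *\<^sub>R v) (t *\<^sub>R u))) (at a)"
      if "0 \<le> b" "b \<le> s" for b
      by (rule has_derivative_compose[OF l assms(1)[OF inb]]) (use that \<open>0 \<le> a\<close> \<open>a \<le> s\<close> in auto)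
    from has_derivative_diff[OF this[of s] this[of 0]] show ?thesis
      using assms(3) by (simp add: q_def[abs_def])
  qed
  obtain \<xi> where \<xi>: "0 < \<xi>" "\<xi> < s"
    and q\<xi>: "q s - q 0 = s * (Dh (x + \<xi> *\<^sub>R u + s *\<^sub>R v) u - Dh (x + \<xi> *\<^sub>R u) u)"
  proof -
    obtain z where z: "z \<in> {0<..<s}"
      and "q s - q 0 = (\<lambda>t. Dh (x + z *\<^sub>R u + s *\<^sub>R v) (t *\<^sub>R u) - Dh (x + z *\<^sub>R u) (t *\<^sub>R u)) (s - 0)"
      using mvt_simple[OF assms(3), of q, OF has_derivative_at_withinI[OF q']] by auto
    moreover have "linear (Dh (x + z *\<^sub>R u + b *\<^sub>R v))" if "0 \<le> b" "b \<le> s" for b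
      using inb[of z b] z that assms(1) by (intro has_derivative_linear[OF assms(1)]) auto
    from this[of s] this[of 0] have "Dh (x + z *\<^sub>R u + s *\<^sub>R v) (s *\<^sub>R u) = s * Dh (x + z *\<^sub>R u + s *\<^sub>R v) u"
      "Dh (x + z *\<^sub>R u) (s *\<^sub>R u) = s * Dh (x + z *\<^sub>R u) u"
      using assms(3) by (simp_all add: linear_scale)
    ultimately show ?thesis using that z by (auto simp: algebra_simps)
  qed
  define k where "k b = Dh (x + \<xi> *\<^sub>R u + b *\<^sub>R v) u" for b
  have k': "(k has_derivative (\<lambda>t. D2 (x + \<xi> *\<^sub>R u + b *\<^sub>R v) (t *\<^sub>R v))) (at b)" if "0 \<le> b" "b \<le> s" for b
  proof -
    have l: "((\<lambda>b. x + \<xi> *\<^sub>R u + b *\<^sub>R v) has_derivative (\<lambda>t. t *\<^sub>R v)) (at b)"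
      by (auto intro!: derivative_eq_intros)
    show ?thesis unfolding k_def
      by (rule has_derivative_compose[OF l assms(2)[OF inb]]) (use that \<xi> in auto)
  qed
  obtain \<eta> where \<eta>: "\<eta> \<in> {0<..<s}"
    and k\<eta>: "k s - k 0 = D2 (x + \<xi> *\<^sub>R u + \<eta> *\<^sub>R v) ((s - 0) *\<^sub>R v)"
    using mvt_simple[OF assms(3), of k, OF has_derivative_at_withinI[OF k']] by auto
  have "linear (D2 (x + \<xi> *\<^sub>R u + \<eta> *\<^sub>R v))"
    using inb[of \<xi> \<eta>] \<xi> \<eta> by (intro has_derivative_linear[OF assms(2)]) auto
  then have "k s - k 0 = s * D2 (x + \<xi> *\<^sub>R u + \<eta> *\<^sub>R v) v"
    using k\<eta> by (simp add: linear_scale)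
  then have "q s - q 0 = s * s * D2 (x + \<xi> *\<^sub>R u + \<eta> *\<^sub>R v) v"
    using q\<xi> by (simp add: k_def)
  then show ?thesis
    using near[of \<xi> \<eta>] \<xi> \<eta> unfolding q_def by (intro exI[of _ "x + \<xi> *\<^sub>R u + \<eta> *\<^sub>R v"]) auto
qed

text \<open>The second difference is symmetric in \<open>u\<close> and \<open>v\<close>. Divided by
  the squared step it is a value of either mixed derivative at a nearby point, and both mixed
  derivatives are continuous at \<open>x\<close>.\<close>

lemma second_derivative_symmetric_real:
  fixes h :: "'e::real_normed_vector \<Rightarrow> real"
  assumes "open S" "x \<in> S" "Ck_on 2 h S"
  shows "frechet_derivative (\<lambda>y. frechet_derivative h (at y) u) (at x) v =
    frechet_derivative (\<lambda>y. frechet_derivative h (at y) v) (at x) u" (is "?F x = ?G x")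
proof (rule ccontr)
  define F where "F u v y = frechet_derivative (\<lambda>y. frechet_derivative h (at y) u) (at y) v" for u v y
  assume "?F x \<noteq> ?G x"
  \<comment> \<open>Half the gap: two numbers that are closer than this to the two mixed derivatives
    at \<open>x\<close> cannot be equal.\<close>
  then have e: "\<bar>F u v x - F v u x\<bar> / 2 > 0" (is "?e > 0") by (simp add: F_def)
  have Ck: "Ck_on (Suc (Suc 0)) h S" using assms(3) by (simp add: eval_nat_numeral)
  have cont: "continuous_on S (F u v)" for u v using Ck by (simp add: F_def)
  have "\<exists>d>0. \<forall>y\<in>S. dist y x < d \<longrightarrow> dist (F u v y) (F u v x) < ?e" for u v
    using cont[of u v] assms(2) e unfolding continuous_on_iff F_def by blast
  moreover obtain r where r: "r > 0" "ball x r \<subseteq> S"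
    using assms(1,2) open_contains_ball by blast
  ultimately obtain d1 d2 where d: "d1 > 0" "d2 > 0"
    "\<And>y. y \<in> S \<Longrightarrow> dist y x < d1 \<Longrightarrow> dist (F u v y) (F u v x) < ?e"
    "\<And>y. y \<in> S \<Longrightarrow> dist y x < d2 \<Longrightarrow> dist (F v u y) (F v u x) < ?e"
    by meson
  \<comment> \<open>Within distance \<open>m\<close> of \<open>x\<close> everything needed holds.
    The step \<open>s\<close> keeps all points of the second difference that close; the summand 1 in
    its denominator covers \<open>u = v = 0\<close>.\<close>
  define m where "m = min r (min d1 d2)"
  define s where "s = m / (2 * (norm u + norm v + 1))"
  have m: "m > 0" using r d by (simp add: m_def)
  have nn: "norm u + norm v + 1 > 0" by (simp add: add_nonneg_pos)
  have s: "s > 0" using m nn by (simp add: s_def)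
  have "s * (norm u + norm v) \<le> s * (norm u + norm v + 1)" using s by simp
  also have "\<dots> = m / 2" using nn by (simp add: s_def field_simps)
  also have "\<dots> < m" using m by simp
  finally have sm: "s * (norm u + norm v) < m" .
  have D1: "(h has_derivative frechet_derivative h (at y)) (at y)" if "y \<in> ball x r" for y
    using Ck_on_Suc_derivative[OF Ck] r that by blast
  have D2: "((\<lambda>y. frechet_derivative h (at y) u) has_derivative (\<lambda>v. F u v y)) (at y)" if "y \<in> ball x r" for y u
    using Ck r that Ck_on_Suc_derivative[of 0 "\<lambda>y. frechet_derivative h (at y) u" S y]
    unfolding F_def by auto
  obtain p where p: "dist x p \<le> s * (norm u + norm v)"
    "h (x + s *\<^sub>R u + s *\<^sub>R v) - h (x + s *\<^sub>R u) - h (x + s *\<^sub>R v) + h x = s * s * F u v p"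
    using second_difference_mean_value[OF D1 D2[of _ u] s, where v = v] sm unfolding m_def by auto
  obtain q where q: "dist x q \<le> s * (norm v + norm u)"
    "h (x + s *\<^sub>R v + s *\<^sub>R u) - h (x + s *\<^sub>R v) - h (x + s *\<^sub>R u) + h x = s * s * F v u q"
    using second_difference_mean_value[OF D1 D2[of _ v] s, where v = u] sm unfolding m_def
    by (auto simp: add.commute)
  have "s * s * F u v p = s * s * F v u q"
    using p(2) q(2) by (simp add: algebra_simps)
  then have "F u v p = F v u q" using s by simp
  moreover have "dist (F u v p) (F u v x) < ?e"
    using p(1) sm r by (intro d(3)) (auto simp: m_def dist_commute subset_iff)
  moreover have "dist (F v u q) (F v u x) < ?e"
    using q(1) sm r by (intro d(4)) (auto simp: m_def dist_commute subset_iff add.commute)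
  ultimately show False by (auto simp: dist_real_def abs_if split: if_splits)
qed

text \<open>The mean value theorem needs real values, so the real case is applied to each
  component.\<close>

lemma second_derivative_symmetric:
  fixes f :: "'e::real_normed_vector \<Rightarrow> 'f::euclidean_space"
  assumes "open S" "x \<in> S" "smooth_on f S"
  shows "frechet_derivative (\<lambda>y. frechet_derivative f (at y) u) (at x) v =
    frechet_derivative (\<lambda>y. frechet_derivative f (at y) v) (at x) u"
proof (rule euclidean_eqI)
  fix b :: 'f assume "b \<in> Basis"
  have D: "frechet_derivative (\<lambda>y. f y \<bullet> b) (at y) w = frechet_derivative f (at y) w \<bullet> b"
    if "smooth_on f S" "y \<in> S" for y w and f :: "'e \<Rightarrow> 'f"
    using frechet_derivative_at[OF has_derivative_inner_left[OF smooth_on_has_derivative[OF that], of b]]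
    by (rule fun_cong[OF sym])
  have D2: "frechet_derivative (\<lambda>y. frechet_derivative (\<lambda>y. f y \<bullet> b) (at y) u) (at x) v =
      frechet_derivative (\<lambda>y. frechet_derivative f (at y) u) (at x) v \<bullet> b" for u v
  proof -
    note d = smooth_on_derivative[OF assms(3), of u]
    have "frechet_derivative (\<lambda>y. frechet_derivative f (at y) u \<bullet> b) (at x) =
        frechet_derivative (\<lambda>y. frechet_derivative (\<lambda>y. f y \<bullet> b) (at y) u) (at x)"
      by (rule frechet_derivative_transform_within_open[OF _ assms(1,2)])
        (use D[OF assms(3)] has_derivative_inner_left[OF smooth_on_has_derivative[OF d assms(2)], of b] 
          in \<open>auto simp: differentiable_def\<close>)
    then show ?thesis using D[OF d assms(2)] by simp
  qed
  have "smooth_on (\<lambda>y. f y \<bullet> b) S"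
    by (intro smooth_on_inner assms smooth_on_const)
  then have "Ck_on 2 (\<lambda>y. f y \<bullet> b) S" by (simp add: smooth_on_def)
  from second_derivative_symmetric_real[OF assms(1,2) this, of u v]
  show "frechet_derivative (\<lambda>y. frechet_derivative f (at y) u) (at x) v \<bullet> b =
    frechet_derivative (\<lambda>y. frechet_derivative f (at y) v) (at x) u \<bullet> b"
    by (simp add: D2)
qed

lemma frechet_derivative_linear_family:
  fixes \<beta> :: "'e::euclidean_space \<Rightarrow> 'e \<Rightarrow> 'v::real_normed_vector"
    and \<sigma> :: "'p::real_normed_vector \<Rightarrow> 'e"
  assumes "open N" "z0 \<in> N" "open W" "\<sigma> ` N \<subseteq> W"
    and lin: "\<And>z. z \<in> W \<Longrightarrow> linear (\<beta> z)"
    and diff: "\<And>v. (\<lambda>z. \<beta> z v) differentiable (at (\<sigma> z0))"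
    and \<sigma>: "(\<sigma> has_derivative \<sigma>') (at z0)" and V: "(V has_derivative V') (at z0)"
  shows "((\<lambda>z. \<beta> (\<sigma> z) (V z)) has_derivative
    (\<lambda>X. \<beta> (\<sigma> z0) (V' X) + frechet_derivative (\<lambda>z. \<beta> z (V z0)) (at (\<sigma> z0)) (\<sigma>' X))) (at z0)"
proof -
  let ?D = "\<lambda>v. frechet_derivative (\<lambda>z. \<beta> z v) (at (\<sigma> z0))"
  have D: "((\<lambda>z. \<beta> z v) has_derivative ?D v) (at (\<sigma> z0))" for v
    using diff frechet_derivative_works by blast
  have s0: "\<sigma> z0 \<in> W" using assms by auto
  \<comment> \<open>Differentiating in the base point keeps linearity in the vector argument; this
    reassembles the basis expansion at the end.\<close>
  have Dv: "?D v w = (\<Sum>b\<in>Basis. (v \<bullet> b) *\<^sub>R ?D b w)" for v w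
  proof -
    have "((\<lambda>z. \<Sum>b\<in>Basis. (v \<bullet> b) *\<^sub>R \<beta> z b) has_derivative (\<lambda>w. \<Sum>b\<in>Basis. (v \<bullet> b) *\<^sub>R ?D b w)) (at (\<sigma> z0))"
      by (intro has_derivative_sum has_derivative_scaleR_right D)
    then have "((\<lambda>z. \<beta> z v) has_derivative (\<lambda>w. \<Sum>b\<in>Basis. (v \<bullet> b) *\<^sub>R ?D b w)) (at (\<sigma> z0))"
      by (rule has_derivative_transform_within_open[OF _ assms(3) s0])
        (rule linear_Basis_expansion[OF lin, symmetric])
    from fun_cong[OF frechet_derivative_at[OF this]] show ?thesis by simp
  qed
  have "((\<lambda>z. \<Sum>b\<in>Basis. (V z \<bullet> b) *\<^sub>R \<beta> (\<sigma> z) b) has_derivative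
      (\<lambda>X. \<Sum>b\<in>Basis. (V z0 \<bullet> b) *\<^sub>R ?D b (\<sigma>' X) + (V' X \<bullet> b) *\<^sub>R \<beta> (\<sigma> z0) b)) (at z0)"
    by (intro has_derivative_sum has_derivative_scaleR has_derivative_inner_left V
        has_derivative_compose[OF \<sigma>] D)
  then have "((\<lambda>z. \<Sum>b\<in>Basis. (V z \<bullet> b) *\<^sub>R \<beta> (\<sigma> z) b) has_derivative
      (\<lambda>X. \<beta> (\<sigma> z0) (V' X) + ?D (V z0) (\<sigma>' X))) (at z0)"
    by (rule has_derivative_eq_rhs)
      (rule ext, subst Dv, subst linear_Basis_expansion[OF lin[OF s0]], simp add: sum.distrib add.commute)
  then show ?thesis
    by (rule has_derivative_transform_within_open[OF _ assms(1,2)])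
      (rule linear_Basis_expansion[OF lin, symmetric], use assms(4) in auto)
qed

text \<open>The product rule produces, besides the wanted terms, \<beta> applied to second
  derivatives of \<sigma>; these are symmetric in \<open>X\<close> and \<open>Y\<close> and cancel
  in the difference. Nothing is asked of the rank of \<sigma>, so surfaces in a larger space are
  covered.\<close>

lemma exterior_derivative_pullback:
  fixes \<beta> :: "'e::euclidean_space \<Rightarrow> 'e \<Rightarrow> 'v::real_normed_vector"
    and \<sigma> :: "'p::real_normed_vector \<Rightarrow> 'e"
  assumes "open N" "z0 \<in> N" "open W" "\<sigma> ` N \<subseteq> W"
    and lin: "\<And>z. z \<in> W \<Longrightarrow> linear (\<beta> z)"
    and diff: "\<And>v. (\<lambda>z. \<beta> z v) differentiable (at (\<sigma> z0))"
    and \<sigma>: "smooth_on \<sigma> N"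
  defines "\<sigma>' \<equiv> \<lambda>z. frechet_derivative \<sigma> (at z)"
  shows "frechet_derivative (\<lambda>z. \<beta> (\<sigma> z) (\<sigma>' z Y)) (at z0) X - frechet_derivative (\<lambda>z. \<beta> (\<sigma> z) (\<sigma>' z X)) (at z0) Y =
    frechet_derivative (\<lambda>z. \<beta> z (\<sigma>' z0 Y)) (at (\<sigma> z0)) (\<sigma>' z0 X) -
    frechet_derivative (\<lambda>z. \<beta> z (\<sigma>' z0 X)) (at (\<sigma> z0)) (\<sigma>' z0 Y)"
proof -
  have d: "frechet_derivative (\<lambda>z. \<beta> (\<sigma> z) (\<sigma>' z Y)) (at z0) X =
    \<beta> (\<sigma> z0) (frechet_derivative (\<lambda>z. \<sigma>' z Y) (at z0) X) +
    frechet_derivative (\<lambda>z. \<beta> z (\<sigma>' z0 Y)) (at (\<sigma> z0)) (\<sigma>' z0 X)" for X Y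
  proof -
    have "((\<lambda>z. \<sigma>' z Y) has_derivative frechet_derivative (\<lambda>z. \<sigma>' z Y) (at z0)) (at z0)"
      using smooth_on_has_derivative[OF smooth_on_derivative[OF \<sigma>] assms(2)] by (simp add: \<sigma>'_def)
    note frechet_derivative_linear_family[OF assms(1-4) lin diff
        smooth_on_has_derivative[OF \<sigma> assms(2)] this]
    from fun_cong[OF frechet_derivative_at[OF this]] show ?thesis by (simp add: \<sigma>'_def)
  qed
  show ?thesis
    using second_derivative_symmetric[OF assms(1,2) \<sigma>, of X Y] unfolding d by (simp add: \<sigma>'_def)
qed


subsection \<open>Smooth atlases\<close>

locale atlas =
  fixes \<B> :: "('p, 'e::euclidean_space) chart set"
  assumes smooth_atlas: "smooth_atlas \<B>"
begin

lemma inj_chart: "c \<in> \<B> \<Longrightarrow> inj_on (snd c) (fst c)"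
  and open_chart_image: "c \<in> \<B> \<Longrightarrow> open (snd c ` fst c)"
  and open_overlap: "c \<in> \<B> \<Longrightarrow> d \<in> \<B> \<Longrightarrow> open (snd c ` (fst c \<inter> fst d))"
  and smooth_transition: "c \<in> \<B> \<Longrightarrow> d \<in> \<B> \<Longrightarrow> smooth_on (transition c d) (snd c ` (fst c \<inter> fst d))"
  using smooth_atlas unfolding smooth_atlas_def by auto

lemma chart_inv_chart [simp]: "c \<in> \<B> \<Longrightarrow> p \<in> fst c \<Longrightarrow> chart_inv c (snd c p) = p"
  unfolding chart_inv_def using inj_chart by (simp add: inv_into_f_f)

lemma transition_chart [simp]: "c \<in> \<B> \<Longrightarrow> p \<in> fst c \<Longrightarrow> transition c d (snd c p) = snd d p"
  by (simp add: transition_def)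

lemma chart_chart_inv:
  "y \<in> snd c ` fst c \<Longrightarrow> chart_inv c y \<in> fst c" "y \<in> snd c ` fst c \<Longrightarrow> snd c (chart_inv c y) = y"
  unfolding chart_inv_def by (auto intro: inv_into_into f_inv_into_f)

lemma transition_has_derivative:
  assumes "c \<in> \<B>" "d \<in> \<B>" "p \<in> fst c" "p \<in> fst d"
  shows "(transition c d has_derivative frechet_derivative (transition c d) (at (snd c p))) (at (snd c p))"
  by (rule smooth_on_has_derivative[OF smooth_transition[OF assms(1,2)]]) (use assms in auto)

lemma transition_derivative_chain:
  assumes "c \<in> \<B>" "d \<in> \<B>" "e \<in> \<B>" "p \<in> fst c" "p \<in> fst d" "p \<in> fst e"
  shows "frechet_derivative (transition d e) (at (snd d p)) (frechet_derivative (transition c d) (at (snd c p)) v) =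
    frechet_derivative (transition c e) (at (snd c p)) v"
proof -
  have "((\<lambda>y. transition d e (transition c d y)) has_derivative
      (\<lambda>v. frechet_derivative (transition d e) (at (snd d p))
        (frechet_derivative (transition c d) (at (snd c p)) v))) (at (snd c p))"
    by (rule has_derivative_compose[OF transition_has_derivative[OF assms(1,2,4,5)]])
      (use transition_has_derivative[OF assms(2,3,5,6)] assms in simp)
  then have "(transition c e has_derivative
      (\<lambda>v. frechet_derivative (transition d e) (at (snd d p))
        (frechet_derivative (transition c d) (at (snd c p)) v))) (at (snd c p))"
    by (rule has_derivative_transform_within_open[OF _ open_overlap[OF assms(1,2)]])
      (use assms in auto)
  from fun_cong[OF frechet_derivative_at[OF this]] show ?thesis .
qed

lemma transition_derivative_refl:
  assumes "c \<in> \<B>" "p \<in> fst c"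
  shows "frechet_derivative (transition c c) (at (snd c p)) v = v"
proof -
  have "(transition c c has_derivative (\<lambda>v. v)) (at (snd c p))"
    by (rule has_derivative_transform_within_open[OF has_derivative_ident open_chart_image[OF assms(1)]])
      (use assms in auto)
  from fun_cong[OF frechet_derivative_at[OF this], of v] show ?thesis by (rule sym)
qed

section \<open>Tangent vectors, forms and fields described in a single chart\<close>

lemma coord_vec_chart [simp]: "c \<in> \<B> \<Longrightarrow> p \<in> fst c \<Longrightarrow> coord_vec \<B> c p v c = v"
  by (simp add: coord_vec_def transition_derivative_refl)

lemma coord_vec_in_tangent_space:
  assumes "c \<in> \<B>" "p \<in> fst c"
  shows "coord_vec \<B> c p v \<in> tangent_space \<B> p"
  using assms by (auto simp: tangent_space_def coord_vec_def transition_derivative_chain)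

text \<open>The convention that tangent vectors are 0 at all other charts makes this an equality of
  functions, so that one coordinate vector determines a tangent vector.\<close>

lemma tangent_vector_eq_coord_vec:
  assumes "c \<in> \<B>" "p \<in> fst c" "X \<in> tangent_space \<B> p"
  shows "X = coord_vec \<B> c p (X c)"
proof
  fix d
  show "X d = coord_vec \<B> c p (X c) d"
  proof (cases "d \<in> \<B> \<and> p \<in> fst d")
    case True
    then have "X d = frechet_derivative (transition c d) (at (snd c p)) (X c)"
      using assms unfolding tangent_space_def by blast
    then show ?thesis unfolding coord_vec_def if_P[OF True] .
  next
    case False
    then have "X d = 0" using assms(3) unfolding tangent_space_def by blast
    with False show ?thesis by (simp only: coord_vec_def if_False)
  qed
qed

lemma tangent_vector_eqI:
  assumes "c \<in> \<B>" "p \<in> fst c" "X \<in> tangent_space \<B> p" "Y \<in> tangent_space \<B> p" "X c = Y c"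
  shows "X = Y"
  by (subst tangent_vector_eq_coord_vec[OF assms(1-3)], subst tangent_vector_eq_coord_vec[OF assms(1,2,4)])
    (simp only: assms(5))

lemma linear_coord_vec:
  assumes "c \<in> \<B>" "p \<in> fst c"
  shows "linear (coord_vec \<B> c p)"
proof -
  have "linear (frechet_derivative (transition c d) (at (snd c p)))" if "d \<in> \<B>" "p \<in> fst d" for d
    using has_derivative_linear transition_has_derivative assms that by blast
  then show ?thesis
    by (intro linearI) (auto simp: coord_vec_def fun_eq_iff scaleR_fun_def linear_add linear_scale)
qed

lemma tangent_space_eq_range:
  assumes "c \<in> \<B>" "p \<in> fst c"
  shows "tangent_space \<B> p = range (coord_vec \<B> c p)"
  using coord_vec_in_tangent_space[OF assms] tangent_vector_eq_coord_vec[OF assms] by blast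

lemma chart_at:
  assumes "p \<in> points \<B>"
  shows "chart_at \<B> p \<in> \<B>" "p \<in> fst (chart_at \<B> p)"
proof -
  have "\<exists>c. c \<in> \<B> \<and> p \<in> fst c" using assms by (auto simp: points_def)
  from someI_ex[OF this] show "chart_at \<B> p \<in> \<B>" "p \<in> fst (chart_at \<B> p)"
    by (simp_all add: chart_at_def)
qed

lemma openin_chart: "c \<in> \<B> \<Longrightarrow> openin (manifold_topology \<B>) (fst c)"
  using open_overlap by (auto simp: openin_manifold_topology[OF smooth_atlas] points_def)

text \<open>Smoothness has to be checked in every chart \<open>d\<close>: there the coefficient is
  \<open>b\<close> at the transition to \<open>c\<close>, applied to a vector moved by the
  derivative of this transition.\<close>

lemma smooth_one_form_from_chart:
  assumes "c \<in> \<B>" "\<And>z. z \<in> snd c ` fst c \<Longrightarrow> linear (b z)"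
    and "\<And>v. smooth_on (\<lambda>z. b z v) (snd c ` fst c)"
  shows "smooth_one_form \<B> (fst c) (\<lambda>q X. b (snd c q) (X c))"
  unfolding smooth_one_form_def
proof (intro conjI ballI allI)
  fix p X Y a assume "p \<in> fst c"
  then show "b (snd c p) ((a *\<^sub>R X + Y) c) = a *\<^sub>R b (snd c p) (X c) + b (snd c p) (Y c)"
    using assms(2)[of "snd c p"] by (simp add: scaleR_fun_def linear_add linear_scale)
next
  fix d v assume d: "d \<in> \<B>"
  have "smooth_on (\<lambda>y. b (transition d c y) (frechet_derivative (transition d c) (at y) v)) (snd d ` (fst d \<inter> fst c))"
    by (rule smooth_on_linear_family[OF open_overlap[OF d assms(1)] open_chart_image[OF assms(1)] assms(2,3)
        smooth_transition[OF d assms(1)] smooth_on_derivative[OF smooth_transition[OF d assms(1)]]])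
      (use d in auto)
  then show "smooth_on (form_coeff \<B> (\<lambda>q X. b (snd c q) (X c)) d v) (snd d ` (fst d \<inter> fst c))"
    by (rule smooth_on_cong[OF open_overlap[OF d assms(1)]])
      (use d assms(1) in \<open>auto simp: form_coeff_def coord_vec_def\<close>)
qed

lemma form_coeff_from_chart:
  assumes "c \<in> \<B>" "z \<in> snd c ` fst c"
  shows "form_coeff \<B> (\<lambda>q X. b (snd c q) (X c)) c v z = b z v"
  using assms by (auto simp: form_coeff_def)

text \<open>In another chart \<open>d\<close> the coordinates of the field are those in
  \<open>c\<close>, read at the transition from \<open>d\<close> and moved by the derivative of the
  transition back to \<open>d\<close>.\<close>

lemma smooth_vector_field_from_chart:
  assumes "c \<in> \<B>" "smooth_on F (snd c ` fst c)"
  shows "smooth_vector_field \<B> (fst c) (\<lambda>q. coord_vec \<B> c q (F (snd c q)))"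
  unfolding smooth_vector_field_def
proof (intro conjI ballI)
  fix d assume d: "d \<in> \<B>"
  have sub: "transition d c ` (snd d ` (fst d \<inter> fst c)) \<subseteq> snd c ` (fst c \<inter> fst d)" using d by auto
  have "smooth_on (\<lambda>y. F (transition d c y)) (snd d ` (fst d \<inter> fst c))"
    by (rule smooth_on_compose[OF open_overlap[OF d assms(1)] open_chart_image[OF assms(1)] assms(2)
        smooth_transition[OF d assms(1)]]) (use sub in auto)
  then have "smooth_on (\<lambda>y. frechet_derivative (transition c d) (at (transition d c y)) (F (transition d c y)))
      (snd d ` (fst d \<inter> fst c))"
    using sub
    by (rule smooth_on_frechet_derivative[OF open_overlap[OF d assms(1)] open_overlap[OF assms(1) d]
        smooth_transition[OF assms(1) d] smooth_transition[OF d assms(1)]])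
  then show "smooth_on (\<lambda>y. coord_vec \<B> c (chart_inv d y) (F (snd c (chart_inv d y))) d) (snd d ` (fst d \<inter> fst c))"
    by (rule smooth_on_cong[OF open_overlap[OF d assms(1)]])
      (use d assms(1) in \<open>auto simp: coord_vec_def\<close>)
qed (use assms coord_vec_in_tangent_space in auto)

end


subsection \<open>Curves and tangent vectors of subsets\<close>

lemma chart_inv_ident: "t \<in> I \<Longrightarrow> chart_inv (I, \<lambda>t. t) t = t"
  unfolding chart_inv_def by (rule inv_into_f_eq) auto

context atlas
begin

lemma smooth_curve_in_chart:
  assumes "smooth_map {({-\<epsilon><..<\<epsilon>::real}, \<lambda>t. t)} \<B> \<gamma>" "c \<in> \<B>"
  shows "open {t \<in> {-\<epsilon><..<\<epsilon>}. \<gamma> t \<in> fst c}" "smooth_on (\<lambda>t. snd c (\<gamma> t)) {t \<in> {-\<epsilon><..<\<epsilon>}. \<gamma> t \<in> fst c}"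
proof -
  let ?D = "{t \<in> {-\<epsilon><..<\<epsilon>}. \<gamma> t \<in> fst c}"
  show D: "open ?D"
    using assms unfolding smooth_map_def Let_def by auto
  have "smooth_on (snd c \<circ> \<gamma> \<circ> chart_inv ({-\<epsilon><..<\<epsilon>}, \<lambda>t. t)) ?D"
    using assms unfolding smooth_map_def Let_def by auto
  then show "smooth_on (\<lambda>t. snd c (\<gamma> t)) ?D"
    by (rule smooth_on_cong[OF D]) (auto simp: chart_inv_ident)
qed

lemma velocity_in_chart:
  assumes "smooth_map {({-\<epsilon><..<\<epsilon>::real}, \<lambda>t. t)} \<B> \<gamma>" "\<epsilon> > 0" "c \<in> \<B>" "\<gamma> 0 \<in> fst c"
  shows "((\<lambda>t. snd c (\<gamma> t)) has_vector_derivative velocity \<B> \<gamma> 0 c) (at 0)"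
proof -
  have "((\<lambda>t. snd c (\<gamma> t)) has_derivative frechet_derivative (\<lambda>t. snd c (\<gamma> t)) (at 0)) (at 0)"
    by (rule smooth_on_has_derivative[OF smooth_curve_in_chart(2)[OF assms(1,3)]]) (use assms in auto)
  then have "(\<lambda>t. snd c (\<gamma> t)) differentiable (at 0)" unfolding differentiable_def by blast
  then show ?thesis
    using assms by (simp add: velocity_def vector_derivative_works[symmetric] o_def)
qed

lemma velocity_in_tangent_space:
  assumes "smooth_map {({-\<epsilon><..<\<epsilon>::real}, \<lambda>t. t)} \<B> \<gamma>" "\<epsilon> > 0"
  shows "velocity \<B> \<gamma> 0 \<in> tangent_space \<B> (\<gamma> 0)"
  unfolding tangent_space_def
proof (intro CollectI conjI ballI impI allI)
  fix c d assume cd: "c \<in> \<B>" "d \<in> \<B>" "\<gamma> 0 \<in> fst c \<inter> fst d"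
  let ?D = "{t \<in> {-\<epsilon><..<\<epsilon>}. \<gamma> t \<in> fst c}"
  note vc = velocity_in_chart[OF assms cd(1)] and vd = velocity_in_chart[OF assms cd(2)]
  have "((\<lambda>t. transition c d (snd c (\<gamma> t))) has_derivative
      (\<lambda>t. frechet_derivative (transition c d) (at (snd c (\<gamma> 0))) (t *\<^sub>R velocity \<B> \<gamma> 0 c))) (at 0)"
    by (rule has_derivative_compose[OF vc[unfolded has_vector_derivative_def] transition_has_derivative])
      (use cd in auto)
  then have "((\<lambda>t. snd d (\<gamma> t)) has_derivative
      (\<lambda>t. frechet_derivative (transition c d) (at (snd c (\<gamma> 0))) (t *\<^sub>R velocity \<B> \<gamma> 0 c))) (at 0)"
    by (rule has_derivative_transform_within_open[OF _ smooth_curve_in_chart(1)[OF assms(1) cd(1)]])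
      (use cd assms in auto)
  moreover have "((\<lambda>t. snd d (\<gamma> t)) has_derivative (\<lambda>t. t *\<^sub>R velocity \<B> \<gamma> 0 d)) (at 0)"
    using vd cd by (simp add: has_vector_derivative_def)
  ultimately have "(\<lambda>t. frechet_derivative (transition c d) (at (snd c (\<gamma> 0))) (t *\<^sub>R velocity \<B> \<gamma> 0 c)) =
      (\<lambda>t. t *\<^sub>R velocity \<B> \<gamma> 0 d)"
    by (rule has_derivative_unique)
  from fun_cong[OF this, of 1]
  show "velocity \<B> \<gamma> 0 d = frechet_derivative (transition c d) (at (snd c (\<gamma> 0))) (velocity \<B> \<gamma> 0 c)"
    by simp
qed (auto simp: velocity_def)

lemma sub_tangent_space_subset: "sub_tangent_space \<B> S p \<subseteq> tangent_space \<B> p"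
  unfolding sub_tangent_space_def using velocity_in_tangent_space by blast

lemma smooth_map_curve_from_chart:
  assumes "c \<in> \<B>" "smooth_on \<sigma> {-\<epsilon><..<\<epsilon>::real}" "\<sigma> ` {-\<epsilon><..<\<epsilon>} \<subseteq> snd c ` fst c"
  shows "smooth_map {({-\<epsilon><..<\<epsilon>}, \<lambda>t. t)} \<B> (\<lambda>t. chart_inv c (\<sigma> t))"
proof -
  let ?I = "{-\<epsilon><..<\<epsilon>}"
  have inc: "chart_inv c (\<sigma> t) \<in> fst c" if "t \<in> ?I" for t
    using assms(3) that chart_chart_inv(1)[of "\<sigma> t" c] by blast
  have "open D \<and> smooth_on (snd d \<circ> (\<lambda>t. chart_inv c (\<sigma> t)) \<circ> chart_inv (?I, \<lambda>t. t)) D"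
    if d: "d \<in> \<B>" and D: "D = {t \<in> ?I. chart_inv c (\<sigma> t) \<in> fst d}" for d D
  proof
    have "D = ?I \<inter> \<sigma> -` (snd c ` (fst c \<inter> fst d))"
    proof (intro equalityI subsetI)
      fix t assume t: "t \<in> D"
      then have "\<sigma> t \<in> snd c ` fst c"
        using D assms(3) by blast
      then have "\<sigma> t = snd c (chart_inv c (\<sigma> t))"
        by (rule chart_chart_inv(2)[symmetric])
      then show "t \<in> ?I \<inter> \<sigma> -` (snd c ` (fst c \<inter> fst d))"
        using t inc D by auto
    qed (use D assms(1) in auto)
    moreover have "open (?I \<inter> \<sigma> -` (snd c ` (fst c \<inter> fst d)))"
      using continuous_on_open_vimage[of ?I \<sigma>]
        smooth_on_continuous[OF assms(2)] open_overlap[OF assms(1) d] by (auto simp: Int_commute)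
    ultimately show o: "open D" by simp
    have sub: "\<sigma> ` D \<subseteq> snd c ` (fst c \<inter> fst d)"
      using \<open>D = ?I \<inter> \<sigma> -` (snd c ` (fst c \<inter> fst d))\<close> by auto
    have "smooth_on (\<lambda>t. transition c d (\<sigma> t)) D"
      by (rule smooth_on_compose[OF o open_overlap[OF assms(1) d] smooth_transition[OF assms(1) d]
          smooth_on_subset[OF assms(2)] sub]) (use D in auto)
    then show "smooth_on (snd d \<circ> (\<lambda>t. chart_inv c (\<sigma> t)) \<circ> chart_inv (?I, \<lambda>t. t)) D"
      by (rule smooth_on_cong[OF o]) (use D in \<open>auto simp: chart_inv_ident transition_def\<close>)
  qed
  moreover have "(\<lambda>t. chart_inv c (\<sigma> t)) ` ?I \<subseteq> points \<B>"
    using inc assms(1) by (auto simp: points_def)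
  ultimately show ?thesis
    unfolding smooth_map_def Let_def by (auto simp: points_def)
qed

text \<open>The curve is the image under \<sigma> of the segment through \<open>z\<close> in the
  direction \<open>u\<close>. The parameter space is arbitrary, so the same lemma serves at every
  point of a surface and in every direction.\<close>

lemma sub_tangent_spaceI:
  fixes \<sigma> :: "'d::euclidean_space \<Rightarrow> 'e"
  assumes "c \<in> \<B>" "open N" "z \<in> N" "smooth_on \<sigma> N" "\<sigma> ` N \<subseteq> snd c ` (fst c \<inter> S)"
  shows "coord_vec \<B> c (chart_inv c (\<sigma> z)) (frechet_derivative \<sigma> (at z) u) \<in>
    sub_tangent_space \<B> S (chart_inv c (\<sigma> z))"
proof -
  \<comment> \<open>The segment stays in a ball inside \<open>N\<close>; the summand 1 in the
    denominator covers \<open>u = 0\<close>.\<close>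
  obtain \<epsilon>::real where \<epsilon>: "\<epsilon> > 0" "\<And>t. t \<in> {-\<epsilon><..<\<epsilon>} \<Longrightarrow> z + t *\<^sub>R u \<in> N"
  proof -
    obtain r where r: "r > 0" "ball z r \<subseteq> N" using assms(2,3) open_contains_ball by blast
    have "z + t *\<^sub>R u \<in> N" if "t \<in> {-(r / (norm u + 1))<..<r / (norm u + 1)}" for t
    proof -
      have pos: "norm u + 1 > 0" by (simp add: add_nonneg_pos)
      have "\<bar>t\<bar> < r / (norm u + 1)" using that by auto
      then have "\<bar>t\<bar> * (norm u + 1) < r" using pos by (simp add: pos_less_divide_eq)
      moreover have "\<bar>t\<bar> * norm u \<le> \<bar>t\<bar> * (norm u + 1)" by (simp add: mult_left_mono)
      ultimately have "dist z (z + t *\<^sub>R u) < r" by (simp add: dist_norm)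
      then show ?thesis using r(2) by auto
    qed
    then show thesis using that[of "r / (norm u + 1)"] r(1) by (simp add: add_nonneg_pos)
  qed
  let ?I = "{-\<epsilon><..<\<epsilon>}" and ?l = "\<lambda>t::real. z + t *\<^sub>R u"
  let ?\<gamma> = "\<lambda>t. chart_inv c (\<sigma> (?l t))"
  have l: "smooth_on ?l ?I"
    by (rule smooth_on_add[OF open_greaterThanLessThan smooth_on_const
          smooth_on_bounded_linear[OF bounded_linear_scaleR_left]]) auto
  have s: "smooth_on (\<lambda>t. \<sigma> (?l t)) ?I"
    by (rule smooth_on_compose[OF open_greaterThanLessThan assms(2,4) l]) (use \<epsilon> in auto)
  have im: "\<sigma> (?l t) \<in> snd c ` (fst c \<inter> S)" if "t \<in> ?I" for t
    using assms(5) \<epsilon>(2)[OF that] by auto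
  have sm: "smooth_map {(?I, \<lambda>t. t)} \<B> ?\<gamma>"
    by (rule smooth_map_curve_from_chart[OF assms(1) s]) (use im in blast)
  have "?\<gamma> t \<in> fst c \<inter> S" "snd c (?\<gamma> t) = \<sigma> (?l t)" if t: "t \<in> ?I" for t
  proof -
    obtain q where "q \<in> fst c \<inter> S" "\<sigma> (?l t) = snd c q" using im[OF t] by blast
    then show "?\<gamma> t \<in> fst c \<inter> S" "snd c (?\<gamma> t) = \<sigma> (?l t)" using assms(1) by auto
  qed
  note g = this
  have 0: "0 \<in> ?I" using \<epsilon> by simp
  have ld: "(?l has_derivative (\<lambda>t. t *\<^sub>R u)) (at 0)" by (auto intro!: derivative_eq_intros)
  have sd: "(\<sigma> has_derivative frechet_derivative \<sigma> (at z)) (at (?l 0))"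
    using smooth_on_has_derivative[OF assms(4,3)] by simp
  have lin: "linear (frechet_derivative \<sigma> (at z))" by (rule has_derivative_linear[OF sd])
  have "((\<lambda>t. snd c (?\<gamma> t)) has_derivative (\<lambda>t. frechet_derivative \<sigma> (at z) (t *\<^sub>R u))) (at 0)"
    by (rule has_derivative_transform_within_open[OF has_derivative_compose[OF ld sd]
        open_greaterThanLessThan 0]) (use g in simp)
  then have "((\<lambda>t. snd c (?\<gamma> t)) has_vector_derivative frechet_derivative \<sigma> (at z) u) (at 0)"
    unfolding has_vector_derivative_def by (simp add: linear_scale[OF lin])
  moreover have "((\<lambda>t. snd c (?\<gamma> t)) has_vector_derivative velocity \<B> ?\<gamma> 0 c) (at 0)"
    by (rule velocity_in_chart[OF sm \<epsilon>(1) assms(1)]) (use g(1)[OF 0] in simp)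
  ultimately have "velocity \<B> ?\<gamma> 0 c = frechet_derivative \<sigma> (at z) u"
    by (rule vector_derivative_unique_at[symmetric])
  moreover have "velocity \<B> ?\<gamma> 0 \<in> tangent_space \<B> (chart_inv c (\<sigma> z))"
    using velocity_in_tangent_space[OF sm \<epsilon>(1)] by simp
  moreover have "chart_inv c (\<sigma> z) \<in> fst c" using g(1)[OF 0] by simp
  ultimately have eq: "coord_vec \<B> c (chart_inv c (\<sigma> z)) (frechet_derivative \<sigma> (at z) u) = velocity \<B> ?\<gamma> 0"
    using tangent_vector_eq_coord_vec[OF assms(1)] by metis
  show ?thesis
    unfolding sub_tangent_space_def eq
    by (intro CollectI exI[of _ ?\<gamma>] exI[of _ \<epsilon>]) (use \<epsilon>(1) sm g(1) in auto)
qed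

text \<open>
  Two extensions agree along a surface in \<open>S\<close> tangent to \<open>X\<close> and \<open>Y\<close>, and the exterior derivative
  commutes with the pullback to this surface.
\<close>

lemma ext_deriv_local_extension_unique:
  fixes \<sigma> :: "real \<times> real \<Rightarrow> 'e"
  assumes ext: "local_extension \<B> S \<alpha> p W1 \<beta>1" "local_extension \<B> S \<alpha> p W2 \<beta>2"
    and c: "c = chart_at \<B> p" "c \<in> \<B>" "p \<in> fst c"
    and \<sigma>: "open N" "0 \<in> N" "smooth_on \<sigma> N" "\<sigma> ` N \<subseteq> snd c ` (fst c \<inter> S)" "\<sigma> 0 = snd c p"
    and XY: "frechet_derivative \<sigma> (at 0) (1, 0) = X c" "frechet_derivative \<sigma> (at 0) (0, 1) = Y c"
  shows "ext_deriv \<B> \<beta>1 p X Y = ext_deriv \<B> \<beta>2 p X Y"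
proof -
  define W where "W = W1 \<inter> W2"
  define T where "T = snd c ` (fst c \<inter> W)"
  have "openin (manifold_topology \<B>) W"
    using ext unfolding W_def local_extension_def by (intro openin_Int) auto
  then have T: "open T"
    unfolding openin_manifold_topology[OF smooth_atlas] T_def using c(2) by blast
  have pW: "snd c p \<in> T" using ext c(3) unfolding T_def W_def local_extension_def by auto
  define b1 where "b1 z v = form_coeff \<B> \<beta>1 c v z" for z v
  define b2 where "b2 z v = form_coeff \<B> \<beta>2 c v z" for z v
  \<comment> \<open>A form is only known to be linear on tangent vectors over its domain; the linear
    map \<open>coord_vec\<close> carries this over to coordinates.\<close>
  have lin: "linear (\<lambda>v. form_coeff \<B> \<beta> c v z)"
    if sf: "smooth_one_form \<B> V \<beta>" and z: "z \<in> snd c ` (fst c \<inter> V)" for z V \<beta>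
  proof -
    obtain q where q: "q \<in> fst c" "q \<in> V" "z = snd c q" using z by blast
    note l = linear_coord_vec[OF c(2) q(1)]
    have *: "\<beta> q (a *\<^sub>R coord_vec \<B> c q x + coord_vec \<B> c q y) =
      a *\<^sub>R \<beta> q (coord_vec \<B> c q x) + \<beta> q (coord_vec \<B> c q y)" for a x y
      using sf q(2) coord_vec_in_tangent_space[OF c(2) q(1)] unfolding smooth_one_form_def by blast
    have "form_coeff \<B> \<beta> c (a *\<^sub>R x + y) z = a *\<^sub>R form_coeff \<B> \<beta> c x z + form_coeff \<B> \<beta> c y z" for a x y
      using *[of a x y] c(2) q by (simp add: form_coeff_def linear_add[OF l] linear_scale[OF l])
    note e = this
    have e0: "form_coeff \<B> \<beta> c 0 z = 0" using e[of 1 0 0] by simp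
    show ?thesis using e[of 1] e[of _ _ 0] by (intro linearI) (simp_all add: e0)
  qed
  have sub1: "T \<subseteq> snd c ` (fst c \<inter> W1)" and sub2: "T \<subseteq> snd c ` (fst c \<inter> W2)"
    unfolding T_def W_def by auto
  have sf: "smooth_one_form \<B> W1 \<beta>1" "smooth_one_form \<B> W2 \<beta>2"
    using ext unfolding local_extension_def by auto
  have lin1: "linear (b1 z)" and lin2: "linear (b2 z)" if "z \<in> T" for z
    using lin[OF sf(1)] lin[OF sf(2)] that sub1 sub2 by (auto simp: b1_def[abs_def] b2_def[abs_def])
  have sm: "smooth_on (\<lambda>z. b1 z v) T" "smooth_on (\<lambda>z. b2 z v) T" for v
    using sf c(2) smooth_on_subset[OF _ sub1] smooth_on_subset[OF _ sub2]
    unfolding smooth_one_form_def b1_def b2_def by blast+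
  define b where "b z v = b1 z v - b2 z v" for z v
  have linb: "linear (b z)" if "z \<in> T" for z
    using linear_compose_sub[OF lin1[OF that] lin2[OF that]] by (simp add: b_def[abs_def])
  define N' where "N' = N \<inter> \<sigma> -` T"
  have N': "open N'"
    using continuous_on_open_vimage[OF \<sigma>(1), of \<sigma>] smooth_on_continuous[OF \<sigma>(3)] T
    by (auto simp: N'_def Int_commute)
  have 0: "0 \<in> N'" using \<sigma>(2,5) pW by (simp add: N'_def)
  have sm': "smooth_on \<sigma> N'" by (rule smooth_on_subset[OF \<sigma>(3)]) (simp add: N'_def)
  \<comment> \<open>At every point of the surface, not only at \<open>p\<close>, the image of
    \<open>u\<close> is tangent to \<open>S\<close>, where both extensions equal \<alpha>. Hence the
    pullback of their difference \<open>b\<close> vanishes.\<close>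
  have zero: "b (\<sigma> z) (frechet_derivative \<sigma> (at z) u) = 0" if "z \<in> N'" for z u
  proof -
    let ?q = "chart_inv c (\<sigma> z)"
    let ?V = "coord_vec \<B> c ?q (frechet_derivative \<sigma> (at z) u)"
    have "?V \<in> sub_tangent_space \<B> S ?q"
      by (rule sub_tangent_spaceI[OF c(2) \<sigma>(1) _ \<sigma>(3,4)]) (use that in \<open>simp add: N'_def\<close>)
    moreover have "z \<in> N" "\<sigma> z \<in> T" using that by (simp_all add: N'_def)
    then have "\<sigma> z \<in> snd c ` (fst c \<inter> S)" using \<sigma>(4) by (simp add: image_subset_iff)
    then have "?q \<in> S" by (rule imageE) (simp add: c(2))
    moreover have "?q \<in> W"
      using \<open>\<sigma> z \<in> T\<close> unfolding T_def by (rule imageE) (simp add: c(2))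
    ultimately have "\<alpha> ?q ?V = \<beta>1 ?q ?V" "\<alpha> ?q ?V = \<beta>2 ?q ?V"
      using ext unfolding local_extension_def W_def by blast+
    then show ?thesis by (simp add: b_def b1_def b2_def form_coeff_def)
  qed
  have d: "(\<lambda>z. b1 z v) differentiable (at (snd c p))" "(\<lambda>z. b2 z v) differentiable (at (snd c p))" for v
    using smooth_on_has_derivative[OF sm(1) pW] smooth_on_has_derivative[OF sm(2) pW]
    unfolding differentiable_def by blast+
  have Db: "frechet_derivative (\<lambda>z. b z v) (at (snd c p)) w =
    frechet_derivative (\<lambda>z. b1 z v) (at (snd c p)) w - frechet_derivative (\<lambda>z. b2 z v) (at (snd c p)) w" for v w
    using fun_cong[OF frechet_derivative_at[OF has_derivative_diff[OF
      smooth_on_has_derivative[OF sm(1) pW, of v] smooth_on_has_derivative[OF sm(2) pW, of v]]]]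
    by (simp add: b_def)
  \<comment> \<open>The pullback vanishes on a neighbourhood of 0, so its derivatives at 0 vanish as
    well.\<close>
  have D0: "frechet_derivative (\<lambda>z. b (\<sigma> z) (frechet_derivative \<sigma> (at z) u)) (at 0) v = 0" for u v
  proof -
    have "((\<lambda>z. b (\<sigma> z) (frechet_derivative \<sigma> (at z) u)) has_derivative (\<lambda>_. 0)) (at 0)"
      by (rule has_derivative_transform_within_open[OF has_derivative_const N' 0]) (simp add: zero)
    from fun_cong[OF frechet_derivative_at[OF this], of v] show ?thesis by (rule sym)
  qed
  have "frechet_derivative (\<lambda>z. b z (Y c)) (at (snd c p)) (X c) - frechet_derivative (\<lambda>z. b z (X c)) (at (snd c p)) (Y c) = 0"
  proof -
    have im: "\<sigma> ` N' \<subseteq> T" by (auto simp: N'_def)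
    have "(\<lambda>z. b z v) differentiable (at (\<sigma> 0))" for v
      unfolding b_def \<sigma>(5) by (intro differentiable_diff d)
    from exterior_derivative_pullback[OF N' 0 T im linb this sm', of "(0, 1)" "(1, 0)"]
    show ?thesis by (simp only: D0 XY \<sigma>(5) diff_self)
  qed
  then show ?thesis
    unfolding Db ext_deriv_def Let_def c(1)[symmetric] by (simp add: b1_def b2_def algebra_simps)
qed

end


subsection \<open>Matrices\<close>

lemma bounded_bilinear_matrix_mult: "bounded_bilinear ((**) :: real^'m^'l \<Rightarrow> real^'k^'m \<Rightarrow> real^'k^'l)"
  unfolding bilinear_conv_bounded_bilinear[symmetric] bilinear_def
  by (auto intro!: linearI simp: matrix_add_ldistrib matrix_matrix_mult_def vec_eq_iff
      sum.distrib sum_distrib_left algebra_simps)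

lemma bounded_bilinear_matrix_vector_mult: "bounded_bilinear ((*v) :: real^'m^'l \<Rightarrow> real^'m \<Rightarrow> real^'l)"
  unfolding bilinear_conv_bounded_bilinear[symmetric] bilinear_def
  by (auto intro!: linearI simp: algebra_simps scaleR_matrix_vector_assoc)

lemma bounded_linear_transpose: "bounded_linear (transpose :: real^'m^'l \<Rightarrow> real^'l^'m)"
  unfolding linear_conv_bounded_linear[symmetric]
  by (auto intro!: linearI simp: transpose_def vec_eq_iff)

lemmas smooth_on_matrix_mult = smooth_on_bilinear[OF bounded_bilinear_matrix_mult]
lemmas smooth_on_matrix_vector_mult = smooth_on_bilinear[OF bounded_bilinear_matrix_vector_mult]
lemmas smooth_on_transpose = smooth_on_linear[OF bounded_linear_transpose]

lemma linear_transpose: "linear (transpose :: real^'m^'l \<Rightarrow> real^'l^'m)"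
  using bounded_linear_transpose by (rule bounded_linear.linear)

lemmas transpose_add = linear_add[OF linear_transpose]
lemmas transpose_diff = linear_diff[OF linear_transpose]

lemmas matrix_bilinear_simps =
  bounded_bilinear.add_left[OF bounded_bilinear_matrix_mult]
  bounded_bilinear.add_right[OF bounded_bilinear_matrix_mult]
  bounded_bilinear.diff_left[OF bounded_bilinear_matrix_mult]
  bounded_bilinear.diff_right[OF bounded_bilinear_matrix_mult]
  bounded_bilinear.minus_left[OF bounded_bilinear_matrix_mult]
  bounded_bilinear.minus_right[OF bounded_bilinear_matrix_mult]
  bounded_bilinear.zero_left[OF bounded_bilinear_matrix_mult]
  bounded_bilinear.zero_right[OF bounded_bilinear_matrix_mult]
  bounded_bilinear.scaleR_left[OF bounded_bilinear_matrix_mult]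
  bounded_bilinear.scaleR_right[OF bounded_bilinear_matrix_mult]

lemma inner_matrix_transpose: "a \<bullet> (M *v b) = b \<bullet> (transpose M *v a)" for M :: "real^'n^'m"
  by (metis dot_lmul_matrix inner_commute transpose_matrix_vector)

lemma matrix_eqI_inner:
  fixes M N :: "real^'n^'m"
  assumes "\<And>a b. a \<bullet> (M *v b) = a \<bullet> (N *v b)"
  shows "M = N"
  using assms vector_eq_ldot unfolding matrix_eq by blast

text \<open>Translates between the matrix equation \<open>transpose m ** G ** m = mat 1\<close> and
  orthonormality of the columns of \<open>m\<close>, the form in which Gram-Schmidt works.\<close>

lemma gram_entry:
  fixes A B G :: "real^'n^'n"
  shows "(transpose A ** G ** B) $ i $ j = column i A \<bullet> (G *v column j B)"
proof -
  have "(transpose A ** (G ** B)) $ i $ j = column i A \<bullet> (G *v column j B)"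
    by (simp add: matrix_matrix_mult_def transpose_def column_def inner_vec_def matrix_vector_mult_def)
  then show ?thesis by (simp add: matrix_mul_assoc)
qed

section \<open>The matrix exponential at 0\<close>

lemma matrix_exp_0: "matrix_exp 0 = (mat 1 :: real^'n^'n)"
proof -
  have pow: "((\<lambda>Y. 0 ** Y) ^^ k) (mat 1 :: real^'n^'n) = (if k = 0 then mat 1 else 0)" for k
    by (cases k) (auto simp: matrix_bilinear_simps)
  then have "matrix_exp 0 = (\<Sum>k. if k = 0 then mat 1 else 0 :: real^'n^'n)"
    unfolding matrix_exp_def by (simp only: pow) (intro suminf_cong, auto)
  also have "\<dots> = mat 1" using suminf_finite[of "{0}" "\<lambda>k. if k = 0 then mat 1 else 0 :: real^'n^'n"] by simp
  finally show ?thesis .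
qed

text \<open>Each component is a power series in \<open>t\<close> that converges everywhere; termwise
  differentiation at 0 leaves only the coefficient of \<open>t\<close>, which belongs to
  \<open>P 1 = Z\<close>.\<close>

lemma matrix_exp_has_vector_derivative:
  fixes Z :: "real^'n^'n"
  shows "((\<lambda>t. matrix_exp (t *\<^sub>R Z)) has_vector_derivative Z) (at 0)"
proof -
  define P where "P k = ((\<lambda>Y. Z ** Y) ^^ k) (mat 1)" for k
  obtain B where B: "B \<ge> 0" "\<And>Y :: real^'n^'n. norm (Z ** Y) \<le> norm Y * B"
    using bounded_linear.nonneg_bounded[OF bounded_bilinear.bounded_linear_right[OF bounded_bilinear_matrix_mult, of Z]]
    by blast
  \<comment> \<open>Compares the series with that of the real exponential of
    \<bar>\<open>t\<close>\<bar> times \<open>B\<close>.\<close>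
  have nP: "norm (P k) \<le> B ^ k * norm (P 0)" for k
  proof (induction k)
    case (Suc k)
    have "norm (P (Suc k)) \<le> norm (P k) * B" using B(2) by (simp add: P_def)
    also have "\<dots> \<le> B ^ k * norm (P 0) * B" using Suc B(1) by (rule mult_right_mono)
    finally show ?case by (simp add: mult_ac)
  qed simp
  have scale: "((\<lambda>Y. (t *\<^sub>R Z) ** Y) ^^ k) (mat 1) = t ^ k *\<^sub>R P k" for t k
    by (induction k) (auto simp: P_def matrix_bilinear_simps)
  have sm: "summable (\<lambda>k. (t ^ k / fact k) *\<^sub>R P k)" for t
  proof (rule summable_comparison_test')
    show "summable (\<lambda>k. norm (P 0) * ((\<bar>t\<bar> * B) ^ k /\<^sub>R fact k))"
      by (intro summable_mult summable_exp_generic)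
    show "norm ((t ^ k / fact k) *\<^sub>R P k) \<le> norm (P 0) * ((\<bar>t\<bar> * B) ^ k /\<^sub>R fact k)" if "k \<ge> 0" for k
      using mult_left_mono[OF nP[of k], of "\<bar>t\<bar> ^ k / fact k"]
      by (simp add: power_abs power_mult_distrib divide_simps mult_ac)
  qed
  have E: "matrix_exp (t *\<^sub>R Z) = (\<Sum>k. (t ^ k / fact k) *\<^sub>R P k)" for t
    unfolding matrix_exp_def scale by simp
  have "((\<lambda>t. matrix_exp (t *\<^sub>R Z) \<bullet> b) has_derivative (\<lambda>t. (t *\<^sub>R Z) \<bullet> b)) (at 0)" for b
  proof -
    define c where "c k = (P k \<bullet> b) / fact k" for k
    have s: "summable (\<lambda>k. c k * t ^ k)" for t
      using bounded_linear.summable[OF bounded_linear_inner_left sm[of t], of b]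
      by (simp add: c_def mult_ac)
    have Eb: "matrix_exp (t *\<^sub>R Z) \<bullet> b = (\<Sum>k. c k * t ^ k)" for t
      using bounded_linear.suminf[OF bounded_linear_inner_left sm[of t], of b]
      by (simp add: E c_def mult_ac)
    have "((\<lambda>t. \<Sum>k. c k * t ^ k) has_field_derivative (\<Sum>k. diffs c k * 0 ^ k)) (at 0)"
      by (rule termdiffs_strong_converges_everywhere[OF s])
    also have "(\<Sum>k. diffs c k * 0 ^ k) = Z \<bullet> b"
      using powser_zero[of "diffs c"] by (simp add: diffs_def c_def P_def)
    finally show ?thesis
      unfolding Eb has_field_derivative_def by (rule has_derivative_eq_rhs) (simp add: fun_eq_iff)
  qed
  then show ?thesis
    unfolding has_vector_derivative_def by (subst has_derivative_componentwise_within) blast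
qed


subsection \<open>Orthonormalisation of smooth families\<close>

lemma quadratic_has_derivative:
  fixes u w :: "'e::real_normed_vector \<Rightarrow> real^'n" and H :: "'e \<Rightarrow> real^'n^'n"
  assumes "(u has_derivative u') (at z)" "(H has_derivative H') (at z)" "(w has_derivative w') (at z)"
  shows "((\<lambda>z. u z \<bullet> (H z *v w z)) has_derivative
    (\<lambda>X. u z \<bullet> (H z *v w' X + H' X *v w z) + u' X \<bullet> (H z *v w z))) (at z)"
  by (intro has_derivative_inner bounded_bilinear.FDERIV[OF bounded_bilinear_matrix_vector_mult] assms)

lemma smooth_on_quadratic:
  fixes u w :: "'e::real_normed_vector \<Rightarrow> real^'n" and H :: "'e \<Rightarrow> real^'n^'n"
  assumes "open S" "smooth_on u S" "smooth_on H S" "smooth_on w S"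
  shows "smooth_on (\<lambda>z. u z \<bullet> (H z *v w z)) S"
  by (rule smooth_on_inner[OF assms(1,2) smooth_on_matrix_vector_mult[OF assms(1,3,4)]])

text \<open>
  Gram--Schmidt applied to a family that is orthonormal at \<open>z0\<close>; it does not change the derivative in
  those directions in which the family stays orthonormal to first order.
\<close>

lemma gram_schmidt_smooth:
  fixes m :: "'i \<Rightarrow> 'e::euclidean_space \<Rightarrow> real^'n" and H :: "'e \<Rightarrow> real^'n^'n"
  assumes "finite I" and N: "open N" "z0 \<in> N" and H: "smooth_on H N" "\<forall>z\<in>N. transpose (H z) = H z"
    and m: "\<And>i. smooth_on (m i) N"
    and on: "\<And>i j. i \<in> I \<Longrightarrow> j \<in> I \<Longrightarrow> m i z0 \<bullet> (H z0 *v m j z0) = (if i = j then 1 else 0)"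
  shows "\<exists>N' e. open N' \<and> z0 \<in> N' \<and> N' \<subseteq> N \<and>
    (\<forall>i\<in>I. smooth_on (e i) N' \<and> e i z0 = m i z0 \<and>
      (\<forall>X. (\<forall>j\<in>I. \<forall>k\<in>I. frechet_derivative (\<lambda>z. m j z \<bullet> (H z *v m k z)) (at z0) X = 0) \<longrightarrow>
        frechet_derivative (e i) (at z0) X = frechet_derivative (m i) (at z0) X)) \<and>
    (\<forall>z\<in>N'. \<forall>i\<in>I. \<forall>j\<in>I. e i z \<bullet> (H z *v e j z) = (if i = j then 1 else 0))"
  using assms(1) on
proof (induction I rule: finite_induct)
  case empty
  then show ?case using N by (intro exI[of _ N] exI[of _ m]) auto
next
  case (insert a I)
  from insert.IH[OF insert.prems] obtain N1 e where N1: "open N1" "z0 \<in> N1" "N1 \<subseteq> N"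
    and e: "\<And>i. i \<in> I \<Longrightarrow> smooth_on (e i) N1" "\<And>i. i \<in> I \<Longrightarrow> e i z0 = m i z0"
    and De: "\<And>i X. i \<in> I \<Longrightarrow> (\<forall>j\<in>I. \<forall>k\<in>I. frechet_derivative (\<lambda>z. m j z \<bullet> (H z *v m k z)) (at z0) X = 0) \<Longrightarrow>
        frechet_derivative (e i) (at z0) X = frechet_derivative (m i) (at z0) X"
    and one: "\<And>z i j. z \<in> N1 \<Longrightarrow> i \<in> I \<Longrightarrow> j \<in> I \<Longrightarrow> e i z \<bullet> (H z *v e j z) = (if i = j then 1 else 0)"
    by (smt (verit) insertCI)
  have H1: "smooth_on H N1" and m1: "smooth_on (m i) N1" for i
    using smooth_on_subset N1(3) H(1) m by blast+
  have sym: "u \<bullet> (H z *v v) = v \<bullet> (H z *v u)" if "z \<in> N1" for u v z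
    using inner_matrix_transpose[of u "H z" v] H(2) N1(3) that
    by (simp add: subset_iff del: transpose_matrix_vector)
  \<comment> \<open>Since the \<open>e i\<close> are orthonormal on all of \<open>N1\<close>, these
    coefficients project onto their span without any division.\<close>
  define c where "c i z = m a z \<bullet> (H z *v e i z)" for i z
  define f where "f z = m a z - (\<Sum>i\<in>I. c i z *\<^sub>R e i z)" for z
  define s where "s z = f z \<bullet> (H z *v f z)" for z
  \<comment> \<open>\<open>s\<close> is the squared length of \<open>f\<close> and equals 1 at
    \<open>z0\<close>; on this neighbourhood it is positive, so its power -1/2 is smooth.\<close>
  define N2 where "N2 = N1 \<inter> s -` {0<..}"
  define r where "r z = s z powr (-1/2)" for z
  define h where "h z = r z *\<^sub>R f z" for z
  have c: "smooth_on (c i) N1" if "i \<in> I" for i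
    unfolding c_def[abs_def] by (rule smooth_on_quadratic[OF N1(1) m1 H1 e(1)[OF that]])
  have f: "smooth_on f N1"
    unfolding f_def[abs_def]
    by (rule smooth_on_diff[OF N1(1) m1 smooth_on_sum[OF N1(1) smooth_on_scaleR[OF N1(1)]]]) (use c e in auto)
  have s: "smooth_on s N1" unfolding s_def[abs_def] by (rule smooth_on_quadratic[OF N1(1) f H1 f])
  have N2: "open N2"
    using continuous_on_open_vimage[OF N1(1), of s] smooth_on_continuous[OF s]
    by (auto simp: N2_def Int_commute)
  have sub: "N2 \<subseteq> N1" by (simp add: N2_def)
  have c0: "c i z0 = 0" if "i \<in> I" for i
    using insert.prems[of a i] insert.hyps that e(2) by (auto simp: c_def)
  have f0: "f z0 = m a z0" by (simp add: f_def c0)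
  have s0: "s z0 = 1" using insert.prems[of a a] by (simp add: s_def f0)
  have z2: "z0 \<in> N2" by (simp add: N2_def s0 N1)
  have r: "smooth_on r N2"
    unfolding r_def[abs_def]
    by (rule smooth_on_compose[OF N2 open_greaterThan smooth_on_powr smooth_on_subset[OF s sub]])
      (auto simp: N2_def)
  have h: "smooth_on h N2"
    unfolding h_def[abs_def] by (rule smooth_on_scaleR[OF N2 r smooth_on_subset[OF f sub]])
  have fe: "f z \<bullet> (H z *v e j z) = 0" if "z \<in> N1" "j \<in> I" for z j
  proof -
    have "(\<Sum>i\<in>I. c i z *\<^sub>R e i z) \<bullet> (H z *v e j z) = (\<Sum>i\<in>I. if i = j then c i z else 0)"
      unfolding inner_sum_left by (rule sum.cong) (use one that in auto)
    also have "\<dots> = c j z" using insert.hyps that by simp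
    finally show ?thesis by (simp add: f_def inner_diff_left c_def)
  qed
  have hh: "h z \<bullet> (H z *v h z) = 1" if "z \<in> N2" for z
  proof -
    have "s z > 0" using that by (simp add: N2_def)
    moreover have "r z * r z = s z powr (-1)"
      unfolding r_def powr_add[symmetric] by simp
    ultimately have "r z * r z * s z = 1"
      by (simp add: powr_minus)
    then show ?thesis by (simp add: h_def s_def matrix_vector_mult_scaleR mult.assoc)
  qed
  have he: "h z \<bullet> (H z *v e j z) = 0" if "z \<in> N2" "j \<in> I" for z j
    using fe that sub by (auto simp: h_def)
  \<comment> \<open>Both corrections are trivial to first order. The coefficients \<open>c i\<close>
    vanish at \<open>z0\<close>, and so do their derivatives along \<open>X\<close>, as
    \<open>e i\<close> and \<open>m i\<close> agree there to first order. Then \<open>s\<close> is 1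
    with derivative 0 along \<open>X\<close>, and so is \<open>r\<close>.\<close>
  have Dh: "frechet_derivative h (at z0) X = frechet_derivative (m a) (at z0) X"
    if X: "\<forall>j\<in>insert a I. \<forall>k\<in>insert a I. frechet_derivative (\<lambda>z. m j z \<bullet> (H z *v m k z)) (at z0) X = 0" for X
  proof -
    let ?D = "\<lambda>f. frechet_derivative f (at z0)"
    note D = smooth_on_has_derivative[OF _ N1(2)]
    note Dq = fun_cong[OF frechet_derivative_at[OF quadratic_has_derivative[OF D D[OF H1] D]], symmetric]
    have Dm: "?D (\<lambda>z. m a z \<bullet> (H z *v m k z)) X = 0" if "k \<in> insert a I" for k
      using X that by blast
    have DeX: "?D (e i) X = ?D (m i) X" if "i \<in> I" for i
      using De[OF that] X by blast
    have Dc: "?D (c i) X = 0" if i: "i \<in> I" for i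
      using Dm[of i] i
      unfolding c_def[abs_def] Dq[OF m1 e(1)[OF i]] Dq[OF m1 m1] DeX[OF i] e(2)[OF i] by simp
    have "(f has_derivative (\<lambda>X. ?D (m a) X - (\<Sum>i\<in>I. c i z0 *\<^sub>R ?D (e i) X + ?D (c i) X *\<^sub>R e i z0))) (at z0)"
      unfolding f_def[abs_def]
      by (intro has_derivative_diff has_derivative_sum has_derivative_scaleR D m1 c e)
    from fun_cong[OF frechet_derivative_at[OF this], of X] have Df: "?D f X = ?D (m a) X"
      by (simp add: c0 Dc)
    have Ds: "?D s X = 0"
      using Dm[of a] unfolding s_def[abs_def] Dq[OF f f] Dq[OF m1 m1] Df f0 by simp
    have p: "((\<lambda>x::real. x powr (-1/2)) has_derivative frechet_derivative (\<lambda>x. x powr (-1/2)) (at (s z0))) (at (s z0))"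
      by (rule smooth_on_has_derivative[OF smooth_on_powr]) (simp add: s0)
    have "(r has_derivative (\<lambda>X. frechet_derivative (\<lambda>x. x powr (-1/2)) (at (s z0)) (?D s X))) (at z0)"
      unfolding r_def[abs_def] by (rule has_derivative_compose[OF D[OF s] p])
    from fun_cong[OF frechet_derivative_at[OF this], of X] have Dr: "?D r X = 0"
      using linear_0[OF has_derivative_linear[OF p]] by (simp add: Ds)
    have "(h has_derivative (\<lambda>X. r z0 *\<^sub>R ?D f X + ?D r X *\<^sub>R f z0)) (at z0)"
      unfolding h_def[abs_def]
      by (intro has_derivative_scaleR D f smooth_on_has_derivative[OF r z2])
    from fun_cong[OF frechet_derivative_at[OF this], of X] show ?thesis
      by (simp add: Dr Df r_def s0)
  qed
  have h0: "h z0 = m a z0" by (simp add: h_def f0 r_def s0)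
  have aI: "i \<noteq> a" if "i \<in> I" for i using insert.hyps that by auto
  let ?e = "e(a := h)"
  let ?C = "\<lambda>I X. \<forall>j\<in>I. \<forall>k\<in>I. frechet_derivative (\<lambda>z. m j z \<bullet> (H z *v m k z)) (at z0) X = 0"
  have "smooth_on (?e i) N2 \<and> ?e i z0 = m i z0 \<and>
      (\<forall>X. ?C (insert a I) X \<longrightarrow> frechet_derivative (?e i) (at z0) X = frechet_derivative (m i) (at z0) X)"
    if "i \<in> insert a I" for i
  proof (cases "i = a")
    case True
    then show ?thesis using h h0 Dh by simp
  next
    case False
    then have i: "i \<in> I" "?e i = e i" using that by auto
    have "frechet_derivative (e i) (at z0) X = frechet_derivative (m i) (at z0) X" if "?C (insert a I) X" for X
      by (rule De[OF i(1)]) (use that in blast)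
    then show ?thesis
      unfolding i(2) using smooth_on_subset[OF e(1)[OF i(1)] sub] e(2)[OF i(1)] by blast
  qed
  moreover have "?e i z \<bullet> (H z *v ?e j z) = (if i = j then 1 else 0)"
    if z: "z \<in> N2" and ij: "i \<in> insert a I" "j \<in> insert a I" for z i j
  proof -
    have "z \<in> N1" using z sub by blast
    have eh: "e k z \<bullet> (H z *v h z) = 0" if "k \<in> I" for k
      using sym[OF \<open>z \<in> N1\<close>, of "e k z" "h z"] he[OF z that] by simp
    consider "i = a" "j = a" | "i = a" "j \<in> I" "j \<noteq> a" | "i \<in> I" "i \<noteq> a" "j = a" | "i \<in> I" "i \<noteq> a" "j \<in> I" "j \<noteq> a"
      using ij aI by blast
    then show ?thesis
      by cases (simp_all add: hh[OF z] he[OF z] eh one[OF \<open>z \<in> N1\<close>])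
  qed
  ultimately show ?case using N2 z2 sub N1(3) by (intro exI[of _ N2] exI[of _ ?e]) blast
qed

text \<open>The affine surface through \<open>(y0, m0)\<close> spanned by \<open>X1\<close> and
  \<open>X2\<close> has the right derivatives but leaves the orthonormal frames. Gram-Schmidt over
  the parameter plane, with the metric pulled back along the base component, corrects the matrix
  component only. By \<open>tan\<close> it keeps the derivatives at 0.\<close>

lemma orthonormal_surface:
  fixes G :: "real^'n \<Rightarrow> real^'n^'n" and m0 :: "real^'n^'n" and X1 X2 :: "(real^'n) \<times> (real^'n^'n)"
  assumes Y: "open Y" "y0 \<in> Y" and G: "smooth_on G Y" "\<And>y. y \<in> Y \<Longrightarrow> transpose (G y) = G y"
    and on: "transpose m0 ** G y0 ** m0 = mat 1"
    and tan: "\<And>v w. (v, w) \<in> {X1, X2} \<Longrightarrow>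
      transpose w ** G y0 ** m0 + transpose m0 ** frechet_derivative G (at y0) v ** m0 + transpose m0 ** G y0 ** w = 0"
  obtains N \<sigma> where "open N" "(0::real \<times> real) \<in> N" "smooth_on \<sigma> N" "\<sigma> 0 = (y0, m0)"
    "\<And>z. z \<in> N \<Longrightarrow> fst (\<sigma> z) \<in> Y \<and> transpose (snd (\<sigma> z)) ** G (fst (\<sigma> z)) ** snd (\<sigma> z) = mat 1"
    "frechet_derivative \<sigma> (at 0) (1, 0) = X1" "frechet_derivative \<sigma> (at 0) (0, 1) = X2"
proof -
  define l where "l z = fst z *\<^sub>R X1 + snd z *\<^sub>R X2" for z :: "real \<times> real"
  have bl: "bounded_linear l"
    unfolding l_def[abs_def] linear_conv_bounded_linear[symmetric]
    by (intro linearI) (simp_all add: algebra_simps)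
  have smU: "smooth_on (\<lambda>z. c + L (l z)) UNIV" if "bounded_linear L" for c and L :: "_ \<Rightarrow> 'x::real_normed_vector"
    by (rule smooth_on_add[OF open_UNIV smooth_on_const smooth_on_linear[OF that open_UNIV
            smooth_on_bounded_linear[OF bl open_UNIV]]])
  define yy where "yy z = y0 + fst (l z)" for z
  define M where "M z = m0 + snd (l z)" for z
  have sy: "smooth_on yy UNIV" and sM: "smooth_on M UNIV"
    unfolding yy_def[abs_def] M_def[abs_def] by (intro smU bounded_linear_fst bounded_linear_snd)+
  define N0 where "N0 = yy -` Y"
  have N0: "open N0"
    using continuous_on_open_vimage[OF open_UNIV, of yy] smooth_on_continuous[OF sy] Y(1) by (auto simp: N0_def)
  have l0: "l 0 = 0" by (simp add: l_def)
  have yM0: "yy 0 = y0" "M 0 = m0" by (simp_all add: yy_def M_def l0)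
  have 00: "0 \<in> N0" using Y(2) by (simp add: N0_def yM0)
  define H where "H z = G (yy z)" for z
  have sH: "smooth_on H N0"
    unfolding H_def[abs_def]
    by (rule smooth_on_compose[OF N0 Y(1) G(1) smooth_on_subset[OF sy]]) (auto simp: N0_def)
  have Hs: "\<forall>z\<in>N0. transpose (H z) = H z" using G(2) by (simp add: H_def N0_def)
  have blc: "bounded_linear (column i :: real^'n^'n \<Rightarrow> _)" for i
    unfolding linear_conv_bounded_linear[symmetric]
    by (intro linearI) (simp_all add: column_def vec_eq_iff)
  have sc: "smooth_on (\<lambda>z. column i (M z)) N0" for i
    by (rule smooth_on_linear[OF blc N0 smooth_on_subset[OF sM]]) auto
  have on0: "column i (M 0) \<bullet> (H 0 *v column j (M 0)) = (if i = j then 1 else 0)" for i j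
    using on by (simp add: yM0 H_def gram_entry[symmetric] mat_def)
  obtain N e where N: "open N" "0 \<in> N" "N \<subseteq> N0"
    and eD: "\<And>i. smooth_on (e i) N \<and> e i 0 = column i (M 0) \<and>
      (\<forall>X. (\<forall>j\<in>UNIV. \<forall>k\<in>UNIV. frechet_derivative (\<lambda>z. column j (M z) \<bullet> (H z *v column k (M z))) (at 0) X = 0) \<longrightarrow>
        frechet_derivative (e i) (at 0) X = frechet_derivative (\<lambda>z. column i (M z)) (at 0) X)"
    and one': "\<forall>z\<in>N. \<forall>i\<in>UNIV. \<forall>j\<in>UNIV. e i z \<bullet> (H z *v e j z) = (if i = j then 1 else 0)"
    using gram_schmidt_smooth[OF finite_class.finite_UNIV N0 00 sH Hs sc on0]
    by (elim exE conjE) (rule that, assumption, assumption, assumption, erule bspec[OF _ UNIV_I], assumption)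
  have e: "\<And>i. smooth_on (e i) N" "\<And>i. e i 0 = column i (M 0)"
    and De: "\<And>i X. (\<And>j k. frechet_derivative (\<lambda>z. column j (M z) \<bullet> (H z *v column k (M z))) (at 0) X = 0) \<Longrightarrow>
        frechet_derivative (e i) (at 0) X = frechet_derivative (\<lambda>z. column i (M z)) (at 0) X"
    using eD by blast+
  have one: "e i z \<bullet> (H z *v e j z) = (if i = j then 1 else 0)" if "z \<in> N" for z i j
    using one' that by blast
  define E where "E z = transpose (\<chi> i. e i z)" for z
  have colE: "column i (E z) = e i z" for i z by (simp add: E_def column_def transpose_def vec_eq_iff)
  have sE: "smooth_on E N"
    unfolding E_def[abs_def] by (rule smooth_on_transpose[OF N(1) smooth_on_vec_lambda[OF N(1) e(1)]])
  have E0: "E 0 = m0"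
    using e(2) yM0 by (simp add: vec_eq_iff E_def transpose_def column_def)
  define \<sigma> where "\<sigma> z = (yy z, E z)" for z
  have s\<sigma>: "smooth_on \<sigma> N"
    unfolding \<sigma>_def[abs_def] by (rule smooth_on_Pair[OF N(1) smooth_on_subset[OF sy] sE]) auto
  have Dl: "(l has_derivative l) (at 0)" by (rule bounded_linear_imp_has_derivative[OF bl])
  have Dy: "(yy has_derivative (\<lambda>X. fst (l X))) (at 0)"
    unfolding yy_def[abs_def] using has_derivative_add[OF has_derivative_const has_derivative_fst[OF Dl]] by simp
  have DM: "(M has_derivative (\<lambda>X. snd (l X))) (at 0)"
    unfolding M_def[abs_def] using has_derivative_add[OF has_derivative_const has_derivative_snd[OF Dl]] by simp
  have DH: "(H has_derivative (\<lambda>X. frechet_derivative G (at y0) (fst (l X)))) (at 0)"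
    unfolding H_def[abs_def]
    by (rule has_derivative_compose[OF Dy]) (use smooth_on_has_derivative[OF G(1) Y(2)] yM0 in simp)
  have Dc: "((\<lambda>z. column i (M z)) has_derivative (\<lambda>X. column i (snd (l X)))) (at 0)" for i
    by (rule bounded_linear.has_derivative[OF blc DM])
  have D\<sigma>: "frechet_derivative \<sigma> (at 0) X = l X" if X: "l X \<in> {X1, X2}" for X
  proof -
    obtain v w where vw: "l X = (v, w)" by (cases "l X")
    \<comment> \<open>Entry by entry, \<open>tan\<close> is the vanishing of this derivative, so the
      affine family stays orthonormal to first order along \<open>X\<close>.\<close>
    have "frechet_derivative (\<lambda>z. column j (M z) \<bullet> (H z *v column k (M z))) (at 0) X = 0" for j k
    proof -
      have "frechet_derivative (\<lambda>z. column j (M z) \<bullet> (H z *v column k (M z))) (at 0) X =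
          (transpose w ** G y0 ** m0 + transpose m0 ** frechet_derivative G (at y0) v ** m0 +
            transpose m0 ** G y0 ** w) $ j $ k"
        using fun_cong[OF frechet_derivative_at[OF quadratic_has_derivative[OF Dc DH Dc]], of j k X, symmetric]
        by (simp add: vw yM0 H_def gram_entry inner_add_right)
      then show ?thesis using tan[of v w] X vw by (simp only: zero_index)
    qed
    then have "frechet_derivative (e i) (at 0) X = column i w" for i
      using De[of X i] fun_cong[OF frechet_derivative_at[OF Dc[of i]], of X] vw by simp
    moreover have "column i (frechet_derivative E (at 0) X) = frechet_derivative (e i) (at 0) X" for i
    proof -
      have "((\<lambda>z. column i (E z)) has_derivative (\<lambda>X. column i (frechet_derivative E (at 0) X))) (at 0)"
        by (rule bounded_linear.has_derivative[OF blc smooth_on_has_derivative[OF sE N(2)]])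
      from fun_cong[OF frechet_derivative_at[OF this], of X] show ?thesis by (simp add: colE)
    qed
    ultimately have "frechet_derivative E (at 0) X = w" by (simp add: column_def vec_eq_iff)
    moreover have "(\<sigma> has_derivative (\<lambda>X. (fst (l X), frechet_derivative E (at 0) X))) (at 0)"
      unfolding \<sigma>_def[abs_def] by (rule has_derivative_Pair[OF Dy smooth_on_has_derivative[OF sE N(2)]])
    from fun_cong[OF frechet_derivative_at[OF this], of X]
    have "frechet_derivative \<sigma> (at 0) X = (fst (l X), frechet_derivative E (at 0) X)" by simp
    ultimately show ?thesis using vw by simp
  qed
  show thesis
  proof (rule that[OF N(1,2) s\<sigma>])
    show "\<sigma> 0 = (y0, m0)" by (simp add: \<sigma>_def yM0 E0)
    show "fst (\<sigma> z) \<in> Y \<and> transpose (snd (\<sigma> z)) ** G (fst (\<sigma> z)) ** snd (\<sigma> z) = mat 1" if "z \<in> N" for z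
      using one[OF that] subsetD[OF N(3) that]
      by (simp add: \<sigma>_def N0_def vec_eq_iff gram_entry colE mat_def H_def)
    show "frechet_derivative \<sigma> (at 0) (1, 0) = X1" "frechet_derivative \<sigma> (at 0) (0, 1) = X2"
      using D\<sigma>[of "(1, 0)"] D\<sigma>[of "(0, 1)"] by (simp_all add: l_def)
  qed
qed


subsection \<open>Christoffel symbols\<close>

text \<open>
  For the derivative \<open>D\<close> of a metric at a point these are the Christoffel symbols of the first kind,
  so no inverse of the metric is involved: \<open>a \<bullet> (christoffel D v *v b) = \<langle>\<nabla>\<^sub>v b, a\<rangle>\<close> for constant \<open>b\<close>.
\<close>

definition christoffel :: "(real^'n \<Rightarrow> real^'n^'n) \<Rightarrow> real^'n \<Rightarrow> real^'n^'n"
  where "christoffel D v =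
    (1/2) *\<^sub>R (D v + matrix (\<lambda>b. D b *v v) - transpose (matrix (\<lambda>b. D b *v v)))"

lemma linear_mult_vec: "linear D \<Longrightarrow> linear (\<lambda>b. D b *v v)" for D :: "real^'n \<Rightarrow> real^'n^'n"
  by (intro linearI) (simp_all add: linear_add linear_scale algebra_simps scaleR_matrix_vector_assoc)

text \<open>The Koszul formula for constant vector fields, whose brackets vanish.\<close>

lemma inner_christoffel:
  fixes D :: "real^'n \<Rightarrow> real^'n^'n"
  assumes "linear D"
  shows "a \<bullet> (christoffel D v *v b) = (a \<bullet> (D v *v b) + a \<bullet> (D b *v v) - b \<bullet> (D a *v v)) / 2"
proof -
  have m: "matrix (\<lambda>b. D b *v v) *v b = D b *v v" for b
    using fun_cong[OF matrix_vector_mul(2)[OF linear_mult_vec[OF assms]]] .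
  have "a \<bullet> (transpose (matrix (\<lambda>b. D b *v v)) *v b) = b \<bullet> (D a *v v)"
    using inner_matrix_transpose[of b "matrix (\<lambda>b. D b *v v)" a] by (simp add: m)
  then show ?thesis
    by (simp add: christoffel_def scaleR_matrix_vector_assoc[symmetric] matrix_vector_mult_add_rdistrib
        matrix_vector_mult_diff_rdistrib inner_add_right inner_diff_right m del: transpose_matrix_vector)
qed

text \<open>Compatibility with the metric: the last two summands of \<open>christoffel\<close> form
  a skew matrix and cancel against their transpose.\<close>

lemma christoffel_metric:
  assumes "transpose (D v) = D v"
  shows "christoffel D v + transpose (christoffel D v) = D v"
  using assms by (simp add: christoffel_def transpose_scalar transpose_add transpose_diff
      scaleR_add_right[symmetric] scaleR_2[symmetric])

text \<open>In the Koszul formula the first two terms are exchanged with each other, and the third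
  is symmetric because \<open>D a\<close> is. This is what makes the torsion vanish.\<close>

lemma christoffel_symmetric:
  assumes "linear D" "\<And>v. transpose (D v) = D v"
  shows "christoffel D v *v b = christoffel D b *v v"
proof -
  have "a \<bullet> (christoffel D v *v b) = a \<bullet> (christoffel D b *v v)" for a
    using inner_matrix_transpose[of b "D a" v] assms(2)[of a] by (simp add: inner_christoffel[OF assms(1)])
  then show ?thesis using vector_eq_ldot by blast
qed

lemma linear_christoffel:
  fixes D :: "real^'n \<Rightarrow> real^'n^'n"
  assumes "linear D"
  shows "linear (christoffel D)"
  by (intro linearI matrix_eqI_inner)
    (simp_all add: inner_christoffel[OF assms] matrix_vector_mult_add_rdistrib inner_add_right
      scaleR_matrix_vector_assoc[symmetric] linear_add[OF assms] linear_scale[OF assms] add_divide_distrib diff_divide_distrib algebra_simps)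

text \<open>\<open>J\<close> stands for the Jacobian of a change of coordinates, \<open>S\<close>
  for its derivative, and the hypothesis on \<open>D\<close> is the product rule for the transformed
  metric. In the Koszul combination six terms contain \<open>S\<close>: by its symmetry four cancel
  and the other two are equal, which absorbs the factor 1/2.\<close>

lemma christoffel_transform:
  fixes D D' S :: "real^'n \<Rightarrow> real^'n^'n" and G J :: "real^'n^'n"
  assumes "linear D" "linear D'" "transpose G = G"
    and D: "\<And>v. D v = transpose (S v) ** G ** J + transpose J ** D' (J *v v) ** J + transpose J ** G ** S v"
    and S: "\<And>v b. S v *v b = S b *v v"
  shows "christoffel D v = transpose J ** christoffel D' (J *v v) ** J + transpose J ** G ** S v"
proof (rule matrix_eqI_inner)
  fix a b
  have tr: "x \<bullet> (transpose A *v u) = u \<bullet> (A *v x)" for x u and A :: "real^'n^'n"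
    using inner_matrix_transpose[of u A x] by simp
  have G: "x \<bullet> (G *v u) = u \<bullet> (G *v x)" for x u
    using inner_matrix_transpose[of x G u] assms(3) by simp
  have Dab: "x \<bullet> (D v *v u) = (S v *v x) \<bullet> (G *v (J *v u)) + (J *v x) \<bullet> (D' (J *v v) *v (J *v u)) +
    (J *v x) \<bullet> (G *v (S v *v u))" for x u v
    by (simp add: D matrix_vector_mult_add_rdistrib inner_add_right matrix_vector_mul_assoc[symmetric] tr
        inner_commute del: transpose_matrix_vector)
  have "a \<bullet> ((transpose J ** christoffel D' (J *v v) ** J + transpose J ** G ** S v) *v b) =
      (J *v a) \<bullet> (christoffel D' (J *v v) *v (J *v b)) + (J *v a) \<bullet> (G *v (S v *v b))"
    by (simp add: matrix_vector_mult_add_rdistrib inner_add_right matrix_vector_mul_assoc[symmetric] tr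
        inner_commute del: transpose_matrix_vector)
  then show "a \<bullet> (christoffel D v *v b) =
    a \<bullet> ((transpose J ** christoffel D' (J *v v) ** J + transpose J ** G ** S v) *v b)"
    using Dab[of a v b] Dab[of a b v] Dab[of b a v] G[of "J *v b" "S v *v a"]
    unfolding inner_christoffel[OF assms(1)] inner_christoffel[OF assms(2)] S[of b v] S[of b a] S[of a v]
    by (simp add: inner_commute)
qed


subsection \<open>The frame bundle\<close>

lemma open_invertible: "open {m :: real^'n^'n. invertible m}"
proof -
  have "continuous_on UNIV (det :: real^'n^'n \<Rightarrow> real)"
    unfolding det_def by (intro continuous_intros)
  then have "open (UNIV \<inter> det -` (- {0}) :: (real^'n^'n) set)"
    using continuous_on_open_vimage[OF open_UNIV, of "det :: real^'n^'n \<Rightarrow> real"] by (auto simp: Int_commute)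
  then show ?thesis by (simp add: invertible_det_nz vimage_def)
qed

lemma invertible_iff_inj: "invertible m \<longleftrightarrow> inj ((*v) m)" for m :: "real^'n^'n"
  by (simp add: invertible_left_inverse matrix_left_invertible_injective)

lemma fst_image_frame_chart: "fst (frame_chart \<A> c) = {(x, u). (x, u) \<in> frames \<A> \<and> x \<in> fst c}"
  and frame_chart_apply: "snd (frame_chart \<A> c) p = (snd c (fst p), matrix (\<lambda>v. snd p v c))"
  by (auto simp: frame_chart_def split: prod.split)

text \<open>An explicit inverse of the frame chart, with the point \<open>x\<close> in place of its
  coordinates; for invertible \<open>m\<close> and \<open>x\<close> in the domain of
  \<open>c\<close> it is a frame.\<close>

definition frame_of :: "('a, real^'n) chart set \<Rightarrow> ('a, real^'n) chart \<Rightarrow> 'a \<Rightarrow> real^'n^'n \<Rightarrow> ('a, 'n) frame"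
  where "frame_of \<A> c x m = (x, \<lambda>a. coord_vec \<A> c x (m *v a))"

lemma fst_frame_of [simp]: "fst (frame_of \<A> c x m) = x"
  by (simp add: frame_of_def)

lemma frame_eq_frame_of:
  fixes \<A> :: "('a, real^'n) chart set"
  assumes "atlas \<A>" "c \<in> \<A>" "p \<in> fst (frame_chart \<A> c)"
  shows "p = frame_of \<A> c (fst p) (snd (snd (frame_chart \<A> c) p))"
    and "invertible (snd (snd (frame_chart \<A> c) p))" and "fst p \<in> fst c"
proof -
  interpret A: atlas \<A> by fact
  obtain x u where p: "p = (x, u)" by (cases p)
  have x: "x \<in> fst c" and lin: "linear u" and bij: "bij_betw u UNIV (tangent_space \<A> x)"
    using assms(3) by (auto simp: p fst_image_frame_chart frames_def)
  then show "fst p \<in> fst c" by (simp add: p)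
  have lf: "linear (\<lambda>v. u v c)"
    by (intro linearI) (simp_all add: linear_add[OF lin] linear_scale[OF lin] scaleR_fun_def)
  let ?m = "matrix (\<lambda>v. u v c)"
  have m: "?m *v a = u a c" for a
    using fun_cong[OF matrix_vector_mul(2)[OF lf]] .
  have T: "u a \<in> tangent_space \<A> x" for a using bij by (auto simp: bij_betw_def)
  have "u a = coord_vec \<A> c x (?m *v a)" for a
    unfolding m by (rule A.tangent_vector_eq_coord_vec[OF assms(2) x T])
  then show "p = frame_of \<A> c (fst p) (snd (snd (frame_chart \<A> c) p))"
    by (simp add: p frame_chart_apply frame_of_def fun_eq_iff)
  have "inj ((*v) ?m)"
  proof (rule injI)
    fix a b assume "?m *v a = ?m *v b"
    then have "u a = u b" unfolding m by (intro A.tangent_vector_eqI[OF assms(2) x T T])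
    then show "a = b" using bij by (auto simp: bij_betw_def inj_on_def)
  qed
  then show "invertible (snd (snd (frame_chart \<A> c) p))"
    by (simp add: p frame_chart_apply invertible_iff_inj)
qed

locale frame_bundle = atlas \<A> for \<A> :: "('a, real^'n) chart set"
begin

abbreviation fchart where "fchart \<equiv> frame_chart \<A>"

definition jacobian :: "('a, real^'n) chart \<Rightarrow> ('a, real^'n) chart \<Rightarrow> real^'n \<Rightarrow> real^'n^'n"
  where "jacobian c d y = matrix (frechet_derivative (transition c d) (at y))"

lemmas frame_eq = frame_eq_frame_of[OF atlas_axioms]

lemma fst_fchart_apply: "fst (snd (fchart c) p) = snd c (fst p)"
  by (simp add: frame_chart_apply)

lemma frame_of_in_fchart:
  assumes "c \<in> \<A>" "x \<in> fst c" "invertible m"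
  shows "frame_of \<A> c x m \<in> fst (fchart c)" "snd (fchart c) (frame_of \<A> c x m) = (snd c x, m)"
proof -
  note l = linear_coord_vec[OF assms(1,2)]
  have "linear (\<lambda>a. coord_vec \<A> c x (m *v a))"
    using linear_compose[OF matrix_vector_mul_linear l] by (simp add: o_def)
  moreover have "bij_betw (\<lambda>a. coord_vec \<A> c x (m *v a)) UNIV (tangent_space \<A> x)"
    unfolding bij_betw_def
  proof
    show "inj (\<lambda>a. coord_vec \<A> c x (m *v a))"
    proof (rule injI)
      fix a b assume "coord_vec \<A> c x (m *v a) = coord_vec \<A> c x (m *v b)"
      from fun_cong[OF this, of c] have "m *v a = m *v b" using assms by simp
      then show "a = b" using assms(3) by (simp add: invertible_iff_inj inj_def)
    qed
    obtain m' where m': "m ** m' = mat 1" using assms(3) by (auto simp: invertible_def)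
    have "X = coord_vec \<A> c x (m *v (m' *v X c))" if "X \<in> tangent_space \<A> x" for X
      using tangent_vector_eq_coord_vec[OF assms(1,2) that] by (simp add: matrix_vector_mul_assoc m')
    then show "range (\<lambda>a. coord_vec \<A> c x (m *v a)) = tangent_space \<A> x"
      using coord_vec_in_tangent_space[OF assms(1,2)] by blast
  qed
  ultimately show "frame_of \<A> c x m \<in> fst (fchart c)"
    using assms by (auto simp: fst_image_frame_chart frame_of_def frames_def points_def)
  show "snd (fchart c) (frame_of \<A> c x m) = (snd c x, m)"
    using assms by (simp add: frame_of_def frame_chart_apply)
qed

lemma frames_in_fchart: "p \<in> frames \<A> \<Longrightarrow> fst p \<in> fst c \<Longrightarrow> p \<in> fst (fchart c)"
  by (cases p) (simp add: fst_image_frame_chart)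

lemma fchart_in_frames: "p \<in> fst (fchart c) \<Longrightarrow> p \<in> frames \<A>"
  and fchart_base: "p \<in> fst (fchart c) \<Longrightarrow> fst p \<in> fst c"
  by (cases p; simp add: fst_image_frame_chart)+

text \<open>A frame lies in the domain of an induced chart as soon as its base point lies in the
  chart below, so the overlap restricts only the base coordinates.\<close>

lemma fchart_overlap_image:
  assumes "c \<in> \<A>" "d \<in> \<A>"
  shows "snd (fchart c) ` (fst (fchart c) \<inter> fst (fchart d)) = (snd c ` (fst c \<inter> fst d)) \<times> {m. invertible m}"
proof (intro equalityI subsetI)
  fix z assume "z \<in> snd (fchart c) ` (fst (fchart c) \<inter> fst (fchart d))"
  then obtain p where p: "p \<in> fst (fchart c)" "p \<in> fst (fchart d)" "z = snd (fchart c) p" by blast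
  then show "z \<in> (snd c ` (fst c \<inter> fst d)) \<times> {m. invertible m}"
    using frame_eq(2)[OF assms(1) p(1)] fchart_base[OF p(1)] fchart_base[OF p(2)]
    by (cases z) (auto simp: frame_chart_apply)
next
  fix z assume "z \<in> (snd c ` (fst c \<inter> fst d)) \<times> {m :: real^'n^'n. invertible m}"
  then obtain x and m :: "real^'n^'n" where z: "x \<in> fst c" "x \<in> fst d" "invertible m" "z = (snd c x, m)" by blast
  note f = frame_of_in_fchart[OF assms(1) z(1,3)]
  have "frame_of \<A> c x m \<in> fst (fchart d)"
    by (rule frames_in_fchart[OF fchart_in_frames[OF f(1)]]) (simp add: z)
  then show "z \<in> snd (fchart c) ` (fst (fchart c) \<inter> fst (fchart d))"
    using f z(4) by (metis IntI image_eqI)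
qed

lemma fchart_image:
  assumes "c \<in> \<A>"
  shows "snd (fchart c) ` fst (fchart c) = (snd c ` fst c) \<times> {m. invertible m}"
  using fchart_overlap_image[OF assms assms] by simp

lemma inj_fchart:
  assumes "c \<in> \<A>"
  shows "inj_on (snd (fchart c)) (fst (fchart c))"
proof (rule inj_onI)
  fix p q assume p: "p \<in> fst (fchart c)" and q: "q \<in> fst (fchart c)" and e: "snd (fchart c) p = snd (fchart c) q"
  then have "snd c (fst p) = snd c (fst q)" by (simp add: frame_chart_apply)
  then have "fst p = fst q"
    using inj_chart[OF assms] fchart_base[OF p] fchart_base[OF q] by (simp add: inj_on_def)
  then show "p = q"
    using frame_eq(1)[OF assms p] frame_eq(1)[OF assms q] e by simp
qed

lemma chart_inv_fchart:
  assumes "c \<in> \<A>" "x \<in> fst c" "invertible m"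
  shows "chart_inv (fchart c) (snd c x, m) = frame_of \<A> c x m"
  unfolding chart_inv_def
  by (rule inv_into_f_eq[OF inj_fchart[OF assms(1)] frame_of_in_fchart[OF assms]])

lemma jacobian_mult:
  assumes "c \<in> \<A>" "d \<in> \<A>" "x \<in> fst c" "x \<in> fst d"
  shows "jacobian c d (snd c x) *v v = frechet_derivative (transition c d) (at (snd c x)) v"
  unfolding jacobian_def
  using fun_cong[OF matrix_vector_mul(2)[OF has_derivative_linear[OF transition_has_derivative[OF assms]]]] .

lemma coord_vec_jacobian:
  assumes "c \<in> \<A>" "d \<in> \<A>" "x \<in> fst c" "x \<in> fst d"
  shows "coord_vec \<A> c x v = coord_vec \<A> d x (jacobian c d (snd c x) *v v)"
  using tangent_vector_eq_coord_vec[OF assms(2,4) coord_vec_in_tangent_space[OF assms(1,3)], of v] assms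
  by (simp add: jacobian_mult coord_vec_def)

lemma fchart_transition:
  assumes "c \<in> \<A>" "d \<in> \<A>" "p \<in> fst (fchart c)" "p \<in> fst (fchart d)"
  shows "snd (fchart d) p =
    (snd d (fst p), jacobian c d (snd c (fst p)) ** snd (snd (fchart c) p))"
proof -
  let ?m = "snd (snd (fchart c) p)"
  have x: "fst p \<in> fst c" "fst p \<in> fst d" using fchart_base assms by auto
  have "snd p v d = (jacobian c d (snd c (fst p)) ** ?m) *v v" for v
  proof -
    have "snd p v = coord_vec \<A> c (fst p) (?m *v v)"
      using arg_cong[OF frame_eq(1)[OF assms(1,3)], of "\<lambda>q. snd q v"] by (simp add: frame_of_def)
    also have "\<dots> = coord_vec \<A> d (fst p) (jacobian c d (snd c (fst p)) *v (?m *v v))"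
      by (rule coord_vec_jacobian[OF assms(1,2) x])
    finally show ?thesis using assms(2) x(2) by (simp add: matrix_vector_mul_assoc)
  qed
  then show ?thesis by (simp add: frame_chart_apply[of \<A> d])
qed

lemma smooth_on_jacobian:
  assumes "c \<in> \<A>" "d \<in> \<A>"
  shows "smooth_on (jacobian c d) (snd c ` (fst c \<inter> fst d))"
proof -
  note o = open_overlap[OF assms]
  have "smooth_on (\<lambda>y. \<chi> i j. frechet_derivative (transition c d) (at y) (axis j 1) \<bullet> axis i 1) (snd c ` (fst c \<inter> fst d))"
    by (rule smooth_on_vec_lambda[OF o smooth_on_vec_lambda[OF o smooth_on_inner[OF o
          smooth_on_derivative[OF smooth_transition[OF assms]] smooth_on_const]]])
  then show ?thesis
    by (rule smooth_on_cong[OF o]) (simp add: jacobian_def matrix_def inner_axis)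
qed

lemma transition_fchart:
  assumes "c \<in> \<A>" "d \<in> \<A>" "z \<in> (snd c ` (fst c \<inter> fst d)) \<times> {m. invertible m}"
  shows "transition (fchart c) (fchart d) z = (transition c d (fst z), jacobian c d (fst z) ** snd z)"
proof -
  obtain x m where z: "x \<in> fst c" "x \<in> fst d" "invertible m" "z = (snd c x, m)" using assms(3) by blast
  note f = frame_of_in_fchart[OF assms(1) z(1,3)]
  have "frame_of \<A> c x m \<in> fst (fchart d)"
    by (rule frames_in_fchart[OF fchart_in_frames[OF f(1)]]) (simp add: z)
  from fchart_transition[OF assms(1,2) f(1) this]
  show ?thesis
    using z assms by (simp add: transition_def[of "fchart c"] chart_inv_fchart f(2))
qed

lemma open_fchart_overlap:
  assumes "c \<in> \<A>" "d \<in> \<A>"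
  shows "open ((snd c ` (fst c \<inter> fst d)) \<times> {m :: real^'n^'n. invertible m})"
  by (intro open_Times open_overlap assms open_invertible)

lemma smooth_transition_fchart:
  assumes "c \<in> \<A>" "d \<in> \<A>"
  shows "smooth_on (transition (fchart c) (fchart d)) ((snd c ` (fst c \<inter> fst d)) \<times> {m. invertible m})"
proof -
  let ?S = "(snd c ` (fst c \<inter> fst d)) \<times> {m :: real^'n^'n. invertible m}"
  note o = open_fchart_overlap[OF assms]
  note f = smooth_on_bounded_linear[OF bounded_linear_fst o] and s = smooth_on_bounded_linear[OF bounded_linear_snd o]
  have "smooth_on (\<lambda>z. (transition c d (fst z), jacobian c d (fst z) ** snd z)) ?S"
    by (rule smooth_on_Pair[OF o smooth_on_compose[OF o open_overlap[OF assms] smooth_transition[OF assms] f]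
        smooth_on_matrix_mult[OF o smooth_on_compose[OF o open_overlap[OF assms] smooth_on_jacobian[OF assms] f] s]]) auto
  then show ?thesis
    by (rule smooth_on_cong[OF o]) (simp add: transition_fchart[OF assms])
qed

lemma smooth_atlas_frame_atlas: "smooth_atlas (frame_atlas \<A>)"
  unfolding smooth_atlas_def frame_atlas_def
  by (auto simp: fchart_overlap_image fchart_image open_fchart_overlap smooth_transition_fchart inj_fchart
      intro!: open_Times open_chart_image open_invertible)

sublocale F: atlas "frame_atlas \<A>"
  by unfold_locales (rule smooth_atlas_frame_atlas)

lemma fchart_in_frame_atlas: "c \<in> \<A> \<Longrightarrow> fchart c \<in> frame_atlas \<A>"
  by (simp add: frame_atlas_def)

text \<open>In the second component, the summand with the derivative of the Jacobian is the inhomogeneous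
  term in the transformation law of connection coefficients.\<close>

lemma transition_fchart_derivative:
  assumes "c \<in> \<A>" "d \<in> \<A>" "p \<in> fst (fchart c)" "fst p \<in> fst d"
  defines "y \<equiv> snd c (fst p)" and "m \<equiv> snd (snd (fchart c) p)"
  shows "frechet_derivative (transition (fchart c) (fchart d)) (at (snd (fchart c) p)) (v, w) =
    (jacobian c d y *v v, jacobian c d y ** w + frechet_derivative (jacobian c d) (at y) v ** m)"
proof -
  have x: "fst p \<in> fst c" by (rule fchart_base[OF assms(3)])
  have ym: "snd (fchart c) p = (y, m)" by (simp add: y_def m_def frame_chart_apply)
  have yin: "y \<in> snd c ` (fst c \<inter> fst d)" using x assms(4) by (auto simp: y_def)
  have zin: "(y, m) \<in> (snd c ` (fst c \<inter> fst d)) \<times> {m. invertible m}"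
    using yin frame_eq(2)[OF assms(1,3)] by (simp add: m_def)
  have f: "(fst has_derivative fst) (at (y, m))" and s: "(snd has_derivative snd) (at (y, m))"
    by (rule bounded_linear_imp_has_derivative bounded_linear_fst bounded_linear_snd)+
  have D1: "((\<lambda>z. transition c d (fst z)) has_derivative
      (\<lambda>X. frechet_derivative (transition c d) (at y) (fst X))) (at (y, m))"
    by (rule has_derivative_compose[OF f]) (use smooth_on_has_derivative[OF smooth_transition[OF assms(1,2)] yin] in simp)
  have D2: "((\<lambda>z. jacobian c d (fst z)) has_derivative
      (\<lambda>X. frechet_derivative (jacobian c d) (at y) (fst X))) (at (y, m))"
    by (rule has_derivative_compose[OF f]) (use smooth_on_has_derivative[OF smooth_on_jacobian[OF assms(1,2)] yin] in simp)
  have "((\<lambda>z. (transition c d (fst z), jacobian c d (fst z) ** snd z)) has_derivative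
      (\<lambda>X. (frechet_derivative (transition c d) (at y) (fst X),
        jacobian c d (fst (y, m)) ** snd X + frechet_derivative (jacobian c d) (at y) (fst X) ** snd (y, m)))) (at (y, m))"
    by (intro has_derivative_Pair D1 bounded_bilinear.FDERIV[OF bounded_bilinear_matrix_mult D2 s])
  then have "(transition (fchart c) (fchart d) has_derivative
      (\<lambda>X. (frechet_derivative (transition c d) (at y) (fst X),
        jacobian c d (fst (y, m)) ** snd X + frechet_derivative (jacobian c d) (at y) (fst X) ** snd (y, m)))) (at (y, m))"
    by (rule has_derivative_transform_within_open[OF _ open_fchart_overlap[OF assms(1,2)] zin])
      (simp add: transition_fchart[OF assms(1,2)])
  from fun_cong[OF frechet_derivative_at[OF this], of "(v, w)"] show ?thesis
    unfolding ym using jacobian_mult[OF assms(1,2) x assms(4)] by (simp add: y_def)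
qed

lemma tangent_frame_transition:
  assumes "c \<in> \<A>" "d \<in> \<A>" "p \<in> frames \<A>" "fst p \<in> fst c" "fst p \<in> fst d"
    and X: "X \<in> tangent_space (frame_atlas \<A>) p" "X (fchart c) = (v, w)"
  defines "y \<equiv> snd c (fst p)" and "m \<equiv> snd (snd (fchart c) p)"
  shows "X (fchart d) = (jacobian c d y *v v, jacobian c d y ** w + frechet_derivative (jacobian c d) (at y) v ** m)"
proof -
  have p: "p \<in> fst (fchart c)" "p \<in> fst (fchart d)" using frames_in_fchart assms by auto
  have "X (fchart d) = frechet_derivative (transition (fchart c) (fchart d)) (at (snd (fchart c) p)) (X (fchart c))"
    using X(1) fchart_in_frame_atlas assms(1,2) p unfolding tangent_space_def by blast
  then show ?thesis
    using transition_fchart_derivative[OF assms(1,2) p(1) assms(5)] X(2) by (simp add: y_def m_def)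
qed

text \<open>Both sides are mixed second derivatives of the transition map.\<close>

lemma jacobian_derivative_symmetric:
  assumes "c \<in> \<A>" "d \<in> \<A>" "y \<in> snd c ` (fst c \<inter> fst d)"
  shows "frechet_derivative (jacobian c d) (at y) v *v b = frechet_derivative (jacobian c d) (at y) b *v v"
proof -
  have "frechet_derivative (jacobian c d) (at y) v *v b =
    frechet_derivative (\<lambda>y. frechet_derivative (transition c d) (at y) b) (at y) v" for v b
  proof -
    have "((\<lambda>y. jacobian c d y *v b) has_derivative (\<lambda>v. frechet_derivative (jacobian c d) (at y) v *v b)) (at y)"
      by (rule bounded_linear.has_derivative[OF bounded_bilinear.bounded_linear_left[OF bounded_bilinear_matrix_vector_mult]
          smooth_on_has_derivative[OF smooth_on_jacobian[OF assms(1,2)] assms(3)]])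
    then have "((\<lambda>y. frechet_derivative (transition c d) (at y) b) has_derivative
        (\<lambda>v. frechet_derivative (jacobian c d) (at y) v *v b)) (at y)"
      by (rule has_derivative_transform_within_open[OF _ open_overlap[OF assms(1,2)] assms(3)])
        (use assms(1,2) in \<open>auto simp: jacobian_mult\<close>)
    from fun_cong[OF frechet_derivative_at[OF this], of v] show ?thesis .
  qed
  then show ?thesis
    using second_derivative_symmetric[OF open_overlap[OF assms(1,2)] assms(3) smooth_transition[OF assms(1,2)]] by simp
qed

lemma points_frame_atlas: "points (frame_atlas \<A>) = frames \<A>"
proof -
  have "p \<in> points (frame_atlas \<A>)" if pf: "p \<in> frames \<A>" for p
  proof -
    have "fst p \<in> points \<A>" using pf by (auto simp: frames_def)
    then obtain c where "c \<in> \<A>" "fst p \<in> fst c" unfolding points_def by blast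
    then show ?thesis
      using frames_in_fchart[OF pf] fchart_in_frame_atlas unfolding points_def by blast
  qed
  moreover have "p \<in> frames \<A>" if "p \<in> points (frame_atlas \<A>)" for p
    using that fchart_in_frames unfolding points_def frame_atlas_def by blast
  ultimately show ?thesis by blast
qed

lemma chart_at_frame:
  assumes "p \<in> frames \<A>"
  obtains c where "c \<in> \<A>" "fst p \<in> fst c" "p \<in> fst (fchart c)" "chart_at (frame_atlas \<A>) p = fchart c"
proof -
  have p: "p \<in> points (frame_atlas \<A>)" using assms by (simp only: points_frame_atlas)
  from F.chart_at(1)[OF p] obtain c where c: "c \<in> \<A>" "chart_at (frame_atlas \<A>) p = fchart c"
    unfolding frame_atlas_def by (rule imageE)
  show thesis
    using that[OF c(1) _ _ c(2)] F.chart_at(2)[OF p] fchart_base[of p c] unfolding c(2) by simp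
qed

text \<open>\<open>pushforward\<close> reads \<open>X\<close> in the arbitrary chart
  \<open>chart_at\<close>. Base components transform by the Jacobian alone, so any chart may be used
  instead.\<close>

lemma pushforward_projection:
  assumes "p \<in> frames \<A>" "c \<in> \<A>" "fst p \<in> fst c" "X \<in> tangent_space (frame_atlas \<A>) p"
  shows "pushforward (frame_atlas \<A>) \<A> fst p X = coord_vec \<A> c (fst p) (fst (X (fchart c)))"
proof -
  obtain e where e: "e \<in> \<A>" "fst p \<in> fst e" "p \<in> fst (fchart e)" "chart_at (frame_atlas \<A>) p = fchart e"
    using chart_at_frame[OF assms(1)] .
  let ?z = "snd (fchart e) p"
  have z: "?z \<in> (snd e ` fst e) \<times> {m. invertible m}" using fchart_image[OF e(1)] e(3) by blast
  have "pushforward (frame_atlas \<A>) \<A> fst p X d = coord_vec \<A> e (fst p) (fst (X (fchart e))) d" for d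
  proof (cases "d \<in> \<A> \<and> fst p \<in> fst d")
    case True
    then have z': "?z \<in> (snd e ` (fst e \<inter> fst d)) \<times> {m. invertible m}"
      using z e(2) fst_fchart_apply[of e p] by (cases ?z) auto
    have "((\<lambda>z. transition e d (fst z)) has_derivative
        (\<lambda>X. frechet_derivative (transition e d) (at (snd e (fst p))) (fst X))) (at ?z)"
      by (rule has_derivative_compose[OF bounded_linear_imp_has_derivative[OF bounded_linear_fst]])
        (use transition_has_derivative[of e d "fst p"] True e in \<open>simp add: fst_fchart_apply\<close>)
    then have "((snd d \<circ> fst \<circ> chart_inv (fchart e)) has_derivative
        (\<lambda>X. frechet_derivative (transition e d) (at (snd e (fst p))) (fst X))) (at ?z)"
      by (rule has_derivative_transform_within_open[OF _ open_fchart_overlap[of e d] z'])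
        (use True e(1) in \<open>auto simp: chart_inv_fchart\<close>)
    from fun_cong[OF frechet_derivative_at[OF this], of "X (fchart e)"]
    show ?thesis using True by (simp add: pushforward_def Let_def e(4) coord_vec_def)
  next
    case False
    then show ?thesis by (auto simp: pushforward_def Let_def coord_vec_def)
  qed
  then have "pushforward (frame_atlas \<A>) \<A> fst p X = coord_vec \<A> e (fst p) (fst (X (fchart e)))" by blast
  also have "\<dots> = coord_vec \<A> c (fst p) (fst (X (fchart c)))"
    using tangent_frame_transition[OF e(1) assms(2) assms(1) e(2) assms(3,4)]
      coord_vec_jacobian[OF e(1) assms(2) e(2) assms(3)]
    by (cases "X (fchart e)") simp
  finally show ?thesis .
qed

section \<open>The right action and its fundamental vectors in coordinates\<close>

lemma right_action_frame_of:
  "right_action h (frame_of \<A> c x m) = frame_of \<A> c x (m ** h)"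
  by (simp add: right_action_def frame_of_def matrix_vector_mul_assoc)

lemma right_action_fchart:
  assumes "c \<in> \<A>" "p \<in> fst (fchart c)" "invertible h"
  shows "right_action h p \<in> fst (fchart c)"
    and "snd (fchart c) (right_action h p) = (snd c (fst p), snd (snd (fchart c) p) ** h)"
proof -
  have "invertible (snd (snd (fchart c) p) ** h)"
    by (rule invertible_mult[OF frame_eq(2)[OF assms(1,2)] assms(3)])
  from frame_of_in_fchart[OF assms(1) frame_eq(3)[OF assms(1,2)] this]
  show "right_action h p \<in> fst (fchart c)"
    "snd (fchart c) (right_action h p) = (snd c (fst p), snd (snd (fchart c) p) ** h)"
    using right_action_frame_of[of h c "fst p" "snd (snd (fchart c) p)"] frame_eq(1)[OF assms(1,2)] by simp_all
qed

lemma fst_right_action [simp]: "fst (right_action h p) = fst p"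
  by (simp add: right_action_def split: prod.split)

text \<open>In coordinates the action is \<open>(y, m)\<close> to \<open>(y, m ** h)\<close>, a
  linear map and hence its own derivative. The chart \<open>c\<close> is tied to
  \<open>chart_at\<close> because \<open>pushforward\<close> looks at \<open>X\<close> only
  there.\<close>

lemma pushforward_right_action:
  assumes "p \<in> frames \<A>" "invertible h" "c \<in> \<A>" "chart_at (frame_atlas \<A>) p = fchart c" "p \<in> fst (fchart c)"
  shows "pushforward (frame_atlas \<A>) (frame_atlas \<A>) (right_action h) p X =
    coord_vec (frame_atlas \<A>) (fchart c) (right_action h p) (fst (X (fchart c)), snd (X (fchart c)) ** h)"
proof
  fix D
  let ?z = "snd (fchart c) p" and ?r = "\<lambda>z :: (real^'n) \<times> (real^'n^'n). (fst z, snd z ** h)"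
  note ra = right_action_fchart[OF assms(3,5,2)]
  show "pushforward (frame_atlas \<A>) (frame_atlas \<A>) (right_action h) p X D =
    coord_vec (frame_atlas \<A>) (fchart c) (right_action h p) (?r (X (fchart c))) D"
  proof (cases "D \<in> frame_atlas \<A> \<and> right_action h p \<in> fst D")
    case True
    then obtain d where d: "d \<in> \<A>" "D = fchart d" "right_action h p \<in> fst D" by (auto simp: frame_atlas_def)
    have xd: "fst p \<in> fst d" using fchart_base[of "right_action h p" d] d by simp
    have z: "?z \<in> (snd c ` (fst c \<inter> fst d)) \<times> {m. invertible m}"
      using frames_in_fchart[OF assms(1) xd] assms(5) fchart_overlap_image[OF assms(3) d(1)] by blast
    have bl: "bounded_linear ?r"
      by (intro bounded_linear_Pair bounded_linear_fst
          bounded_linear_compose[OF bounded_bilinear.bounded_linear_left[OF bounded_bilinear_matrix_mult] bounded_linear_snd])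
    have rz: "?r ?z = snd (fchart c) (right_action h p)" by (simp add: ra fst_fchart_apply)
    have "((\<lambda>z. transition (fchart c) D (?r z)) has_derivative
        (\<lambda>X. frechet_derivative (transition (fchart c) D) (at (?r ?z)) (?r X))) (at ?z)"
      by (rule has_derivative_compose[OF bounded_linear_imp_has_derivative[OF bl]],
          unfold rz, rule F.transition_has_derivative)
        (use d ra fchart_in_frame_atlas assms(3) in auto)
    then have "((snd D \<circ> right_action h \<circ> chart_inv (fchart c)) has_derivative
        (\<lambda>X. frechet_derivative (transition (fchart c) D) (at (?r ?z)) (?r X))) (at ?z)"
      by (rule has_derivative_transform_within_open[OF _ open_fchart_overlap[OF assms(3) d(1)] z])
        (use assms(2,3) in \<open>auto simp: transition_def chart_inv_fchart right_action_frame_of invertible_mult\<close>)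
    from fun_cong[OF frechet_derivative_at[OF this], of "X (fchart c)"]
    show ?thesis unfolding rz using True by (simp add: pushforward_def Let_def assms(4) coord_vec_def)
  next
    case False
    then show ?thesis by (auto simp: pushforward_def Let_def coord_vec_def)
  qed
qed

text \<open>In every chart the base point of the curve is constant and its matrix is
  \<open>m ** matrix_exp (t *\<^sub>R Z)\<close>. The charts agree because the inhomogeneous term of
  the transition is linear in the base direction, which is 0.\<close>

lemma fundamental_vector_frame:
  assumes "c \<in> \<A>" "p \<in> fst (fchart c)"
  shows "fundamental_vector (frame_atlas \<A>) right_action Z p =
    coord_vec (frame_atlas \<A>) (fchart c) p (0, snd (snd (fchart c) p) ** Z)"
proof
  fix D
  let ?m = "\<lambda>c. snd (snd (fchart c) p)" and ?\<gamma> = "\<lambda>t. right_action (matrix_exp (t *\<^sub>R Z)) p"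
  have 0: "right_action (matrix_exp 0) p = p" by (simp add: matrix_exp_0 right_action_def split: prod.split)
  note xc = fchart_base[OF assms(2)]
  show "fundamental_vector (frame_atlas \<A>) right_action Z p D =
    coord_vec (frame_atlas \<A>) (fchart c) p (0, ?m c ** Z) D"
  proof (cases "D \<in> frame_atlas \<A> \<and> p \<in> fst D")
    case True
    then obtain d where d: "d \<in> \<A>" "D = fchart d" "p \<in> fst (fchart d)" by (auto simp: frame_atlas_def)
    have "snd D (?\<gamma> t) = (snd d (fst p), ?m d ** matrix_exp (t *\<^sub>R Z))" for t
    proof -
      have "snd (right_action h p) v d = (?m d ** h) *v v" for h v
        using arg_cong[OF frame_eq(1)[OF d(1,3)], of "\<lambda>q. snd (right_action h q) v d"] d(1) fchart_base[OF d(3)]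
        by (simp add: right_action_frame_of) (simp add: frame_of_def)
      then show ?thesis by (simp add: d(2) frame_chart_apply[of \<A> d "?\<gamma> t"])
    qed
    moreover have "((\<lambda>t. (snd d (fst p), ?m d ** matrix_exp (t *\<^sub>R Z))) has_vector_derivative (0, ?m d ** Z)) (at 0)"
      by (intro has_vector_derivative_Pair has_vector_derivative_const
          bounded_linear.has_vector_derivative[OF bounded_bilinear.bounded_linear_right[OF bounded_bilinear_matrix_mult]]
          matrix_exp_has_vector_derivative)
    ultimately have "vector_derivative (snd D \<circ> ?\<gamma>) (at 0) = (0, ?m d ** Z)"
      by (simp add: o_def vector_derivative_at)
    moreover have "coord_vec (frame_atlas \<A>) (fchart c) p (0, ?m c ** Z) D = (0, ?m d ** Z)"
    proof -
      have "frechet_derivative (jacobian c d) (at (snd c (fst p))) 0 = 0"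
        by (rule linear_0[OF has_derivative_linear[OF smooth_on_has_derivative[OF smooth_on_jacobian[OF assms(1) d(1)]]]])
          (use xc fchart_base[OF d(3)] in auto)
      then show ?thesis
        using True d transition_fchart_derivative[OF assms(1) d(1) assms(2) fchart_base[OF d(3)]]
          fchart_transition[OF assms(1) d(1) assms(2) d(3)]
        by (simp add: coord_vec_def matrix_bilinear_simps matrix_mul_assoc)
    qed
    ultimately show ?thesis using True by (simp add: fundamental_vector_def velocity_def 0)
  next
    case False
    then show ?thesis by (auto simp: fundamental_vector_def velocity_def 0 coord_vec_def)
  qed
qed

end


subsection \<open>The metric in coordinates\<close>

locale riemannian =
  fixes \<A> :: "('a, real^'n) chart set"
    and g :: "'a \<Rightarrow> ('a, real^'n) tvec \<Rightarrow> ('a, real^'n) tvec \<Rightarrow> real"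
  assumes riemannian: "riemannian_manifold \<A> g"

sublocale riemannian \<subseteq> frame_bundle \<A>
  by unfold_locales (use riemannian in \<open>simp add: riemannian_manifold_def smooth_manifold_def\<close>)

context riemannian
begin

definition metric :: "('a, real^'n) chart \<Rightarrow> real^'n \<Rightarrow> real^'n^'n"
  where "metric c y = (\<chi> i j. g (chart_inv c y)
    (coord_vec \<A> c (chart_inv c y) (axis i 1)) (coord_vec \<A> c (chart_inv c y) (axis j 1)))"

definition dmetric :: "('a, real^'n) chart \<Rightarrow> real^'n \<Rightarrow> real^'n \<Rightarrow> real^'n^'n"
  where "dmetric c y = frechet_derivative (metric c) (at y)"

text \<open>Linearity of \<open>g\<close> is given in the first argument; symmetry carries it to the
  second, and both arguments are expanded in the standard basis.\<close>

lemma g_coord_vec: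
  assumes "c \<in> \<A>" "x \<in> fst c"
  shows "g x (coord_vec \<A> c x v) (coord_vec \<A> c x w) = v \<bullet> (metric c (snd c x) *v w)"
    and "g x (coord_vec \<A> c x v) (coord_vec \<A> c x w) = g x (coord_vec \<A> c x w) (coord_vec \<A> c x v)"
proof -
  let ?V = "coord_vec \<A> c x"
  let ?q = "\<lambda>v w. g x (?V v) (?V w)"
  have x: "x \<in> points \<A>" using assms by (auto simp: points_def)
  note T = coord_vec_in_tangent_space[OF assms] and l = linear_coord_vec[OF assms]
  have sym: "?q v w = ?q w v" for v w
    using riemannian x T unfolding riemannian_manifold_def by blast
  show "?q v w = ?q w v" by (rule sym)
  have e: "g x (a *\<^sub>R ?V v + ?V v') (?V w) = a * ?q v w + ?q v' w" for a v v' w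
    using riemannian x T unfolding riemannian_manifold_def by blast
  have e': "?q (a *\<^sub>R v + v') w = a * ?q v w + ?q v' w" for a v v' w
    using e[of a v v' w] by (simp add: linear_add[OF l] linear_scale[OF l])
  have q0: "?q 0 w = 0" for w using e'[of 1 0 0 w] by simp
  have lin: "linear (\<lambda>v. ?q v w)" for w
    using e'[of 1] e'[of _ _ 0] by (intro linearI) (simp_all add: q0)
  have ex: "L v = (\<Sum>i\<in>UNIV. v $ i * L (axis i 1))" if L: "linear L" for v and L :: "real^'n \<Rightarrow> real"
  proof -
    have "L (\<Sum>i\<in>UNIV. v $ i *\<^sub>R axis i 1) = (\<Sum>i\<in>UNIV. v $ i * L (axis i 1))"
      by (simp add: linear_sum[OF L] linear_scale[OF L])
    then show ?thesis using basis_expansion[of v] by (simp add: scalar_mult_eq_scaleR)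
  qed
  have "?q v w = (\<Sum>i\<in>UNIV. v $ i * ?q w (axis i 1))"
    using ex[OF lin[of w], of v] by (simp only: sym[of w])
  also have "\<dots> = (\<Sum>i\<in>UNIV. v $ i * (\<Sum>j\<in>UNIV. w $ j * ?q (axis i 1) (axis j 1)))"
    by (subst ex[OF lin]) (simp only: sym)
  also have "\<dots> = v \<bullet> (metric c (snd c x) *v w)"
    using assms by (simp add: inner_vec_def matrix_vector_mult_def metric_def mult.commute)
  finally show "?q v w = v \<bullet> (metric c (snd c x) *v w)" .
qed

lemma transpose_metric:
  assumes "c \<in> \<A>" "y \<in> snd c ` fst c"
  shows "transpose (metric c y) = metric c y"
proof -
  obtain x where x: "x \<in> fst c" "y = snd c x" using assms(2) by blast
  have e: "chart_inv c y = x" using assms(1) x by simp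
  show ?thesis
    unfolding vec_eq_iff metric_def transpose_def e
    using g_coord_vec(2)[OF assms(1) x(1)] by simp
qed

lemma smooth_on_metric:
  assumes "c \<in> \<A>"
  shows "smooth_on (metric c) (snd c ` fst c)"
  unfolding metric_def[abs_def]
  by (rule smooth_on_vec_lambda[OF open_chart_image[OF assms] smooth_on_vec_lambda[OF open_chart_image[OF assms]]])
    (use riemannian assms in \<open>simp add: riemannian_manifold_def\<close>)

lemma metric_has_derivative:
  "c \<in> \<A> \<Longrightarrow> y \<in> snd c ` fst c \<Longrightarrow> (metric c has_derivative dmetric c y) (at y)"
  unfolding dmetric_def by (rule smooth_on_has_derivative[OF smooth_on_metric])

lemma linear_dmetric: "c \<in> \<A> \<Longrightarrow> y \<in> snd c ` fst c \<Longrightarrow> linear (dmetric c y)"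
  by (rule has_derivative_linear[OF metric_has_derivative])

lemma transpose_dmetric:
  assumes "c \<in> \<A>" "y \<in> snd c ` fst c"
  shows "transpose (dmetric c y v) = dmetric c y v"
proof -
  have "((\<lambda>y. transpose (metric c y)) has_derivative (\<lambda>v. transpose (dmetric c y v))) (at y)"
    by (rule bounded_linear.has_derivative[OF bounded_linear_transpose metric_has_derivative[OF assms]])
  then have "(metric c has_derivative (\<lambda>v. transpose (dmetric c y v))) (at y)"
    by (rule has_derivative_transform_within_open[OF _ open_chart_image[OF assms(1)] assms(2)])
      (rule transpose_metric[OF assms(1)])
  from has_derivative_unique[OF this metric_has_derivative[OF assms]] show ?thesis by (rule fun_cong)
qed

lemma metric_transform:
  assumes "c \<in> \<A>" "d \<in> \<A>" "x \<in> fst c" "x \<in> fst d"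
  shows "metric c (snd c x) =
    transpose (jacobian c d (snd c x)) ** metric d (snd d x) ** jacobian c d (snd c x)"
proof (rule matrix_eqI_inner)
  fix a b
  let ?J = "jacobian c d (snd c x)"
  have "a \<bullet> (metric c (snd c x) *v b) = (?J *v a) \<bullet> (metric d (snd d x) *v (?J *v b))"
    using g_coord_vec(1)[OF assms(1,3), of a b] g_coord_vec(1)[OF assms(2,4), of "?J *v a" "?J *v b"]
    by (simp add: coord_vec_jacobian[OF assms])
  also have "\<dots> = a \<bullet> (transpose ?J *v (metric d (snd d x) *v (?J *v b)))"
    using inner_matrix_transpose[of "metric d (snd d x) *v (?J *v b)" ?J a] by (simp only: inner_commute)
  finally show "a \<bullet> (metric c (snd c x) *v b) = a \<bullet> ((transpose ?J ** metric d (snd d x) ** ?J) *v b)"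
    by (simp only: matrix_vector_mul_assoc matrix_mul_assoc)
qed

lemma dmetric_transform:
  assumes "c \<in> \<A>" "d \<in> \<A>" "x \<in> fst c" "x \<in> fst d"
  defines "J \<equiv> jacobian c d (snd c x)" and "S \<equiv> frechet_derivative (jacobian c d) (at (snd c x))"
  shows "dmetric c (snd c x) v = transpose (S v) ** metric d (snd d x) ** J +
    transpose J ** dmetric d (snd d x) (J *v v) ** J + transpose J ** metric d (snd d x) ** S v"
proof -
  let ?y = "snd c x" and ?O = "snd c ` (fst c \<inter> fst d)"
  have y: "?y \<in> ?O" using assms by auto
  have J: "(jacobian c d has_derivative S) (at ?y)"
    unfolding S_def by (rule smooth_on_has_derivative[OF smooth_on_jacobian[OF assms(1,2)] y])
  have M: "((\<lambda>y. metric d (transition c d y)) has_derivative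
      (\<lambda>v. dmetric d (snd d x) (frechet_derivative (transition c d) (at ?y) v))) (at ?y)"
    by (rule has_derivative_compose[OF transition_has_derivative[OF assms(1-4)]])
      (use metric_has_derivative[OF assms(2), of "snd d x"] assms in simp)
  note B = bounded_bilinear.FDERIV[OF bounded_bilinear_matrix_mult]
  have "((\<lambda>y. transpose (jacobian c d y) ** metric d (transition c d y) ** jacobian c d y) has_derivative
      (\<lambda>v. (transpose J ** metric d (transition c d ?y)) ** S v +
        (transpose J ** dmetric d (snd d x) (frechet_derivative (transition c d) (at ?y) v) +
         transpose (S v) ** metric d (transition c d ?y)) ** J)) (at ?y)"
    unfolding J_def by (intro B J M bounded_linear.has_derivative[OF bounded_linear_transpose])
  then have "(metric c has_derivative
      (\<lambda>v. (transpose J ** metric d (transition c d ?y)) ** S v +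
        (transpose J ** dmetric d (snd d x) (frechet_derivative (transition c d) (at ?y) v) +
         transpose (S v) ** metric d (transition c d ?y)) ** J)) (at ?y)"
    by (rule has_derivative_transform_within_open[OF _ open_overlap[OF assms(1,2)] y])
      (use metric_transform[OF assms(1,2)] assms(1) in auto)
  from fun_cong[OF has_derivative_unique[OF metric_has_derivative[OF assms(1)] this], of v]
  show ?thesis
    using assms(1,3) jacobian_mult[OF assms(1-4), of v] by (simp add: J_def matrix_bilinear_simps add_ac)
qed

lemma christoffel_dmetric_transform:
  assumes "c \<in> \<A>" "d \<in> \<A>" "x \<in> fst c" "x \<in> fst d"
  defines "J \<equiv> jacobian c d (snd c x)" and "S \<equiv> frechet_derivative (jacobian c d) (at (snd c x))"
  shows "christoffel (dmetric c (snd c x)) v =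
    transpose J ** christoffel (dmetric d (snd d x)) (J *v v) ** J + transpose J ** metric d (snd d x) ** S v"
  unfolding J_def S_def
  by (rule christoffel_transform[OF linear_dmetric[OF assms(1)] linear_dmetric[OF assms(2)] transpose_metric[OF assms(2)]
      dmetric_transform[OF assms(1-4)] jacobian_derivative_symmetric[OF assms(1,2)]]) (use assms(3,4) in auto)


subsection \<open>The Levi-Civita form in coordinates\<close>

text \<open>
  In a chart, points of the frame bundle are pairs \<open>z = (y, m)\<close>.  On orthonormal frames the inverse of
  \<open>m\<close> is \<open>transpose m ** metric c y\<close>, so that the form below is the usual
  \<open>m\<^sup>-\<^sup>1 (dm + \<Gamma> m)\<close>, and \<open>solder c z\<close> is the canonical form.
\<close>

definition lc_form :: "('a, real^'n) chart \<Rightarrow> (real^'n) \<times> (real^'n^'n) \<Rightarrow> (real^'n) \<times> (real^'n^'n) \<Rightarrow> real^'n^'n"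
  where "lc_form c z X = transpose (snd z) **
    (metric c (fst z) ** snd X + christoffel (dmetric c (fst z)) (fst X) ** snd z)"

definition solder :: "('a, real^'n) chart \<Rightarrow> (real^'n) \<times> (real^'n^'n) \<Rightarrow> (real^'n) \<times> (real^'n^'n) \<Rightarrow> real^'n"
  where "solder c z X = transpose (snd z) *v (metric c (fst z) *v fst X)"

text \<open>On orthonormal frames \<open>snd z ** transpose (snd z)\<close> is the inverse of the
  metric. It raises the index of \<open>christoffel\<close>, so that this is the usual lift with
  matrix component \<open>- \<Gamma>(v) m\<close> for symbols of the second kind.\<close>

definition horizontal_lift :: "('a, real^'n) chart \<Rightarrow> (real^'n) \<times> (real^'n^'n) \<Rightarrow> real^'n \<Rightarrow> (real^'n) \<times> (real^'n^'n)"
  where "horizontal_lift c z v =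
    (v, - (snd z ** transpose (snd z) ** christoffel (dmetric c (fst z)) v ** snd z))"

definition orthonormal_at :: "('a, real^'n) chart \<Rightarrow> (real^'n) \<times> (real^'n^'n) \<Rightarrow> bool"
  where "orthonormal_at c z \<longleftrightarrow> transpose (snd z) ** metric c (fst z) ** snd z = mat 1"

text \<open>One-sided inverses of square matrices are two-sided. With these equations all later
  computations replace the inverses of the frame and of the metric by products.\<close>

lemma orthonormal_at_inverse:
  assumes "orthonormal_at c z"
  shows "snd z ** transpose (snd z) ** metric c (fst z) = mat 1"
    and "metric c (fst z) ** snd z ** transpose (snd z) = mat 1"
    and "invertible (snd z)"
proof -
  have a: "transpose (snd z) ** metric c (fst z) ** snd z = mat 1"
    using assms by (simp add: orthonormal_at_def)
  then have "snd z ** (transpose (snd z) ** metric c (fst z)) = mat 1"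
    using matrix_left_right_inverse by blast
  then show "snd z ** transpose (snd z) ** metric c (fst z) = mat 1"
    by (simp only: matrix_mul_assoc)
  have "transpose (snd z) ** (metric c (fst z) ** snd z) = mat 1"
    using a by (simp only: matrix_mul_assoc)
  then show "metric c (fst z) ** snd z ** transpose (snd z) = mat 1"
    using matrix_left_right_inverse by blast
  show "invertible (snd z)" unfolding invertible_left_inverse using a by blast
qed

text \<open>The right-hand side is the derivative of \<open>m\<^sup>T G m\<close> along
  \<open>X\<close>. The Christoffel terms add up to the derivative of the metric by
  \<open>christoffel_metric\<close>.\<close>

lemma lc_form_plus_transpose:
  assumes "c \<in> \<A>" "fst z \<in> snd c ` fst c"
  shows "lc_form c z X + transpose (lc_form c z X) =
    transpose (snd X) ** metric c (fst z) ** snd z + transpose (snd z) ** dmetric c (fst z) (fst X) ** snd z +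
    transpose (snd z) ** metric c (fst z) ** snd X"
proof -
  let ?C = "christoffel (dmetric c (fst z)) (fst X)"
  have "transpose (snd z) ** dmetric c (fst z) (fst X) ** snd z =
      transpose (snd z) ** ?C ** snd z + transpose (snd z) ** transpose ?C ** snd z"
    by (subst christoffel_metric[of "dmetric c (fst z)" "fst X", OF transpose_dmetric[OF assms], symmetric]) (simp only: matrix_bilinear_simps)
  then show ?thesis
    by (simp add: lc_form_def matrix_transpose_mul transpose_add matrix_bilinear_simps matrix_mul_assoc
        transpose_metric[OF assms])
qed

lemma lc_form_skew_iff:
  assumes "c \<in> \<A>" "fst z \<in> snd c ` fst c"
  shows "lc_form c z X \<in> orthogonal_lie_algebra \<longleftrightarrow>
    transpose (snd X) ** metric c (fst z) ** snd z + transpose (snd z) ** dmetric c (fst z) (fst X) ** snd z +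
    transpose (snd z) ** metric c (fst z) ** snd X = 0"
  unfolding lc_form_plus_transpose[OF assms, symmetric] orthogonal_lie_algebra_def
  by (simp add: eq_neg_iff_add_eq_0 add.commute)

lemma lc_form_horizontal_lift:
  assumes "orthonormal_at c z"
  shows "lc_form c z (horizontal_lift c z v) = 0"
  using orthonormal_at_inverse(2)[OF assms]
  by (simp add: lc_form_def horizontal_lift_def matrix_bilinear_simps matrix_mul_assoc)

lemma lc_form_eq_0_imp:
  assumes "orthonormal_at c z" "lc_form c z X = 0"
  shows "X = horizontal_lift c z (fst X)"
proof -
  have "snd z ** lc_form c z X = snd X + snd z ** transpose (snd z) ** christoffel (dmetric c (fst z)) (fst X) ** snd z"
    using orthonormal_at_inverse(1)[OF assms(1)]
    by (simp add: lc_form_def matrix_bilinear_simps matrix_mul_assoc)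
  then have "snd X + snd z ** transpose (snd z) ** christoffel (dmetric c (fst z)) (fst X) ** snd z = 0"
    by (simp add: assms(2) matrix_bilinear_simps)
  then show ?thesis
    by (simp add: horizontal_lift_def prod_eq_iff eq_neg_iff_add_eq_0)
qed

section \<open>Linearity and smoothness of the forms and of the lift\<close>

lemma linear_lc_form:
  assumes "c \<in> \<A>" "fst z \<in> snd c ` fst c"
  shows "linear (lc_form c z)"
  using linear_christoffel[OF linear_dmetric[OF assms]]
  by (intro linearI) (simp_all add: lc_form_def matrix_bilinear_simps linear_add linear_scale add_ac scaleR_add_right)

lemma linear_solder: "linear (solder c z)"
  by (intro linearI)
    (simp_all add: solder_def matrix_vector_right_distrib matrix_vector_mult_scaleR del: transpose_matrix_vector)

lemma linear_horizontal_lift: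
  assumes "c \<in> \<A>" "fst z \<in> snd c ` fst c"
  shows "linear (horizontal_lift c z)"
  using linear_christoffel[OF linear_dmetric[OF assms]]
  by (intro linearI) (simp_all add: horizontal_lift_def matrix_bilinear_simps linear_add linear_scale)

lemma smooth_on_christoffel:
  assumes "c \<in> \<A>"
  shows "smooth_on (\<lambda>y. christoffel (dmetric c y) v) (snd c ` fst c)"
proof -
  note o = open_chart_image[OF assms]
  have d: "smooth_on (\<lambda>y. dmetric c y b) (snd c ` fst c)" for b
    unfolding dmetric_def by (rule smooth_on_derivative[OF smooth_on_metric[OF assms]])
  have "smooth_on (\<lambda>y. \<chi> i j. (dmetric c y (axis j 1) *v v) \<bullet> axis i 1) (snd c ` fst c)"
    by (rule smooth_on_vec_lambda[OF o smooth_on_vec_lambda[OF o smooth_on_inner[OF o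
          smooth_on_matrix_vector_mult[OF o d smooth_on_const] smooth_on_const]]])
  then have m: "smooth_on (\<lambda>y. matrix (\<lambda>b. dmetric c y b *v v)) (snd c ` fst c)"
    by (simp add: matrix_def inner_axis)
  show ?thesis
    unfolding christoffel_def
    by (rule smooth_on_scaleR[OF o smooth_on_const smooth_on_diff[OF o smooth_on_add[OF o d m] smooth_on_transpose[OF o m]]])
qed

lemma smooth_coordinates:
  assumes "c \<in> \<A>"
  defines "I \<equiv> snd (fchart c) ` fst (fchart c)"
  shows "open I"
    and "smooth_on f (snd c ` fst c) \<Longrightarrow> smooth_on (\<lambda>z. f (fst z)) I" and "smooth_on snd I"
    and "z \<in> I \<Longrightarrow> fst z \<in> snd c ` fst c"
proof -
  show o: "open I" unfolding I_def by (rule F.open_chart_image[OF fchart_in_frame_atlas[OF assms(1)]])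
  show "smooth_on snd I" by (rule smooth_on_bounded_linear[OF bounded_linear_snd o])
  show i: "z \<in> I \<Longrightarrow> fst z \<in> snd c ` fst c" for z
    unfolding I_def fchart_image[OF assms(1)] by auto
  show "smooth_on (\<lambda>z. f (fst z)) I" if "smooth_on f (snd c ` fst c)"
    by (rule smooth_on_compose[OF o open_chart_image[OF assms(1)] that smooth_on_bounded_linear[OF bounded_linear_fst o]])
      (use i in auto)
qed

lemma smooth_on_lc_form:
  assumes "c \<in> \<A>"
  shows "smooth_on (\<lambda>z. lc_form c z X) (snd (fchart c) ` fst (fchart c))"
proof -
  note o = smooth_coordinates(1)[OF assms] and s = smooth_coordinates(3)[OF assms]
    and f = smooth_coordinates(2)[OF assms]
  show ?thesis
    unfolding lc_form_def
    by (rule smooth_on_matrix_mult[OF o smooth_on_transpose[OF o s] smooth_on_add[OF o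
          smooth_on_matrix_mult[OF o f[OF smooth_on_metric[OF assms]] smooth_on_const]
          smooth_on_matrix_mult[OF o f[OF smooth_on_christoffel[OF assms]] s]]])
qed

lemma smooth_on_solder:
  assumes "c \<in> \<A>"
  shows "smooth_on (\<lambda>z. solder c z X) (snd (fchart c) ` fst (fchart c))"
proof -
  note o = smooth_coordinates(1)[OF assms] and s = smooth_coordinates(3)[OF assms]
    and f = smooth_coordinates(2)[OF assms]
  show ?thesis
    unfolding solder_def
    by (rule smooth_on_matrix_vector_mult[OF o smooth_on_transpose[OF o s]
          smooth_on_matrix_vector_mult[OF o f[OF smooth_on_metric[OF assms]] smooth_on_const]])
qed

lemma smooth_on_horizontal_lift:
  assumes "c \<in> \<A>"
  shows "smooth_on (\<lambda>z. horizontal_lift c z v) (snd (fchart c) ` fst (fchart c))"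
proof -
  note o = smooth_coordinates(1)[OF assms] and s = smooth_coordinates(3)[OF assms]
    and f = smooth_coordinates(2)[OF assms]
  show ?thesis
    unfolding horizontal_lift_def
    by (rule smooth_on_Pair[OF o smooth_on_const smooth_on_uminus[OF o smooth_on_matrix_mult[OF o
          smooth_on_matrix_mult[OF o smooth_on_matrix_mult[OF o s smooth_on_transpose[OF o s]]
            f[OF smooth_on_christoffel[OF assms]]] s]]])
qed

text \<open>The same inhomogeneous term appears on both sides: in the chart \<open>c\<close> it
  comes from the Christoffel symbols, in \<open>d\<close> from the matrix component of
  \<open>X\<close>. This works at every frame because the form expresses inner products of the frame
  with its covariant derivative.\<close>

lemma lc_form_transform:
  assumes "c \<in> \<A>" "d \<in> \<A>" "p \<in> frames \<A>" "fst p \<in> fst c" "fst p \<in> fst d"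
    and "X \<in> tangent_space (frame_atlas \<A>) p"
  shows "lc_form c (snd (fchart c) p) (X (fchart c)) = lc_form d (snd (fchart d) p) (X (fchart d))"
proof -
  obtain v w where vw: "X (fchart c) = (v, w)" by (cases "X (fchart c)")
  have p: "p \<in> fst (fchart c)" "p \<in> fst (fchart d)" using frames_in_fchart assms by auto
  show ?thesis
    unfolding lc_form_def fchart_transition[OF assms(1,2) p] tangent_frame_transition[OF assms(1-6) vw] vw
      fst_fchart_apply fst_conv snd_conv
      metric_transform[OF assms(1,2,4,5)] christoffel_dmetric_transform[OF assms(1,2,4,5)]
    by (simp add: matrix_transpose_mul matrix_bilinear_simps matrix_mul_assoc add_ac)
qed


subsection \<open>Tangent vectors of the orthonormal frame bundle\<close>

abbreviation onframes where "onframes \<equiv> orthonormal_frames \<A> g"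

lemma onframes_frames: "p \<in> onframes \<Longrightarrow> p \<in> frames \<A>"
  by (auto simp: orthonormal_frames_def)

lemma onframes_iff:
  assumes "c \<in> \<A>" "p \<in> fst (fchart c)"
  shows "p \<in> onframes \<longleftrightarrow> orthonormal_at c (snd (fchart c) p)"
proof -
  let ?m = "snd (snd (fchart c) p)" and ?x = "fst p"
  note x = fchart_base[OF assms(2)]
  have sp: "snd p v = coord_vec \<A> c ?x (?m *v v)" for v
    using arg_cong[OF frame_eq(1)[OF assms], of "\<lambda>q. snd q v"] by (simp add: frame_of_def)
  have "g ?x (snd p v) (snd p w) = v \<bullet> ((transpose ?m ** metric c (snd c ?x) ** ?m) *v w)" for v w
  proof -
    have "g ?x (snd p v) (snd p w) = (?m *v v) \<bullet> (metric c (snd c ?x) *v (?m *v w))"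
      unfolding sp by (rule g_coord_vec(1)[OF assms(1) x])
    also have "\<dots> = v \<bullet> (transpose ?m *v (metric c (snd c ?x) *v (?m *v w)))"
      using inner_matrix_transpose[of "metric c (snd c ?x) *v (?m *v w)" ?m v] by (simp only: inner_commute)
    finally show ?thesis by (simp only: matrix_vector_mul_assoc matrix_mul_assoc)
  qed
  then have "p \<in> onframes \<longleftrightarrow> (\<forall>v w. v \<bullet> ((transpose ?m ** metric c (snd c ?x) ** ?m) *v w) = v \<bullet> (mat 1 *v w))"
    using fchart_in_frames[OF assms(2)] by (cases p) (simp add: orthonormal_frames_def)
  also have "\<dots> \<longleftrightarrow> transpose ?m ** metric c (snd c ?x) ** ?m = mat 1"
    using matrix_eqI_inner[of "transpose ?m ** metric c (snd c ?x) ** ?m" "mat 1"] by metis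
  finally show ?thesis by (simp add: orthonormal_at_def fst_fchart_apply)
qed

text \<open>Skewness of the two values is the first-order condition of
  \<open>orthonormal_surface\<close>, by \<open>lc_form_skew_iff\<close>.\<close>

lemma onframes_surface:
  assumes "c \<in> \<A>" "p \<in> onframes" "p \<in> fst (fchart c)"
    and "lc_form c (snd (fchart c) p) X \<in> orthogonal_lie_algebra"
    and "lc_form c (snd (fchart c) p) Y \<in> orthogonal_lie_algebra"
  obtains N \<sigma> where "open N" "(0 :: real \<times> real) \<in> N" "smooth_on \<sigma> N"
    "\<sigma> ` N \<subseteq> snd (fchart c) ` (fst (fchart c) \<inter> onframes)" "\<sigma> 0 = snd (fchart c) p"
    "frechet_derivative \<sigma> (at 0) (1, 0) = X" "frechet_derivative \<sigma> (at 0) (0, 1) = Y"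
proof -
  let ?z = "snd (fchart c) p"
  have y: "fst ?z \<in> snd c ` fst c" using fchart_base[OF assms(3)] by (simp add: fst_fchart_apply)
  have on: "transpose (snd ?z) ** metric c (fst ?z) ** snd ?z = mat 1"
    using onframes_iff[OF assms(1,3)] assms(2) by (simp add: orthonormal_at_def)
  have t: "transpose w ** metric c (fst ?z) ** snd ?z +
      transpose (snd ?z) ** frechet_derivative (metric c) (at (fst ?z)) v ** snd ?z +
      transpose (snd ?z) ** metric c (fst ?z) ** w = 0" if "(v, w) \<in> {X, Y}" for v w
    using that assms(4,5) lc_form_skew_iff[OF assms(1) y, of "(v, w)"] by (auto simp: dmetric_def)
  obtain N \<sigma> where N: "open N" "(0 :: real \<times> real) \<in> N" "smooth_on \<sigma> N" "\<sigma> 0 = (fst ?z, snd ?z)"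
    and in_onframes: "\<And>s. s \<in> N \<Longrightarrow> fst (\<sigma> s) \<in> snd c ` fst c \<and>
      transpose (snd (\<sigma> s)) ** metric c (fst (\<sigma> s)) ** snd (\<sigma> s) = mat 1"
    and D: "frechet_derivative \<sigma> (at 0) (1, 0) = X" "frechet_derivative \<sigma> (at 0) (0, 1) = Y"
    using orthonormal_surface[OF open_chart_image[OF assms(1)] y smooth_on_metric[OF assms(1)]
        transpose_metric[OF assms(1)] on t] by metis
  have "\<sigma> s \<in> snd (fchart c) ` (fst (fchart c) \<inter> onframes)" if s: "s \<in> N" for s
  proof -
    obtain x where x: "x \<in> fst c" "fst (\<sigma> s) = snd c x" using in_onframes[OF s] by blast
    have o: "orthonormal_at c (\<sigma> s)" using in_onframes[OF s] by (simp add: orthonormal_at_def)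
    note f = frame_of_in_fchart[OF assms(1) x(1) orthonormal_at_inverse(3)[OF o]]
    have e: "snd (fchart c) (frame_of \<A> c x (snd (\<sigma> s))) = \<sigma> s" using f(2) x(2) by (simp add: prod_eq_iff)
    then have "frame_of \<A> c x (snd (\<sigma> s)) \<in> onframes" using onframes_iff[OF assms(1) f(1)] o by simp
    with f(1) e show ?thesis by (metis IntI image_eqI)
  qed
  then have "\<sigma> ` N \<subseteq> snd (fchart c) ` (fst (fchart c) \<inter> onframes)" by (rule image_subsetI)
  then show thesis using that[OF N(1-3) _ _ D] N(4) by simp
qed

text \<open>One direction differentiates \<open>m\<^sup>T G m = 1\<close> along a curve. The other
  needs an actual curve of orthonormal frames, which is cut out of a surface.\<close>

lemma sub_tangent_space_onframes:
  assumes "c \<in> \<A>" "p \<in> onframes" "p \<in> fst (fchart c)"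
  shows "X \<in> sub_tangent_space (frame_atlas \<A>) onframes p \<longleftrightarrow> X \<in> tangent_space (frame_atlas \<A>) p \<and>
    lc_form c (snd (fchart c) p) (X (fchart c)) \<in> orthogonal_lie_algebra"
proof
  let ?z = "snd (fchart c) p"
  note C = fchart_in_frame_atlas[OF assms(1)]
  have y: "fst ?z \<in> snd c ` fst c" using fchart_base[OF assms(3)] by (simp add: fst_fchart_apply)
  assume X: "X \<in> sub_tangent_space (frame_atlas \<A>) onframes p"
  then obtain \<gamma> \<epsilon> where \<gamma>: "\<epsilon> > 0" "smooth_map {({-\<epsilon><..<\<epsilon>::real}, \<lambda>t. t)} (frame_atlas \<A>) \<gamma>"
    "\<gamma> ` {-\<epsilon><..<\<epsilon>} \<subseteq> onframes" "\<gamma> 0 = p" and Xv: "X = velocity (frame_atlas \<A>) \<gamma> 0"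
    unfolding sub_tangent_space_def by blast
  let ?D = "{t \<in> {-\<epsilon><..<\<epsilon>}. \<gamma> t \<in> fst (fchart c)}"
  let ?s = "\<lambda>t. snd (fchart c) (\<gamma> t)"
  obtain v w where vw: "X (fchart c) = (v, w)" by (cases "X (fchart c)")
  have D: "(?s has_derivative (\<lambda>t. t *\<^sub>R (v, w))) (at 0)"
    using F.velocity_in_chart[OF \<gamma>(2,1) C] \<gamma>(4) assms(3) vw by (simp add: has_vector_derivative_def Xv)
  have s0: "?s 0 = ?z" by (simp add: \<gamma>(4))
  have Df: "((\<lambda>t. fst (?s t)) has_derivative (\<lambda>t. t *\<^sub>R v)) (at 0)" and Ds: "((\<lambda>t. snd (?s t)) has_derivative (\<lambda>t. t *\<^sub>R w)) (at 0)"
    using has_derivative_fst[OF D] has_derivative_snd[OF D] by simp_all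
  have DG: "((\<lambda>t. metric c (fst (?s t))) has_derivative (\<lambda>t. dmetric c (fst ?z) (t *\<^sub>R v))) (at 0)"
    by (rule has_derivative_compose[OF Df]) (use metric_has_derivative[OF assms(1) y] s0 in simp)
  note B = bounded_bilinear.FDERIV[OF bounded_bilinear_matrix_mult]
  have "((\<lambda>t. transpose (snd (?s t)) ** metric c (fst (?s t)) ** snd (?s t)) has_derivative
      (\<lambda>t. (transpose (snd (?s 0)) ** metric c (fst (?s 0))) ** (t *\<^sub>R w) +
        (transpose (snd (?s 0)) ** dmetric c (fst ?z) (t *\<^sub>R v) +
         transpose (t *\<^sub>R w) ** metric c (fst (?s 0))) ** snd (?s 0))) (at 0)"
    by (intro B Ds DG bounded_linear.has_derivative[OF bounded_linear_transpose])
  moreover have "((\<lambda>t. transpose (snd (?s t)) ** metric c (fst (?s t)) ** snd (?s t)) has_derivative (\<lambda>_. 0)) (at 0)"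
  proof (rule has_derivative_transform_within_open[OF has_derivative_const F.smooth_curve_in_chart(1)[OF \<gamma>(2) C]])
    show "0 \<in> ?D" using \<gamma>(1,4) assms(3) by simp
    show "mat 1 = transpose (snd (?s t)) ** metric c (fst (?s t)) ** snd (?s t)" if "t \<in> ?D" for t
    proof -
      have "\<gamma> t \<in> onframes" "\<gamma> t \<in> fst (fchart c)" using that \<gamma>(3) by auto
      then show ?thesis using onframes_iff[OF assms(1)] by (simp add: orthonormal_at_def)
    qed
  qed
  ultimately have "(\<lambda>t. (transpose (snd (?s 0)) ** metric c (fst (?s 0))) ** (t *\<^sub>R w) +
        (transpose (snd (?s 0)) ** dmetric c (fst ?z) (t *\<^sub>R v) +
         transpose (t *\<^sub>R w) ** metric c (fst (?s 0))) ** snd (?s 0)) = (\<lambda>_. 0)"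
    by (rule has_derivative_unique)
  from fun_cong[OF this, of 1]
  have "lc_form c ?z (X (fchart c)) \<in> orthogonal_lie_algebra"
    unfolding lc_form_skew_iff[OF assms(1) y] s0 vw by (simp add: matrix_bilinear_simps add_ac)
  then show "X \<in> tangent_space (frame_atlas \<A>) p \<and> lc_form c ?z (X (fchart c)) \<in> orthogonal_lie_algebra"
    using X F.sub_tangent_space_subset by blast
next
  let ?z = "snd (fchart c) p"
  note C = fchart_in_frame_atlas[OF assms(1)]
  assume X: "X \<in> tangent_space (frame_atlas \<A>) p \<and> lc_form c ?z (X (fchart c)) \<in> orthogonal_lie_algebra"
  \<comment> \<open>A single direction is wanted, so \<open>X\<close> is taken for both directions
    of the surface.\<close>
  obtain N \<sigma> where \<sigma>: "open N" "(0 :: real \<times> real) \<in> N" "smooth_on \<sigma> N"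
    "\<sigma> ` N \<subseteq> snd (fchart c) ` (fst (fchart c) \<inter> onframes)" "\<sigma> 0 = ?z"
    "frechet_derivative \<sigma> (at 0) (1, 0) = X (fchart c)"
    by (rule onframes_surface[OF assms conjunct2[OF X] conjunct2[OF X]])
  have p: "chart_inv (fchart c) (\<sigma> 0) = p" using C assms(3) \<sigma>(5) by simp
  from F.sub_tangent_spaceI[OF C \<sigma>(1-4), of "(1, 0)"]
  show "X \<in> sub_tangent_space (frame_atlas \<A>) onframes p"
    using F.tangent_vector_eq_coord_vec[OF C assms(3) conjunct1[OF X]] unfolding p \<sigma>(6) by simp
qed

text \<open>Justifies the definite description in \<open>sub_ext_deriv\<close>: any one extension
  may be used to compute it.\<close>

lemma sub_ext_deriv_eq:
  assumes "p \<in> onframes" "X \<in> sub_tangent_space (frame_atlas \<A>) onframes p" "Y \<in> sub_tangent_space (frame_atlas \<A>) onframes p"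
    and ext: "local_extension (frame_atlas \<A>) onframes \<alpha> p W \<beta>"
  shows "sub_ext_deriv (frame_atlas \<A>) onframes \<alpha> p X Y = ext_deriv (frame_atlas \<A>) \<beta> p X Y"
proof -
  obtain c where c: "c \<in> \<A>" "p \<in> fst (fchart c)" "chart_at (frame_atlas \<A>) p = fchart c"
    by (rule chart_at_frame[OF onframes_frames[OF assms(1)]])
  have sk: "lc_form c (snd (fchart c) p) (X (fchart c)) \<in> orthogonal_lie_algebra"
    if "X \<in> sub_tangent_space (frame_atlas \<A>) onframes p" for X
    using that sub_tangent_space_onframes[OF c(1) assms(1) c(2)] by blast
  obtain N \<sigma> where \<sigma>: "open N" "(0 :: real \<times> real) \<in> N" "smooth_on \<sigma> N"
    "\<sigma> ` N \<subseteq> snd (fchart c) ` (fst (fchart c) \<inter> onframes)" "\<sigma> 0 = snd (fchart c) p"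
    "frechet_derivative \<sigma> (at 0) (1, 0) = X (fchart c)" "frechet_derivative \<sigma> (at 0) (0, 1) = Y (fchart c)"
    by (rule onframes_surface[OF c(1) assms(1) c(2) sk[OF assms(2)] sk[OF assms(3)]])
  show ?thesis
    unfolding sub_ext_deriv_def
  proof (rule the_equality)
    show "\<exists>W' \<beta>'. local_extension (frame_atlas \<A>) onframes \<alpha> p W' \<beta>' \<and>
      ext_deriv (frame_atlas \<A>) \<beta> p X Y = ext_deriv (frame_atlas \<A>) \<beta>' p X Y"
      using ext by blast
    show "r = ext_deriv (frame_atlas \<A>) \<beta> p X Y"
      if "\<exists>W' \<beta>'. local_extension (frame_atlas \<A>) onframes \<alpha> p W' \<beta>' \<and> r = ext_deriv (frame_atlas \<A>) \<beta>' p X Y" for r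
      using that F.ext_deriv_local_extension_unique[where X = X and Y = Y, OF _ ext c(3)[symmetric] fchart_in_frame_atlas[OF c(1)] c(2) \<sigma>]
      by blast
  qed
qed

lemma local_extension_from_chart:
  assumes "c \<in> \<A>" "p \<in> fst (fchart c)"
    and "\<And>z. z \<in> snd (fchart c) ` fst (fchart c) \<Longrightarrow> linear (b z)"
    and "\<And>X. smooth_on (\<lambda>z. b z X) (snd (fchart c) ` fst (fchart c))"
    and "\<And>q X. q \<in> fst (fchart c) \<inter> onframes \<Longrightarrow> X \<in> sub_tangent_space (frame_atlas \<A>) onframes q \<Longrightarrow>
      \<alpha> q X = b (snd (fchart c) q) (X (fchart c))"
  shows "local_extension (frame_atlas \<A>) onframes \<alpha> p (fst (fchart c)) (\<lambda>q X. b (snd (fchart c) q) (X (fchart c)))"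
  unfolding local_extension_def
  using F.openin_chart[OF fchart_in_frame_atlas[OF assms(1)]]
    F.smooth_one_form_from_chart[OF fchart_in_frame_atlas[OF assms(1)] assms(3,4)] assms(2,5) by blast

lemma fchart_coordinate:
  "p \<in> fst (fchart c) \<Longrightarrow> fst (snd (fchart c) p) \<in> snd c ` fst c"
  using fchart_base by (simp add: fst_fchart_apply)

lemma onframes_orthonormal:
  "c \<in> \<A> \<Longrightarrow> p \<in> onframes \<Longrightarrow> p \<in> fst (fchart c) \<Longrightarrow> orthonormal_at c (snd (fchart c) p)"
  using onframes_iff by blast

lemma sub_tangentD:
  assumes "c \<in> \<A>" "p \<in> onframes" "p \<in> fst (fchart c)" "X \<in> sub_tangent_space (frame_atlas \<A>) onframes p"
  shows "X \<in> tangent_space (frame_atlas \<A>) p" "lc_form c (snd (fchart c) p) (X (fchart c)) \<in> orthogonal_lie_algebra"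
  using sub_tangent_space_onframes[OF assms(1-3)] assms(4) by blast+


subsection \<open>The canonical form\<close>

text \<open>The inverse of the frame is avoided by applying the frame to \<open>solder\<close>:
  since \<open>m m\<^sup>T G\<close> is the identity, the result is the projection of
  \<open>X\<close>.\<close>

lemma canonical_form_chart:
  assumes "c \<in> \<A>" "p \<in> onframes" "p \<in> fst (fchart c)" "X \<in> tangent_space (frame_atlas \<A>) p"
  shows "canonical_form \<A> p X = solder c (snd (fchart c) p) (X (fchart c))"
proof -
  let ?z = "snd (fchart c) p" and ?v = "fst (X (fchart c))"
  note x = fchart_base[OF assms(3)]
  have sp: "snd p a = coord_vec \<A> c (fst p) (snd ?z *v a)" for a
    using arg_cong[OF frame_eq(1)[OF assms(1,3)], of "\<lambda>q. snd q a"] by (simp add: frame_of_def)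
  have "snd ?z *v solder c ?z (X (fchart c)) = (snd ?z ** transpose (snd ?z) ** metric c (fst ?z)) *v ?v"
    by (simp add: solder_def matrix_vector_mul_assoc matrix_mul_assoc del: transpose_matrix_vector)
  then have "snd p (solder c ?z (X (fchart c))) = coord_vec \<A> c (fst p) ?v"
    using orthonormal_at_inverse(1)[OF onframes_orthonormal[OF assms(1-3)]] by (simp add: sp)
  also have "\<dots> = pushforward (frame_atlas \<A>) \<A> fst p X"
    by (rule pushforward_projection[OF onframes_frames[OF assms(2)] assms(1) x assms(4), symmetric])
  finally have "pushforward (frame_atlas \<A>) \<A> fst p X = snd p (solder c ?z (X (fchart c)))" by simp
  moreover have "inj (snd p)"
    using onframes_frames[OF assms(2)] by (cases p) (auto simp: frames_def bij_betw_def)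
  ultimately show ?thesis by (simp add: canonical_form_def inv_f_f)
qed

lemma solder_has_derivative:
  assumes "c \<in> \<A>" "fst z \<in> snd c ` fst c"
  shows "((\<lambda>z. solder c z Y) has_derivative (\<lambda>X. transpose (snd z) *v (dmetric c (fst z) (fst X) *v fst Y) +
    transpose (snd X) *v (metric c (fst z) *v fst Y))) (at z)"
proof -
  have f: "(fst has_derivative fst) (at z)" and s: "(snd has_derivative snd) (at z)"
    by (rule bounded_linear_imp_has_derivative bounded_linear_fst bounded_linear_snd)+
  have "((\<lambda>z. metric c (fst z)) has_derivative (\<lambda>X. dmetric c (fst z) (fst X))) (at z)"
    by (rule has_derivative_compose[OF f metric_has_derivative[OF assms]])
  then have "((\<lambda>z. metric c (fst z) *v fst Y) has_derivative (\<lambda>X. dmetric c (fst z) (fst X) *v fst Y)) (at z)"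
    by (rule bounded_linear.has_derivative[OF bounded_bilinear.bounded_linear_left[OF bounded_bilinear_matrix_vector_mult]])
  moreover have "((\<lambda>z. transpose (snd z)) has_derivative (\<lambda>X. transpose (snd X))) (at z)"
    by (rule bounded_linear.has_derivative[OF bounded_linear_transpose s])
  ultimately show ?thesis
    unfolding solder_def by (rule bounded_bilinear.FDERIV[OF bounded_bilinear_matrix_vector_mult, rotated])
qed

text \<open>The extension is \<open>solder\<close>, not the canonical form on all frames, so that
  its derivative is a plain product rule.\<close>

lemma sub_ext_deriv_canonical_form:
  assumes "p \<in> onframes" "X \<in> sub_tangent_space (frame_atlas \<A>) onframes p"
    "Y \<in> sub_tangent_space (frame_atlas \<A>) onframes p"
  obtains c where "c \<in> \<A>" "p \<in> fst (fchart c)"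
    "sub_ext_deriv (frame_atlas \<A>) onframes (canonical_form \<A>) p X Y =
      frechet_derivative (\<lambda>z. solder c z (Y (fchart c))) (at (snd (fchart c) p)) (X (fchart c)) -
      frechet_derivative (\<lambda>z. solder c z (X (fchart c))) (at (snd (fchart c) p)) (Y (fchart c))"
proof -
  obtain c where c: "c \<in> \<A>" "p \<in> fst (fchart c)" "chart_at (frame_atlas \<A>) p = fchart c"
    by (rule chart_at_frame[OF onframes_frames[OF assms(1)]])
  let ?C = "fchart c" and ?\<beta> = "\<lambda>q X. solder c (snd (fchart c) q) (X (fchart c))"
  note C = fchart_in_frame_atlas[OF c(1)]
  have "local_extension (frame_atlas \<A>) onframes (canonical_form \<A>) p (fst ?C) ?\<beta>"
    by (rule local_extension_from_chart[OF c(1,2) linear_solder smooth_on_solder[OF c(1)]])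
      (use canonical_form_chart[OF c(1)] sub_tangentD[OF c(1)] in blast)
  note sub_ext_deriv_eq[OF assms this]
  moreover have "frechet_derivative (form_coeff (frame_atlas \<A>) ?\<beta> ?C Z) (at (snd ?C p)) =
    frechet_derivative (\<lambda>z. solder c z Z) (at (snd ?C p))" for Z
  proof (rule frechet_derivative_transform_within_open[OF _ F.open_chart_image[OF C], symmetric])
    show "(\<lambda>z. solder c z Z) differentiable at (snd ?C p)"
      using solder_has_derivative[OF c(1) fchart_coordinate[OF c(2)]] unfolding differentiable_def by blast
    show "snd ?C p \<in> snd ?C ` fst ?C" using c(2) by blast
    show "solder c z Z = form_coeff (frame_atlas \<A>) ?\<beta> ?C Z z" if "z \<in> snd ?C ` fst ?C" for z
      by (rule F.form_coeff_from_chart[OF C that, symmetric])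
  qed
  ultimately show thesis using that[OF c(1,2)] by (simp add: ext_deriv_def Let_def c(3))
qed


subsection \<open>The Levi-Civita connection\<close>

definition levi_civita_form ::
    "('a, 'n) frame \<Rightarrow> (('a, 'n) frame, (real^'n) \<times> (real^'n^'n)) tvec \<Rightarrow> real^'n^'n"
  where "levi_civita_form p X =
    (let c = chart_at \<A> (fst p) in lc_form c (snd (fchart c) p) (X (fchart c)))"

definition levi_civita :: "('a, 'n) distribution"
  where "levi_civita = {(p, X). p \<in> onframes \<and> X \<in> sub_tangent_space (frame_atlas \<A>) onframes p \<and>
    levi_civita_form p X = 0}"

lemma levi_civita_form_chart:
  assumes "c \<in> \<A>" "p \<in> fst (fchart c)" "X \<in> tangent_space (frame_atlas \<A>) p"
  shows "levi_civita_form p X = lc_form c (snd (fchart c) p) (X (fchart c))"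
proof -
  note x = fchart_base[OF assms(2)]
  have "fst p \<in> points \<A>" using assms(1) x by (auto simp: points_def)
  from chart_at[OF this] show ?thesis
    unfolding levi_civita_form_def Let_def
    by (rule lc_form_transform[OF _ assms(1) fchart_in_frames[OF assms(2)] _ x assms(3)])
qed

text \<open>Applied to the base component of a second vector, the left side is the derivative of
  \<open>solder\<close> along \<open>X\<close> plus the connection term, that is, one half of the
  torsion. The right side is then symmetric in the two base vectors.\<close>

lemma torsion_identity:
  assumes "c \<in> \<A>" "fst z \<in> snd c ` fst c" "orthonormal_at c z" "lc_form c z X \<in> orthogonal_lie_algebra"
  shows "transpose (snd z) ** dmetric c (fst z) (fst X) + transpose (snd X) ** metric c (fst z) +
      lc_form c z X ** transpose (snd z) ** metric c (fst z) =
    transpose (snd z) ** christoffel (dmetric c (fst z)) (fst X)"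
proof -
  let ?m = "snd z" and ?G = "metric c (fst z)" and ?D = "dmetric c (fst z) (fst X)"
    and ?C = "christoffel (dmetric c (fst z)) (fst X)"
  have inv: "A ** ?m ** transpose ?m ** ?G = A" for A :: "real^'n^'n"
    using orthonormal_at_inverse(1)[OF assms(3)] by (simp add: matrix_mul_assoc[symmetric])
  \<comment> \<open>The tangency condition is multiplied on the right by the inverse of
    \<open>m\<close>, which turns it into an expression for the derivative of
    \<open>m\<^sup>T G\<close>.\<close>
  have "(transpose (snd X) ** ?G ** ?m + transpose ?m ** ?D ** ?m + transpose ?m ** ?G ** snd X) **
      transpose ?m ** ?G = 0"
    using assms(4) unfolding lc_form_skew_iff[OF assms(1,2)] by (simp add: matrix_bilinear_simps)
  then have "transpose (snd X) ** ?G + transpose ?m ** ?D + transpose ?m ** ?G ** snd X ** transpose ?m ** ?G = 0"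
    by (simp add: matrix_bilinear_simps inv)
  moreover have "lc_form c z X ** transpose ?m ** ?G =
      transpose ?m ** ?G ** snd X ** transpose ?m ** ?G + transpose ?m ** ?C"
    by (simp add: lc_form_def matrix_bilinear_simps matrix_mul_assoc inv)
  ultimately show ?thesis by (simp add: algebra_simps)
qed

lemma torsion_levi_civita_form:
  assumes "p \<in> onframes" "X \<in> sub_tangent_space (frame_atlas \<A>) onframes p"
    "Y \<in> sub_tangent_space (frame_atlas \<A>) onframes p"
  shows "torsion \<A> g levi_civita_form p X Y = 0"
proof -
  obtain c where c: "c \<in> \<A>" "p \<in> fst (fchart c)"
    and d: "sub_ext_deriv (frame_atlas \<A>) onframes (canonical_form \<A>) p X Y =
      frechet_derivative (\<lambda>z. solder c z (Y (fchart c))) (at (snd (fchart c) p)) (X (fchart c)) -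
      frechet_derivative (\<lambda>z. solder c z (X (fchart c))) (at (snd (fchart c) p)) (Y (fchart c))"
    by (rule sub_ext_deriv_canonical_form[OF assms])
  let ?z = "snd (fchart c) p"
  note y = fchart_coordinate[OF c(2)] and on = onframes_orthonormal[OF c(1) assms(1) c(2)]
  note T = sub_tangentD[OF c(1) assms(1) c(2)]
  have D: "frechet_derivative (\<lambda>z. solder c z B) (at ?z) A =
    transpose (snd ?z) *v (dmetric c (fst ?z) (fst A) *v fst B) + transpose (snd A) *v (metric c (fst ?z) *v fst B)" for A B
    using fun_cong[OF frechet_derivative_at[OF solder_has_derivative[OF c(1) y]], of A B] by (rule sym)
  \<comment> \<open>The torsion is this expression minus the one with the two vectors exchanged; by
    the symmetry of \<open>christoffel\<close> both are equal.\<close>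
  have *: "frechet_derivative (\<lambda>z. solder c z B) (at ?z) A + lc_form c ?z A *v solder c ?z B =
    transpose (snd ?z) *v (christoffel (dmetric c (fst ?z)) (fst A) *v fst B)"
    if "lc_form c ?z A \<in> orthogonal_lie_algebra" for A B
    using arg_cong[OF torsion_identity[OF c(1) y on that], of "\<lambda>M. M *v fst B"]
    unfolding D by (simp add: solder_def matrix_vector_mul_assoc matrix_mul_assoc matrix_vector_mult_add_rdistrib
        del: transpose_matrix_vector)
  have "christoffel (dmetric c (fst ?z)) (fst (X (fchart c))) *v fst (Y (fchart c)) =
      christoffel (dmetric c (fst ?z)) (fst (Y (fchart c))) *v fst (X (fchart c))"
    by (rule christoffel_symmetric[OF linear_dmetric[OF c(1) y] transpose_dmetric[OF c(1) y]])
  then show ?thesis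
    using *[OF T(2)[OF assms(2)], of "Y (fchart c)"] *[OF T(2)[OF assms(3)], of "X (fchart c)"]
    unfolding torsion_def d canonical_form_chart[OF c(1) assms(1) c(2) T(1)[OF assms(2)]]
      canonical_form_chart[OF c(1) assms(1) c(2) T(1)[OF assms(3)]]
      levi_civita_form_chart[OF c T(1)[OF assms(2)]] levi_civita_form_chart[OF c T(1)[OF assms(3)]]
    by (simp add: algebra_simps)
qed

lemma zero_in_orthogonal_lie_algebra: "(0 :: real^'n^'n) \<in> orthogonal_lie_algebra"
  by (simp add: orthogonal_lie_algebra_def transpose_def vec_eq_iff)

text \<open>A linear injective parametrisation of the fibre, from which the subspace property, local
  frames, invariance and the projection are read off. Lifts are tangent because their form value 0
  is skew.\<close>

lemma levi_civita_fibre: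
  assumes "c \<in> \<A>" "p \<in> onframes" "p \<in> fst (fchart c)"
  shows "levi_civita `` {p} =
    range (\<lambda>v. coord_vec (frame_atlas \<A>) (fchart c) p (horizontal_lift c (snd (fchart c) p) v))"
proof (intro equalityI subsetI)
  let ?C = "fchart c" and ?z = "snd (fchart c) p"
  note C = fchart_in_frame_atlas[OF assms(1)] and on = onframes_orthonormal[OF assms]
  fix X assume "X \<in> levi_civita `` {p}"
  then have X: "X \<in> sub_tangent_space (frame_atlas \<A>) onframes p" "levi_civita_form p X = 0"
    by (auto simp: levi_civita_def)
  note T = sub_tangentD(1)[OF assms X(1)]
  have "lc_form c ?z (X ?C) = 0" using X(2) levi_civita_form_chart[OF assms(1,3) T] by simp
  then have "X = coord_vec (frame_atlas \<A>) ?C p (horizontal_lift c ?z (fst (X ?C)))"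
    using F.tangent_vector_eq_coord_vec[OF C assms(3) T] lc_form_eq_0_imp[OF on] by metis
  then show "X \<in> range (\<lambda>v. coord_vec (frame_atlas \<A>) ?C p (horizontal_lift c ?z v))" by blast
next
  let ?C = "fchart c" and ?z = "snd (fchart c) p"
  note C = fchart_in_frame_atlas[OF assms(1)] and on = onframes_orthonormal[OF assms]
  fix X assume "X \<in> range (\<lambda>v. coord_vec (frame_atlas \<A>) ?C p (horizontal_lift c ?z v))"
  then obtain v where X: "X = coord_vec (frame_atlas \<A>) ?C p (horizontal_lift c ?z v)" by blast
  have T: "X \<in> tangent_space (frame_atlas \<A>) p" unfolding X by (rule F.coord_vec_in_tangent_space[OF C assms(3)])
  have "lc_form c ?z (X ?C) = 0" using lc_form_horizontal_lift[OF on] C assms(3) by (simp add: X)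
  then show "X \<in> levi_civita `` {p}"
    using assms(2) T levi_civita_form_chart[OF assms(1,3) T] sub_tangent_space_onframes[OF assms]
      zero_in_orthogonal_lie_algebra by (simp add: levi_civita_def)
qed

lemma linear_frame_lift:
  assumes "c \<in> \<A>" "p \<in> fst (fchart c)"
  shows "linear (\<lambda>v. coord_vec (frame_atlas \<A>) (fchart c) p (horizontal_lift c (snd (fchart c) p) v))"
  using linear_compose[OF linear_horizontal_lift[OF assms(1) fchart_coordinate[OF assms(2)]]
      F.linear_coord_vec[OF fchart_in_frame_atlas[OF assms(1)] assms(2)]] by (simp add: o_def)

lemma inj_frame_lift:
  assumes "c \<in> \<A>" "p \<in> fst (fchart c)"
  shows "inj (\<lambda>v. coord_vec (frame_atlas \<A>) (fchart c) p (horizontal_lift c (snd (fchart c) p) v))" (is "inj ?L")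
proof (rule injI)
  fix v w assume "?L v = ?L w"
  from fun_cong[OF this, of "fchart c"] show "v = w"
    using fchart_in_frame_atlas[OF assms(1)] assms(2) by (simp add: horizontal_lift_def)
qed

lemma smooth_distribution_levi_civita: "smooth_distribution (frame_atlas \<A>) onframes levi_civita"
  unfolding smooth_distribution_def
proof (intro conjI ballI)
  show "levi_civita \<subseteq> Sigma onframes (sub_tangent_space (frame_atlas \<A>) onframes)"
    by (auto simp: levi_civita_def)
next
  fix p assume p: "p \<in> onframes"
  obtain c where c: "c \<in> \<A>" "p \<in> fst (fchart c)" by (rule chart_at_frame[OF onframes_frames[OF p]])
  show "subspace (levi_civita `` {p})"
    unfolding levi_civita_fibre[OF c(1) p c(2)]
    by (rule linear_subspace_image[OF linear_frame_lift[OF c] subspace_UNIV])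
  \<comment> \<open>The local frame consists of the lifts of the standard basis; \<open>h\<close>
    numbers the basis, as \<open>smooth_distribution\<close> indexes a frame by natural
    numbers.\<close>
  obtain h where h: "bij_betw h {0..<CARD('n)} (UNIV :: 'n set)"
    using ex_bij_betw_nat_finite[OF finite_class.finite_UNIV] by blast
  define L where "L q v = coord_vec (frame_atlas \<A>) (fchart c) q (horizontal_lift c (snd (fchart c) q) v)" for q v
  define E where "E i q = L q (axis (h i) 1)" for i q
  have Eim: "(\<lambda>i. E i q) ` {..<CARD('n)} = L q ` Basis" for q
  proof -
    have "h ` {..<CARD('n)} = UNIV" using h by (simp add: bij_betw_def lessThan_atLeast0)
    moreover have "range (\<lambda>j. axis j (1::real)) = (Basis :: (real^'n) set)" by (auto simp: Basis_vec_def)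
    ultimately have B: "(\<lambda>j. axis j (1::real)) ` h ` {..<CARD('n)} = Basis" by (simp only:)
    show ?thesis unfolding B[symmetric] by (simp add: E_def image_image)
  qed
  have "smooth_vector_field (frame_atlas \<A>) (fst (fchart c)) (E i)" for i
    unfolding E_def[abs_def] L_def
    by (rule F.smooth_vector_field_from_chart[OF fchart_in_frame_atlas[OF c(1)] smooth_on_horizontal_lift[OF c(1)]])
  moreover have "inj_on (\<lambda>i. E i q) {..<CARD('n)} \<and> independent ((\<lambda>i. E i q) ` {..<CARD('n)}) \<and>
      span ((\<lambda>i. E i q) ` {..<CARD('n)}) = levi_civita `` {q}" if q: "q \<in> fst (fchart c) \<inter> onframes" for q
  proof -
    have qc: "q \<in> fst (fchart c)" "q \<in> onframes" using q by auto
    have l: "linear (L q)" and i: "inj (L q)"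
      using linear_frame_lift[OF c(1) qc(1)] inj_frame_lift[OF c(1) qc(1)] by (simp_all add: L_def[abs_def])
    have "inj_on (\<lambda>i. E i q) {..<CARD('n)}"
    proof (rule inj_onI)
      fix i j assume ij: "i \<in> {..<CARD('n)}" "j \<in> {..<CARD('n)}" "E i q = E j q"
      then have "axis (h i) (1::real) = axis (h j) 1" using i by (auto simp: E_def inj_def)
      then have "h i = h j" by (simp add: axis_eq_axis)
      then show "i = j" using h ij(1,2) by (auto simp: bij_betw_def inj_on_def)
    qed
    moreover have "independent (L q ` Basis)"
      by (rule linear_independent_injective_image[OF l independent_Basis inj_on_subset[OF i]]) simp
    moreover have "span (L q ` Basis) = levi_civita `` {q}"
      unfolding levi_civita_fibre[OF c(1) qc(2,1)] L_def[symmetric]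
      by (simp add: linear_span_image[OF l] span_Basis)
    ultimately show ?thesis by (simp add: Eim)
  qed
  ultimately show "\<exists>W (r::nat) E. openin (manifold_topology (frame_atlas \<A>)) W \<and> p \<in> W \<and>
      (\<forall>i<r. smooth_vector_field (frame_atlas \<A>) W (E i)) \<and>
      (\<forall>q\<in>W \<inter> onframes. inj_on (\<lambda>i. E i q) {..<r} \<and> independent ((\<lambda>i. E i q) ` {..<r}) \<and>
        span ((\<lambda>i. E i q) ` {..<r}) = levi_civita `` {q})"
    using F.openin_chart[OF fchart_in_frame_atlas[OF c(1)]] c(2)
    by (intro exI[of _ "fst (fchart c)"] exI[of _ "CARD('n)"] exI[of _ E]) blast
qed

section \<open>The Levi-Civita distribution is a connection, and its form is the connection
  form\<close>

lemma right_action_onframes: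
  assumes "orthogonal_matrix h" "p \<in> onframes"
  shows "right_action h p \<in> onframes"
proof -
  have h: "invertible h" and hh: "transpose h ** h = mat 1"
    using assms(1) unfolding orthogonal_matrix_def invertible_def by blast+
  obtain c where c: "c \<in> \<A>" "p \<in> fst (fchart c)" by (rule chart_at_frame[OF onframes_frames[OF assms(2)]])
  note ra = right_action_fchart[OF c h]
  have a: "transpose (snd (snd (fchart c) p)) ** metric c (snd c (fst p)) ** snd (snd (fchart c) p) = mat 1"
    using onframes_orthonormal[OF c(1) assms(2) c(2)] by (simp add: orthonormal_at_def fst_fchart_apply)
  let ?m = "snd (snd (fchart c) p)" and ?G = "metric c (snd c (fst p))"
  have "transpose (?m ** h) ** ?G ** (?m ** h) = transpose h ** (transpose ?m ** ?G ** ?m) ** h"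
    by (simp only: matrix_transpose_mul matrix_mul_assoc)
  then show ?thesis
    using onframes_iff[OF c(1) ra(1)] by (simp add: ra(2) orthonormal_at_def a hh)
qed

lemma frame_connection_levi_civita: "frame_connection \<A> g levi_civita"
  unfolding frame_connection_def principal_connection_def
proof (intro conjI ballI smooth_distribution_levi_civita)
  fix h :: "real^'n^'n" and p assume "h \<in> orthogonal_group" and p: "p \<in> onframes"
  then have h: "orthogonal_matrix h" by (simp add: orthogonal_group_def)
  then have hi: "invertible h" and hh: "h ** transpose h = mat 1"
    unfolding orthogonal_matrix_def invertible_def by blast+
  obtain c where c: "c \<in> \<A>" "p \<in> fst (fchart c)" "chart_at (frame_atlas \<A>) p = fchart c"
    by (rule chart_at_frame[OF onframes_frames[OF p]])
  note ra = right_action_fchart[OF c(1,2) hi]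
  let ?m = "snd (snd (fchart c) p)"
  \<comment> \<open>For orthogonal \<open>h\<close> the product \<open>m m\<^sup>T\<close> is
    unchanged, so the lift at the moved frame is the old lift with its matrix multiplied by
    \<open>h\<close>, which is the pushforward.\<close>
  have "?m ** h ** transpose (?m ** h) = ?m ** (h ** transpose h) ** transpose ?m"
    by (simp only: matrix_transpose_mul matrix_mul_assoc)
  then have "horizontal_lift c (snd (fchart c) (right_action h p)) v =
      (fst (horizontal_lift c (snd (fchart c) p) v), snd (horizontal_lift c (snd (fchart c) p) v) ** h)" for v
    by (simp add: horizontal_lift_def ra(2) fst_fchart_apply hh matrix_bilinear_simps matrix_mul_assoc)
  then show "pushforward (frame_atlas \<A>) (frame_atlas \<A>) (right_action h) p ` (levi_civita `` {p}) =
      levi_civita `` {right_action h p}"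
    unfolding levi_civita_fibre[OF c(1) p c(2)]
      levi_civita_fibre[OF c(1) right_action_onframes[OF h p] ra(1)]
      pushforward_right_action[OF onframes_frames[OF p] hi c(1,3,2)]
    using fchart_in_frame_atlas[OF c(1)] c(2) by (simp add: image_image)
next
  fix p assume p: "p \<in> onframes"
  obtain c where c: "c \<in> \<A>" "p \<in> fst (fchart c)" by (rule chart_at_frame[OF onframes_frames[OF p]])
  note C = fchart_in_frame_atlas[OF c(1)] and x = fchart_base[OF c(2)]
  let ?L = "\<lambda>v. coord_vec (frame_atlas \<A>) (fchart c) p (horizontal_lift c (snd (fchart c) p) v)"
  let ?\<pi> = "pushforward (frame_atlas \<A>) \<A> fst p"
  have \<pi>: "?\<pi> (?L v) = coord_vec \<A> c (fst p) v" for v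
    using pushforward_projection[OF onframes_frames[OF p] c(1) x F.coord_vec_in_tangent_space[OF C c(2)]]
      C c(2) by (simp add: horizontal_lift_def)
  have "inj_on ?\<pi> (range ?L)"
  proof (rule inj_onI; clarify)
    fix v w assume "?\<pi> (?L v) = ?\<pi> (?L w)"
    from fun_cong[OF this[unfolded \<pi>], of c] show "?L v = ?L w" using c(1) x by simp
  qed
  moreover have "?\<pi> ` range ?L = tangent_space \<A> (fst p)"
  proof -
    have "?\<pi> ` range ?L = range (coord_vec \<A> c (fst p))" by (simp only: image_image \<pi>)
    then show ?thesis by (simp only: tangent_space_eq_range[OF c(1) x])
  qed
  ultimately show "bij_betw ?\<pi> (levi_civita `` {p}) (tangent_space \<A> (fst p))"
    unfolding levi_civita_fibre[OF c(1) p c(2)] bij_betw_def by blast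
qed

text \<open>The form takes \<open>(0, m ** Z)\<close> to \<open>m\<^sup>T G m Z\<close>, which is
  \<open>Z\<close> on orthonormal frames. Skewness of \<open>Z\<close> then gives tangency.\<close>

lemma fundamental_vector_tangent:
  assumes "c \<in> \<A>" "p \<in> onframes" "p \<in> fst (fchart c)" "Z \<in> orthogonal_lie_algebra"
  shows "lc_form c (snd (fchart c) p) (0, snd (snd (fchart c) p) ** Z) = Z"
    and "fundamental_vector (frame_atlas \<A>) right_action Z p \<in> sub_tangent_space (frame_atlas \<A>) onframes p"
proof -
  let ?z = "snd (fchart c) p"
  note C = fchart_in_frame_atlas[OF assms(1)]
  have "christoffel (dmetric c (fst ?z)) 0 = 0"
    by (rule linear_0[OF linear_christoffel[OF linear_dmetric[OF assms(1) fchart_coordinate[OF assms(3)]]]])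
  then show l: "lc_form c ?z (0, snd ?z ** Z) = Z"
    using onframes_orthonormal[OF assms(1-3)]
    by (simp add: lc_form_def matrix_bilinear_simps matrix_mul_assoc orthonormal_at_def)
  show "fundamental_vector (frame_atlas \<A>) right_action Z p \<in> sub_tangent_space (frame_atlas \<A>) onframes p"
    unfolding fundamental_vector_frame[OF assms(1,3)] sub_tangent_space_onframes[OF assms(1-3)]
    using F.coord_vec_in_tangent_space[OF C assms(3)] C assms(3,4) l by simp
qed

lemma connection_form_levi_civita:
  "connection_form (frame_atlas \<A>) onframes orthogonal_lie_algebra right_action levi_civita levi_civita_form"
  unfolding connection_form_def
proof (intro conjI ballI)
  show "sub_smooth_one_form (frame_atlas \<A>) onframes levi_civita_form"
    unfolding sub_smooth_one_form_def
  proof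
    fix p assume p: "p \<in> onframes"
    obtain c where c: "c \<in> \<A>" "p \<in> fst (fchart c)" by (rule chart_at_frame[OF onframes_frames[OF p]])
    have "local_extension (frame_atlas \<A>) onframes levi_civita_form p (fst (fchart c))
        (\<lambda>q X. lc_form c (snd (fchart c) q) (X (fchart c)))"
      by (rule local_extension_from_chart[OF c linear_lc_form[OF c(1) smooth_coordinates(4)[OF c(1)]] smooth_on_lc_form[OF c(1)]])
        (use levi_civita_form_chart[OF c(1)] sub_tangentD(1)[OF c(1)] in blast)+
    then show "\<exists>W \<beta>. local_extension (frame_atlas \<A>) onframes levi_civita_form p W \<beta>" by blast
  qed
next
  fix p X assume p: "p \<in> onframes" and X: "X \<in> sub_tangent_space (frame_atlas \<A>) onframes p"
  obtain c where c: "c \<in> \<A>" "p \<in> fst (fchart c)" by (rule chart_at_frame[OF onframes_frames[OF p]])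
  show "levi_civita_form p X \<in> orthogonal_lie_algebra"
    using sub_tangentD[OF c(1) p c(2) X] levi_civita_form_chart[OF c] by simp
next
  fix p and Z :: "real^'n^'n" assume p: "p \<in> onframes" and Z: "Z \<in> orthogonal_lie_algebra"
  obtain c where c: "c \<in> \<A>" "p \<in> fst (fchart c)" by (rule chart_at_frame[OF onframes_frames[OF p]])
  have "fundamental_vector (frame_atlas \<A>) right_action Z p \<in> tangent_space (frame_atlas \<A>) p"
    by (rule sub_tangentD(1)[OF c(1) p c(2) fundamental_vector_tangent(2)[OF c(1) p c(2) Z]])
  from levi_civita_form_chart[OF c this]
  show "levi_civita_form p (fundamental_vector (frame_atlas \<A>) right_action Z p) = Z"
    using fundamental_vector_tangent(1)[OF c(1) p c(2) Z] fchart_in_frame_atlas[OF c(1)] c(2)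
    by (simp add: fundamental_vector_frame[OF c])
qed (auto simp: levi_civita_def)

lemma torsion_free_levi_civita: "torsion_free \<A> g levi_civita"
  unfolding torsion_free_def using connection_form_levi_civita torsion_levi_civita_form by blast


subsection \<open>Uniqueness\<close>

text \<open>
  The trilinear form \<open>c \<bullet> (S a *v b)\<close> is symmetric in \<open>a, b\<close> and skew in \<open>b, c\<close>, and the
  product of these transpositions has order three.
\<close>

lemma symmetric_skew_eq_0:
  fixes S :: "real^'n \<Rightarrow> real^'n^'n"
  assumes sym: "\<And>a b. S a *v b = S b *v a" and skew: "\<And>a. S a \<in> orthogonal_lie_algebra"
  shows "S a = 0"
proof (rule matrix_eqI_inner)
  fix b c
  have sk: "u \<bullet> (S v *v w) = - (w \<bullet> (S v *v u))" for u v w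
  proof -
    have "transpose (S v) = - S v" using skew[of v] by (simp add: orthogonal_lie_algebra_def)
    then show ?thesis
      using inner_matrix_transpose[of u "S v" w]
      by (simp add: bounded_bilinear.minus_left[OF bounded_bilinear_matrix_vector_mult] del: transpose_matrix_vector)
  qed
  have "c \<bullet> (S a *v b) = - (c \<bullet> (S a *v b))"
    using sk[of c a b] sk[of a b c] sk[of b c a] sym[of a c] sym[of b a] sym[of c b] by simp
  then show "c \<bullet> (S a *v b) = c \<bullet> (0 *v b)" by simp
qed

text \<open>Subtracting the two vanishing torsions removes the exterior derivative. On horizontal
  vectors the Levi-Civita form is 0, so \<phi> itself takes the place of the difference of the
  forms.\<close>

lemma torsion_free_form_on_levi_civita:
  assumes form: "connection_form (frame_atlas \<A>) onframes orthogonal_lie_algebra right_action A \<phi>"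
    and T0: "\<And>p X Y. p \<in> onframes \<Longrightarrow> X \<in> sub_tangent_space (frame_atlas \<A>) onframes p \<Longrightarrow>
      Y \<in> sub_tangent_space (frame_atlas \<A>) onframes p \<Longrightarrow> torsion \<A> g \<phi> p X Y = 0"
    and "(p, X) \<in> levi_civita"
  shows "\<phi> p X = 0"
proof -
  have p: "p \<in> onframes" using assms(3) by (simp add: levi_civita_def)
  obtain c where c: "c \<in> \<A>" "p \<in> fst (fchart c)" by (rule chart_at_frame[OF onframes_frames[OF p]])
  let ?z = "snd (fchart c) p"
  note C = fchart_in_frame_atlas[OF c(1)]
  note inv = orthonormal_at_inverse[OF onframes_orthonormal[OF c(1) p c(2)]]
  \<comment> \<open>The lift of the image of \<open>a\<close> under the frame, so that its canonical
    form is \<open>a\<close> itself.\<close>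
  define H where "H a = coord_vec (frame_atlas \<A>) (fchart c) p (horizontal_lift c ?z (snd ?z *v a))" for a
  have HA: "H a \<in> levi_civita `` {p}" for a
    unfolding levi_civita_fibre[OF c(1) p c(2)] H_def by blast
  then have HT: "H a \<in> sub_tangent_space (frame_atlas \<A>) onframes p" and H0: "levi_civita_form p (H a) = 0" for a
    by (auto simp: levi_civita_def)
  have can: "canonical_form \<A> p (H a) = a" for a
  proof -
    have "canonical_form \<A> p (H a) = (transpose (snd ?z) ** metric c (fst ?z) ** snd ?z) *v a"
      using canonical_form_chart[OF c(1) p c(2) sub_tangentD(1)[OF c(1) p c(2) HT]] C c(2)
      by (simp add: H_def solder_def horizontal_lift_def matrix_vector_mul_assoc matrix_mul_assoc
          del: transpose_matrix_vector)
    then show ?thesis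
      using onframes_orthonormal[OF c(1) p c(2)] by (simp add: orthonormal_at_def)
  qed
  have "\<phi> p (H a) *v b = \<phi> p (H b) *v a" for a b
    using T0[OF p HT HT, of a b] torsion_levi_civita_form[OF p HT HT, of a b]
    by (simp add: torsion_def can H0)
  moreover have "\<phi> p (H a) \<in> orthogonal_lie_algebra" for a
    using form p HT unfolding connection_form_def by blast
  ultimately have z: "\<phi> p (H a) = 0" for a by (rule symmetric_skew_eq_0)
  have "X \<in> levi_civita `` {p}" using assms(3) by blast
  then obtain v where "X = coord_vec (frame_atlas \<A>) (fchart c) p (horizontal_lift c ?z v)"
    unfolding levi_civita_fibre[OF c(1) p c(2)] by blast
  \<comment> \<open>Every base vector \<open>v\<close> is the image under the frame of
    \<open>m\<^sup>T G v\<close>, so the \<open>H a\<close> exhaust the fibre.\<close>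
  then have "X = H (transpose (snd ?z) ** metric c (fst ?z) *v v)"
    using inv(1) by (simp add: H_def matrix_vector_mul_assoc matrix_mul_assoc)
  then show ?thesis using z by simp
qed

text \<open>Splits \<open>X\<close> into a horizontal part, killed by \<phi>, and the fundamental
  vector of the value \<open>Z\<close> of the Levi-Civita form on \<open>X\<close>. So \<phi> also
  takes the value \<open>Z\<close> on \<open>X\<close>, and this is 0.\<close>

lemma torsion_free_connection_subset:
  assumes conn: "frame_connection \<A> g A"
    and form: "connection_form (frame_atlas \<A>) onframes orthogonal_lie_algebra right_action A \<phi>"
    and T0: "\<And>p X Y. p \<in> onframes \<Longrightarrow> X \<in> sub_tangent_space (frame_atlas \<A>) onframes p \<Longrightarrow>
      Y \<in> sub_tangent_space (frame_atlas \<A>) onframes p \<Longrightarrow> torsion \<A> g \<phi> p X Y = 0"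
    and pX: "(p, X) \<in> A"
  shows "(p, X) \<in> levi_civita"
proof -
  have p: "p \<in> onframes" and X: "X \<in> sub_tangent_space (frame_atlas \<A>) onframes p"
    using conn pX unfolding frame_connection_def principal_connection_def smooth_distribution_def by blast+
  have \<phi>X: "\<phi> p X = 0" using form pX unfolding connection_form_def by blast
  obtain c where c: "c \<in> \<A>" "p \<in> fst (fchart c)" by (rule chart_at_frame[OF onframes_frames[OF p]])
  let ?z = "snd (fchart c) p" and ?V = "coord_vec (frame_atlas \<A>) (fchart c) p"
  note C = fchart_in_frame_atlas[OF c(1)] and on = onframes_orthonormal[OF c(1) p c(2)]
  note TX = sub_tangentD[OF c(1) p c(2) X]
  define Z where "Z = lc_form c ?z (X (fchart c))"
  define X0 where "X0 = ?V (horizontal_lift c ?z (fst (X (fchart c))))"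
  define X1 where "X1 = fundamental_vector (frame_atlas \<A>) right_action Z p"
  have Z: "Z \<in> orthogonal_lie_algebra" using TX(2) by (simp add: Z_def)
  have X0A: "(p, X0) \<in> levi_civita"
    using levi_civita_fibre[OF c(1) p c(2)] unfolding X0_def by blast
  have X0: "X0 \<in> sub_tangent_space (frame_atlas \<A>) onframes p"
    using X0A by (simp add: levi_civita_def)
  have X1: "X1 \<in> sub_tangent_space (frame_atlas \<A>) onframes p"
    unfolding X1_def by (rule fundamental_vector_tangent(2)[OF c(1) p c(2) Z])
  have l: "linear (lc_form c ?z)" by (rule linear_lc_form[OF c(1) fchart_coordinate[OF c(2)]])
  define Y where "Y = X (fchart c) - (0, snd ?z ** Z)"
  have "lc_form c ?z Y = 0"
    using fundamental_vector_tangent(1)[OF c(1) p c(2) Z] by (simp add: Y_def linear_diff[OF l] Z_def[symmetric])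
  from lc_form_eq_0_imp[OF on this] have "X (fchart c) = horizontal_lift c ?z (fst (X (fchart c))) + (0, snd ?z ** Z)"
    by (simp add: Y_def diff_eq_eq)
  then have "X = ?V (horizontal_lift c ?z (fst (X (fchart c))) + (0, snd ?z ** Z))"
    using F.tangent_vector_eq_coord_vec[OF C c(2) TX(1)] by metis
  then have XX: "X = X0 + X1"
    unfolding X0_def X1_def fundamental_vector_frame[OF c] linear_add[OF F.linear_coord_vec[OF C c(2)]] .
  \<comment> \<open>Additivity of \<phi> is not a clause of \<open>connection_form\<close>; it is
    inherited from a smooth extension.\<close>
  obtain W \<beta> where ext: "local_extension (frame_atlas \<A>) onframes \<phi> p W \<beta>"
    using form p unfolding connection_form_def sub_smooth_one_form_def by blast
  have \<phi>\<beta>: "\<phi> p X' = \<beta> p X'" if "X' \<in> sub_tangent_space (frame_atlas \<A>) onframes p" for X'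
    using ext p that unfolding local_extension_def by blast
  have "\<beta> p (1 *\<^sub>R X0 + X1) = 1 *\<^sub>R \<beta> p X0 + \<beta> p X1"
    using ext sub_tangentD(1)[OF c(1) p c(2) X0] sub_tangentD(1)[OF c(1) p c(2) X1]
    unfolding local_extension_def smooth_one_form_def by blast
  then have "\<phi> p X = \<phi> p X0 + \<phi> p X1"
    using \<phi>\<beta>[OF X] \<phi>\<beta>[OF X0] \<phi>\<beta>[OF X1] XX by simp
  moreover have "\<phi> p X0 = 0" by (rule torsion_free_form_on_levi_civita[OF form T0 X0A])
  moreover have "\<phi> p X1 = Z" using form p Z unfolding connection_form_def X1_def by blast
  ultimately have "Z = 0" using \<phi>X by simp
  then show ?thesis
    using p X levi_civita_form_chart[OF c TX(1)] by (simp add: levi_civita_def Z_def)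
qed

lemma torsion_free_connection_unique:
  assumes conn: "frame_connection \<A> g A" and "torsion_free \<A> g A"
  shows "A = levi_civita"
proof -
  obtain \<phi> where form: "connection_form (frame_atlas \<A>) onframes orthogonal_lie_algebra right_action A \<phi>"
    and T0: "\<And>p X Y. p \<in> onframes \<Longrightarrow> X \<in> sub_tangent_space (frame_atlas \<A>) onframes p \<Longrightarrow>
      Y \<in> sub_tangent_space (frame_atlas \<A>) onframes p \<Longrightarrow> torsion \<A> g \<phi> p X Y = 0"
    using assms(2) unfolding torsion_free_def by blast
  have sub: "A \<subseteq> levi_civita"
    using torsion_free_connection_subset[OF conn form T0] by (simp add: subset_iff)
  \<comment> \<open>Both fibres project bijectively onto the same tangent space, so the inclusion of
    fibres is an equality.\<close>
  have "(p, X) \<in> A" if pX: "(p, X) \<in> levi_civita" for p X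
  proof -
    let ?\<pi> = "pushforward (frame_atlas \<A>) \<A> fst p"
    have p: "p \<in> onframes" using pX by (simp add: levi_civita_def)
    have bij: "bij_betw ?\<pi> (B `` {p}) (tangent_space \<A> (fst p))" if "frame_connection \<A> g B" for B
      using that p unfolding frame_connection_def principal_connection_def by blast
    have "?\<pi> X \<in> tangent_space \<A> (fst p)"
      using bij[OF frame_connection_levi_civita] pX unfolding bij_betw_def by blast
    then obtain X' where X': "X' \<in> A `` {p}" "?\<pi> X = ?\<pi> X'"
      using bij[OF conn] unfolding bij_betw_def by blast
    moreover have "X' \<in> levi_civita `` {p}" "X \<in> levi_civita `` {p}" using X'(1) sub pX by blast+
    ultimately have "X = X'"
      using bij[OF frame_connection_levi_civita] unfolding bij_betw_def by (meson inj_onD)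
    with X'(1) show ?thesis by blast
  qed
  with sub show ?thesis by auto
qed

end

theorem theorem2p5p5:
  fixes \<A> :: "('a, real^'n) chart set"
    and g :: "'a \<Rightarrow> ('a, real^'n) tvec \<Rightarrow> ('a, real^'n) tvec \<Rightarrow> real"
  assumes "riemannian_manifold \<A> g"
  shows "\<exists>!A. frame_connection \<A> g A \<and> torsion_free \<A> g A"
proof -
  interpret riemannian \<A> g by unfold_locales (rule assms)
  show ?thesis
    using frame_connection_levi_civita torsion_free_levi_civita torsion_free_connection_unique by blast
qed

end
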